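(* Let $S$ be a closed, connected, orientable surface and let $\Gamma\subset S$ be a (finite, nonempty) collection of disjoint embedded circles dividing $S$ into two regions, so that $$S\cong S_-\cup [-1,1]\times\Gamma\cup S_+,$$ where $S_\pm$ are two nonempty open submanifolds of $S$. Then there exist a smooth function $u:S\to\mathbb{R}$, an area form $\Omega$ and a compatible complex structure $j$ on $S$ so that $$d(du\circ j)=u\,\Omega,\qquad u^{-1}(0)=\Gamma,\qquad u^2+|du|^2>0.$$
   Context: In the decomposition $S\cong S_-\cup[-1,1]\times\Gamma\cup S_+$ the three pieces are pairwise disjoint, $[-1,1]\times\Gamma$ is an embedded closed tubular neighbourhood of $\Gamma$ in which $\Gamma$ is identified with $\{0\}\times\Gamma$, and the boundary of the closure of $S_-$ (resp. $S_+$) is $\{-1\}\times\Gamma$ (resp. $\{1\}\times\Gamma$). The regions $S_\pm$ need not be connected. A complex structure $j$ on $S$ is compatible with an area form $\Omega$ if $\Omega(\cdot,j\cdot)$ is a Riemannian metric on $S$; $|du|$ is the norm of $du$ in this metric. The one-form $du\circ j$ is $v\mapsto du(jv)$. *)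

theory Defs
  imports "HOL-Analysis.Analysis"
begin

fun Ck_on :: "nat \<Rightarrow> 'a::real_normed_vector set \<Rightarrow> ('a \<Rightarrow> 'b::real_normed_vector) \<Rightarrow> bool" where
  "Ck_on 0 N f \<longleftrightarrow> continuous_on N f"
| "Ck_on (Suc k) N f \<longleftrightarrow> (\<forall>x\<in>N. f differentiable (at x)) \<and>
     (\<forall>v. Ck_on k N (\<lambda>x. frechet_derivative f (at x) v))"

text \<open>On a set \<open>D\<close> that is not open (such as a closed strip), smoothness means the
  existence of local smooth extensions; for open \<open>D\<close> it is the usual notion.\<close>

definition smooth_on :: "'a::real_normed_vector set \<Rightarrow> ('a \<Rightarrow> 'b::real_normed_vector) \<Rightarrow> bool" where
  "smooth_on D f \<longleftrightarrow> (\<forall>x\<in>D. \<exists>N g. open N \<and> x \<in> N \<and> (\<forall>k. Ck_on k N g) \<and> (\<forall>y\<in>N \<inter> D. g y = f y))"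

type_synonym 'a chart = "'a set \<times> ('a \<Rightarrow> real^2)"

abbreviation chart_inv :: "'a chart \<Rightarrow> real^2 \<Rightarrow> 'a" where
  "chart_inv \<kappa> \<equiv> inv_into (fst \<kappa>) (snd \<kappa>)"

abbreviation chart_image :: "'a chart \<Rightarrow> (real^2) set" where
  "chart_image \<kappa> \<equiv> snd \<kappa> ` fst \<kappa>"

definition transition :: "'a chart \<Rightarrow> 'a chart \<Rightarrow> real^2 \<Rightarrow> real^2" where
  "transition \<kappa> \<mu> = snd \<mu> \<circ> chart_inv \<kappa>"

definition topological_chart :: "'a::t2_space set \<Rightarrow> 'a chart \<Rightarrow> bool" where
  "topological_chart S \<kappa> \<longleftrightarrow> openin (top_of_set S) (fst \<kappa>) \<and> open (chart_image \<kappa>) \<and>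
     homeomorphism (fst \<kappa>) (chart_image \<kappa>) (snd \<kappa>) (chart_inv \<kappa>)"

text \<open>Atlases are not required to be maximal: all notions below depend only on the smooth
  structure that the atlas generates.\<close>

definition smooth_atlas :: "'a::t2_space set \<Rightarrow> 'a chart set \<Rightarrow> bool" where
  "smooth_atlas S A \<longleftrightarrow> (\<forall>\<kappa>\<in>A. topological_chart S \<kappa>) \<and> S = (\<Union>\<kappa>\<in>A. fst \<kappa>) \<and>
     (\<forall>\<kappa>\<in>A. \<forall>\<mu>\<in>A. smooth_on (snd \<kappa> ` (fst \<kappa> \<inter> fst \<mu>)) (transition \<kappa> \<mu>))"

text \<open>The surface is Hausdorff because the ambient type is, it has no boundary because charts
  have open image in the plane, and it is second countable because it is compact and locally
  Euclidean.\<close>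

definition closed_surface :: "'a::t2_space set \<Rightarrow> 'a chart set \<Rightarrow> bool" where
  "closed_surface S A \<longleftrightarrow> smooth_atlas S A \<and> compact S"

definition oriented_atlas :: "'a::t2_space set \<Rightarrow> 'a chart set \<Rightarrow> bool" where
  "oriented_atlas S B \<longleftrightarrow> smooth_atlas S B \<and>
     (\<forall>\<kappa>\<in>B. \<forall>\<mu>\<in>B. \<forall>p\<in>fst \<kappa> \<inter> fst \<mu>.
        det (matrix (frechet_derivative (transition \<kappa> \<mu>) (at (snd \<kappa> p)))) > 0)"

text \<open>\<open>smooth_atlas S (A \<union> B)\<close> says that \<open>B\<close> defines the same smooth structure as \<open>A\<close>.\<close>

definition orientable :: "'a::t2_space set \<Rightarrow> 'a chart set \<Rightarrow> bool" where
  "orientable S A \<longleftrightarrow> (\<exists>B. oriented_atlas S B \<and> smooth_atlas S (A \<union> B))"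

definition smooth_function :: "'a chart set \<Rightarrow> ('a \<Rightarrow> real) \<Rightarrow> bool" where
  "smooth_function A u \<longleftrightarrow> (\<forall>\<kappa>\<in>A. smooth_on (chart_image \<kappa>) (u \<circ> chart_inv \<kappa>))"

definition smooth_into ::
    "'a::t2_space set \<Rightarrow> 'a chart set \<Rightarrow> 'b::real_normed_vector set \<Rightarrow> ('b \<Rightarrow> 'a) \<Rightarrow> bool" where
  "smooth_into S A D F \<longleftrightarrow> F ` D \<subseteq> S \<and> continuous_on D F \<and>
     (\<forall>\<kappa>\<in>A. smooth_on (D \<inter> F -` fst \<kappa>) (snd \<kappa> \<circ> F))"

definition smooth_immersion ::
    "'a::t2_space set \<Rightarrow> 'a chart set \<Rightarrow> 'b::real_normed_vector set \<Rightarrow> ('b \<Rightarrow> 'a) \<Rightarrow> bool" where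
  "smooth_immersion S A D F \<longleftrightarrow> smooth_into S A D F \<and>
     (\<forall>\<kappa>\<in>A. \<forall>x\<in>D. F x \<in> fst \<kappa> \<longrightarrow>
        (\<exists>L. ((snd \<kappa> \<circ> F) has_derivative L) (at x within D) \<and> inj L))"

text \<open>Maps defined on the unit circle (or on its product with an interval) are smooth, or
  immersions, iff they become so after composition with the covering \<open>cis\<close>. Since the sources
  are compact, an injective immersion is an embedding.\<close>

definition circle_embedding :: "'a::t2_space set \<Rightarrow> 'a chart set \<Rightarrow> (complex \<Rightarrow> 'a) \<Rightarrow> bool" where
  "circle_embedding S A c \<longleftrightarrow> inj_on c (sphere 0 1) \<and>
     smooth_immersion S A (UNIV :: real set) (\<lambda>\<theta>. c (cis \<theta>))"

definition embedded_circle :: "'a::t2_space set \<Rightarrow> 'a chart set \<Rightarrow> 'a set \<Rightarrow> bool" where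
  "embedded_circle S A C \<longleftrightarrow> (\<exists>c. circle_embedding S A c \<and> C = c ` sphere 0 1)"

text \<open>\<open>\<tau>\<close> embeds \<open>[-1,1] \<times> \<Union>\<C>\<close> into \<open>S\<close>, extending the inclusion of \<open>{0} \<times> \<Union>\<C>\<close>.\<close>

definition tubular_neighbourhood ::
    "'a::t2_space set \<Rightarrow> 'a chart set \<Rightarrow> 'a set set \<Rightarrow> (real \<times> 'a \<Rightarrow> 'a) \<Rightarrow> bool" where
  "tubular_neighbourhood S A \<C> \<tau> \<longleftrightarrow>
     inj_on \<tau> ({-1..1} \<times> \<Union>\<C>) \<and>
     (\<forall>p\<in>\<Union>\<C>. \<tau> (0, p) = p) \<and>
     (\<forall>C\<in>\<C>. \<exists>c. circle_embedding S A c \<and> C = c ` sphere 0 1 \<and>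
        smooth_immersion S A ({-1..1} \<times> (UNIV :: real set)) (\<lambda>(t, \<theta>). \<tau> (t, c (cis \<theta>))))"

text \<open>A tangent vector at \<open>p\<close> is the family of its coordinate representations in all charts
  around \<open>p\<close>, related by the derivatives of the transition maps. Entries for other charts are
  fixed to be \<open>0\<close>.\<close>

type_synonym 'a tvec = "'a chart \<Rightarrow> real^2"

definition tangent_space :: "'a chart set \<Rightarrow> 'a \<Rightarrow> 'a tvec set" where
  "tangent_space A p = {v.
     (\<forall>\<kappa>\<in>A. \<forall>\<mu>\<in>A. p \<in> fst \<kappa> \<inter> fst \<mu> \<longrightarrow>
        v \<mu> = frechet_derivative (transition \<kappa> \<mu>) (at (snd \<kappa> p)) (v \<kappa>)) \<and>
     (\<forall>\<kappa>. \<not> (\<kappa> \<in> A \<and> p \<in> fst \<kappa>) \<longrightarrow> v \<kappa> = 0)}"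

definition tcomb :: "real \<Rightarrow> 'a tvec \<Rightarrow> real \<Rightarrow> 'a tvec \<Rightarrow> 'a tvec" where
  "tcomb a v b w = (\<lambda>\<kappa>. a *\<^sub>R v \<kappa> + b *\<^sub>R w \<kappa>)"

text \<open>The tangent vector at \<open>p\<close> whose representation in the chart \<open>\<kappa>\<close> is \<open>e\<close>.\<close>

definition coord_vec :: "'a chart set \<Rightarrow> 'a chart \<Rightarrow> 'a \<Rightarrow> real^2 \<Rightarrow> 'a tvec" where
  "coord_vec A \<kappa> p e = (\<lambda>\<mu>. if \<mu> \<in> A \<and> p \<in> fst \<mu>
     then frechet_derivative (transition \<kappa> \<mu>) (at (snd \<kappa> p)) e else 0)"

definition coord_field :: "'a chart set \<Rightarrow> 'a chart \<Rightarrow> 2 \<Rightarrow> 'a \<Rightarrow> 'a tvec" where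
  "coord_field A \<kappa> i p = coord_vec A \<kappa> p (axis i 1)"

text \<open>By the chain rule, the differential and the exterior derivative below do not depend on
  the choice of chart.\<close>

definition chart_at :: "'a chart set \<Rightarrow> 'a \<Rightarrow> 'a chart" where
  "chart_at A p = (SOME \<kappa>. \<kappa> \<in> A \<and> p \<in> fst \<kappa>)"

type_synonym 'a form1 = "'a \<Rightarrow> 'a tvec \<Rightarrow> real"
type_synonym 'a bilin = "'a \<Rightarrow> 'a tvec \<Rightarrow> 'a tvec \<Rightarrow> real"
type_synonym 'a endo = "'a \<Rightarrow> 'a tvec \<Rightarrow> 'a tvec"

definition differential :: "'a chart set \<Rightarrow> ('a \<Rightarrow> real) \<Rightarrow> 'a form1" where
  "differential A u p v = (let \<kappa> = chart_at A p in
     frechet_derivative (u \<circ> chart_inv \<kappa>) (at (snd \<kappa> p)) (v \<kappa>))"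

definition comp_endo :: "'a form1 \<Rightarrow> 'a endo \<Rightarrow> 'a form1" where
  "comp_endo \<alpha> j p v = \<alpha> p (j p v)"

text \<open>This is \<open>d\<alpha>(V, W) = V(\<alpha>(W)) - W(\<alpha>(V)) - \<alpha>([V, W])\<close> for the extensions \<open>V\<close>, \<open>W\<close> of
  \<open>v\<close>, \<open>w\<close> with constant coefficients in the chart, for which \<open>[V, W] = 0\<close>.\<close>

definition ext_deriv :: "'a chart set \<Rightarrow> 'a form1 \<Rightarrow> 'a bilin" where
  "ext_deriv A \<alpha> p v w = (let \<kappa> = chart_at A p;
       pairing = (\<lambda>e x. \<alpha> (chart_inv \<kappa> x) (coord_vec A \<kappa> (chart_inv \<kappa> x) e)) in
     frechet_derivative (pairing (w \<kappa>)) (at (snd \<kappa> p)) (v \<kappa>) -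
     frechet_derivative (pairing (v \<kappa>)) (at (snd \<kappa> p)) (w \<kappa>))"

definition smooth_bilinear_field :: "'a chart set \<Rightarrow> 'a set \<Rightarrow> 'a bilin \<Rightarrow> bool" where
  "smooth_bilinear_field A S B \<longleftrightarrow>
     (\<forall>p\<in>S. \<forall>v\<in>tangent_space A p. \<forall>w\<in>tangent_space A p. \<forall>z\<in>tangent_space A p. \<forall>a b.
        B p (tcomb a v b w) z = a * B p v z + b * B p w z \<and>
        B p z (tcomb a v b w) = a * B p z v + b * B p z w) \<and>
     (\<forall>\<kappa>\<in>A. \<forall>i k. smooth_on (chart_image \<kappa>)
        ((\<lambda>p. B p (coord_field A \<kappa> i p) (coord_field A \<kappa> k p)) \<circ> chart_inv \<kappa>))"

text \<open>An area form is a nowhere vanishing smooth 2-form.\<close>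

definition area_form :: "'a set \<Rightarrow> 'a chart set \<Rightarrow> 'a bilin \<Rightarrow> bool" where
  "area_form S A \<Omega> \<longleftrightarrow> smooth_bilinear_field A S \<Omega> \<and>
     (\<forall>p\<in>S. \<forall>v\<in>tangent_space A p. \<Omega> p v v = 0) \<and>
     (\<forall>p\<in>S. \<exists>v\<in>tangent_space A p. \<exists>w\<in>tangent_space A p. \<Omega> p v w \<noteq> 0)"

definition riemannian_metric :: "'a set \<Rightarrow> 'a chart set \<Rightarrow> 'a bilin \<Rightarrow> bool" where
  "riemannian_metric S A g \<longleftrightarrow> smooth_bilinear_field A S g \<and>
     (\<forall>p\<in>S. \<forall>v\<in>tangent_space A p. \<forall>w\<in>tangent_space A p. g p v w = g p w v) \<and>
     (\<forall>p\<in>S. \<forall>v\<in>tangent_space A p. v \<noteq> (\<lambda>_. 0) \<longrightarrow> g p v v > 0)"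

text \<open>In real dimension two every smooth \<open>j\<close> with \<open>j\<^sup>2 = -1\<close> is integrable.\<close>

definition complex_structure :: "'a set \<Rightarrow> 'a chart set \<Rightarrow> 'a endo \<Rightarrow> bool" where
  "complex_structure S A j \<longleftrightarrow>
     (\<forall>p\<in>S. \<forall>v\<in>tangent_space A p. j p v \<in> tangent_space A p \<and> j p (j p v) = (\<lambda>\<kappa>. - v \<kappa>)) \<and>
     (\<forall>p\<in>S. \<forall>v\<in>tangent_space A p. \<forall>w\<in>tangent_space A p. \<forall>a b.
        j p (tcomb a v b w) = tcomb a (j p v) b (j p w)) \<and>
     (\<forall>\<kappa>\<in>A. \<forall>i. smooth_on (chart_image \<kappa>)
        ((\<lambda>p. j p (coord_field A \<kappa> i p) \<kappa>) \<circ> chart_inv \<kappa>))"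

definition metric_of :: "'a bilin \<Rightarrow> 'a endo \<Rightarrow> 'a bilin" where
  "metric_of \<Omega> j p v w = \<Omega> p v (j p w)"

definition compatible :: "'a set \<Rightarrow> 'a chart set \<Rightarrow> 'a bilin \<Rightarrow> 'a endo \<Rightarrow> bool" where
  "compatible S A \<Omega> j \<longleftrightarrow> riemannian_metric S A (metric_of \<Omega> j)"

definition covector_norm :: "'a chart set \<Rightarrow> 'a bilin \<Rightarrow> 'a form1 \<Rightarrow> 'a \<Rightarrow> real" where
  "covector_norm A g \<alpha> p = (SUP v\<in>{v \<in> tangent_space A p. g p v v \<le> 1}. \<bar>\<alpha> p v\<bar>)"

end

theory Submission
  imports Defs
begin

text \<open>Let \<open>L\<close> be minus the Laplace-Beltrami operator of a Riemannian metric with rotation \<open>j\<close> and area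
  form \<open>dA\<close>. Then \<open>d(du \<circ> j) = (L u) dA\<close>, so it suffices to find a metric and a function \<open>u\<close>
  with regular zero set \<open>\<Gamma>\<close> such that \<open>L u = f u\<close> for a smooth \<open>f > 0\<close>, and to take \<open>\<Omega> = f dA\<close>.

  The metric is pulled back from a Euclidean space and equals \<open>dt\<^sup>2 + d\<theta>\<^sup>2\<close> on a collar of \<open>\<Gamma>\<close>. There
  \<open>h(t)\<close> satisfies \<open>L h(t) = - h''(t)\<close>; we take \<open>h = sin\<close> near \<open>0\<close>, with \<open>- h''\<close> of the sign of \<open>t\<close>, and
  \<open>h\<close> locally constant away from \<open>0\<close>, so that \<open>h(t)\<close> extends to the surface. Away from the collar
  its Laplacian vanishes, and the correct strict sign is restored by adding \<open>\<epsilon> w\<close> on the positive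
  side and \<open>- \<epsilon> w\<close> on the negative side, where \<open>w = 0\<close> near \<open>\<Gamma>\<close> and \<open>L w > 0\<close> outside a compact part
  of the collar on which \<open>- h''\<close> dominates.

  The function \<open>w\<close> is obtained by sweeping: a Hopf barrier in a chart gives, for nearby points
  \<open>p\<close> and \<open>q\<close>, a compactly supported function with \<open>L \<ge> 0\<close> except near \<open>q\<close> and \<open>L > 0\<close> at \<open>p\<close>. Hence
  the defect can be pushed from chart to chart, and by connectedness of the surface all the way
  into the collar.\<close>

section \<open>Smooth maps between Euclidean spaces\<close>

text \<open>On a closed surface the integral of \<open>L w\<close> vanishes, so no \<open>w\<close>
  has \<open>L w > 0\<close> everywhere. Sweeping can move the defect but never remove it, and the
  defect needs a place where another term pays for it: the inside of the collar, where
  \<open>- h''\<close> has a strict sign. The second obstacle is the quotient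
  \<open>f = L u / u\<close>, which must be smooth and positive across \<Gamma>. With
  \<open>u = sin t\<close> and a flat metric near \<Gamma> it is identically \<open>1\<close> there,
  so \<open>w\<close> is kept away from this zone. The levels of \<open>|t|\<close> are nested
  accordingly: \<open>u = sin t\<close> below \<open>1/8\<close>, the defect of \<open>w\<close>
  between \<open>1/8\<close> and \<open>3/8\<close>, \<open>h\<close> constant from
  \<open>1/2\<close> on, the metric flat below \<open>5/8\<close>, the collar functions cut off only
  beyond \<open>7/8\<close>. Reversing the orientation changes the sign of both
  \<open>du \<circ> j\<close> and \<open>dA\<close>, hence leaves \<open>L\<close> unchanged. The
  analysis can therefore be done with unoriented charts, and the orientation enters only when
  \<open>j\<close> and \<Omega> are defined.\<close>

lemma frechet_derivative_eqI: "(f has_derivative f') (at x) \<Longrightarrow> frechet_derivative f (at x) = f'"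
  using frechet_derivative_at by metis

lemma frechet_derivative_cong_open:
  assumes "open N" "x \<in> N" "\<And>y. y \<in> N \<Longrightarrow> f y = g y"
  shows "frechet_derivative f (at x) = frechet_derivative g (at x)"
proof -
  have "(f has_derivative D) (at x) \<longleftrightarrow> (g has_derivative D) (at x)" for D
    using assms has_derivative_transform_within_open[of _ D x UNIV N] by metis
  then show ?thesis
    by (simp add: frechet_derivative_def)
qed

lemma differentiable_cong_open:
  assumes "open N" "x \<in> N" "\<And>y. y \<in> N \<Longrightarrow> f y = g y"
  shows "f differentiable (at x) \<longleftrightarrow> g differentiable (at x)"
  using assms has_derivative_transform_within_open[of _ _ x UNIV N]
  unfolding differentiable_def by metis

lemma Ck_on_cong:
  assumes "open N" "\<And>y. y \<in> N \<Longrightarrow> f y = g y"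
  shows "Ck_on k N f \<longleftrightarrow> Ck_on k N g"
  using assms
proof (induction k arbitrary: f g)
  case 0
  then show ?case by (simp cong: continuous_on_cong)
next
  case (Suc k)
  have "Ck_on k N (\<lambda>x. frechet_derivative f (at x) v) \<longleftrightarrow> Ck_on k N (\<lambda>x. frechet_derivative g (at x) v)"
    for v
    by (rule Suc.IH) (use Suc.prems frechet_derivative_cong_open in metis)+
  moreover have "(\<forall>x\<in>N. f differentiable (at x)) \<longleftrightarrow> (\<forall>x\<in>N. g differentiable (at x))"
    using Suc.prems differentiable_cong_open by metis
  ultimately show ?case by simp
qed

lemma Ck_on_SucD: "Ck_on (Suc k) N f \<Longrightarrow> Ck_on k N f"
proof (induction k arbitrary: f)
  case 0
  then show ?case
    by (auto intro!: continuous_at_imp_continuous_on differentiable_imp_continuous_within)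
next
  case (Suc k)
  have "Ck_on k N (\<lambda>x. frechet_derivative f (at x) v)" for v
    by (rule Suc.IH) (use Suc.prems in simp)
  then show ?case using Suc.prems by simp
qed

lemma Ck_on_subset: "Ck_on k N f \<Longrightarrow> M \<subseteq> N \<Longrightarrow> Ck_on k M f"
  by (induction k arbitrary: f) (auto intro: continuous_on_subset)

lemma Ck_on_open_cover:
  assumes "\<And>x. x \<in> U \<Longrightarrow> \<exists>V. open V \<and> x \<in> V \<and> Ck_on k V f"
  shows "Ck_on k U f"
  using assms
proof (induction k arbitrary: f)
  case 0
  then have "\<forall>x\<in>U. isCont f x"
    by (metis Ck_on.simps(1) continuous_on_eq_continuous_at)
  then show ?case by (simp add: continuous_at_imp_continuous_on)
next
  case (Suc k)
  have "Ck_on k U (\<lambda>x. frechet_derivative f (at x) v)" for v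
    by (rule Suc.IH) (use Suc.prems in fastforce)
  then show ?case using Suc.prems by fastforce
qed

lemma Ck_on_bounded_linear:
  assumes "bounded_linear f" shows "Ck_on k N f"
proof -
  have const: "Ck_on k N (\<lambda>x. c)" for k c
    by (induction k arbitrary: c) (auto simp: frechet_derivative_const)
  have "frechet_derivative f (at x) = f" for x
    using assms by (intro frechet_derivative_eqI bounded_linear_imp_has_derivative)
  then show ?thesis
    using assms const by (cases k) (auto simp: linear_continuous_on bounded_linear_imp_differentiable)
qed

lemma Ck_on_const: "Ck_on k N (\<lambda>x. c)"
  by (induction k arbitrary: c) (auto simp: frechet_derivative_const)

lemma Ck_on_add:
  assumes "open N" "Ck_on k N f" "Ck_on k N g"
  shows "Ck_on k N (\<lambda>x. f x + g x)"
  using assms(2,3)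
proof (induction k arbitrary: f g)
  case 0
  then show ?case by (auto intro: continuous_intros)
next
  case (Suc k)
  have "frechet_derivative (\<lambda>x. f x + g x) (at x) v
      = frechet_derivative f (at x) v + frechet_derivative g (at x) v" if "x \<in> N" for x v
    using Suc.prems that
    by (subst frechet_derivative_eqI[OF has_derivative_add]) (auto simp: frechet_derivative_works)
  then have "Ck_on k N (\<lambda>x. frechet_derivative (\<lambda>x. f x + g x) (at x) v)" for v
    using Suc by (subst Ck_on_cong[OF \<open>open N\<close>]) auto
  then show ?case using Suc.prems by (auto intro: differentiable_add)
qed

lemma (in bounded_bilinear) Ck_on_prod:
  assumes "open N" "Ck_on k N f" "Ck_on k N g"
  shows "Ck_on k N (\<lambda>x. prod (f x) (g x))"
  using assms(2,3)
proof (induction k arbitrary: f g)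
  case 0
  then show ?case by (auto intro: continuous_on)
next
  case (Suc k)
  have D: "((\<lambda>x. prod (f x) (g x)) has_derivative
      (\<lambda>v. prod (f x) (frechet_derivative g (at x) v) + prod (frechet_derivative f (at x) v) (g x)))
        (at x)"
    if "x \<in> N" for x
    using Suc.prems that by (intro FDERIV) (auto simp: frechet_derivative_works)
  have "Ck_on k N (\<lambda>x. prod (f x) (frechet_derivative g (at x) v) + prod (frechet_derivative f (at
    x) v) (g x))" for v
    using Suc.prems Ck_on_SucD[OF Suc.prems(1)] Ck_on_SucD[OF Suc.prems(2)]
    by (intro Ck_on_add[OF \<open>open N\<close>] Suc.IH) auto
  then have "Ck_on k N (\<lambda>x. frechet_derivative (\<lambda>x. prod (f x) (g x)) (at x) v)" for v
    by (rule Ck_on_cong[OF \<open>open N\<close>, THEN iffD1, rotated]) (simp add: frechet_derivative_eqI[OF D])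
  then show ?case using D by (auto simp: differentiable_def)
qed

lemma Ck_on_sum:
  assumes "open N" "\<And>i. i \<in> I \<Longrightarrow> Ck_on k N (f i)"
  shows "Ck_on k N (\<lambda>x. \<Sum>i\<in>I. f i x)"
  using assms(2)
  by (induction I rule: infinite_finite_induct) (auto intro: Ck_on_add[OF \<open>open N\<close>] Ck_on_const)

text \<open>The derivative is a composition of linear maps that both vary with the point. Expanding
  the inner vector in \<open>Basis\<close> turns it into a finite sum of products of functions of
  class \<open>k\<close>, to which the product rule and the induction hypothesis apply; this is what
  the Euclidean type of the middle space is for.\<close>

lemma Ck_on_compose:
  fixes f :: "'a::real_normed_vector \<Rightarrow> 'b::euclidean_space" and g :: "'b \<Rightarrow> 'c::real_normed_vector"
  assumes "open U" "open V" "f ` U \<subseteq> V" "Ck_on k U f" "Ck_on k V g"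
  shows "Ck_on k U (\<lambda>x. g (f x))"
  using assms(4,5)
proof (induction k arbitrary: g)
  case 0
  then show ?case using assms by (auto intro: continuous_on_compose2)
next
  case (Suc k)
  have fU: "f x \<in> V" if "x \<in> U" for x using assms that by auto
  have D: "((\<lambda>x. g (f x)) has_derivative
      (\<lambda>v. frechet_derivative g (at (f x)) (frechet_derivative f (at x) v))) (at x)" if "x \<in> U" for x
    using Suc.prems that fU
    by (intro has_derivative_compose[where f=f and g=g]) (auto simp: frechet_derivative_works)
  have lin: "linear (frechet_derivative g (at (f x)))" if "x \<in> U" for x
    using Suc.prems(2) fU[OF that] by (intro linear_frechet_derivative) simp
  have rep: "frechet_derivative g (at (f x)) w
      = (\<Sum>b\<in>Basis. (w \<bullet> b) *\<^sub>R frechet_derivative g (at (f x)) b)" if "x \<in> U" for x w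
    using linear_sum[OF lin[OF that], of "\<lambda>b. (w \<bullet> b) *\<^sub>R b" Basis] lin[OF that]
    by (simp add: euclidean_representation linear_cmul)
  have "Ck_on k U (\<lambda>x. \<Sum>b\<in>Basis. (frechet_derivative f (at x) v \<bullet> b) *\<^sub>R frechet_derivative g (at (f
    x)) b)" for v
  proof (intro Ck_on_sum \<open>open U\<close> bounded_bilinear.Ck_on_prod[OF bounded_bilinear_scaleR]
      bounded_bilinear.Ck_on_prod[OF bounded_bilinear_inner] Ck_on_const)
    show "Ck_on k U (\<lambda>x. frechet_derivative f (at x) v)" using Suc.prems by simp
    show "Ck_on k U (\<lambda>x. frechet_derivative g (at (f x)) b)" for b
      by (rule Suc.IH) (use Suc.prems Ck_on_SucD in auto)
  qed
  then have "Ck_on k U (\<lambda>x. frechet_derivative (\<lambda>x. g (f x)) (at x) v)" for v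
    by (rule Ck_on_cong[OF \<open>open U\<close>, THEN iffD1, rotated]) (simp add: frechet_derivative_eqI[OF D]
    flip: rep)
  then show ?case using D by (auto simp: differentiable_def)
qed

text \<open>Plain smoothness without local extensions, to be used on open sets, where it agrees with
  \<open>smooth_on\<close>.\<close>

definition Cinf_on :: "'a::real_normed_vector set \<Rightarrow> ('a \<Rightarrow> 'b::real_normed_vector) \<Rightarrow> bool" where
  "Cinf_on U f \<longleftrightarrow> (\<forall>k. Ck_on k U f)"

lemma Cinf_on_cong: "open N \<Longrightarrow> (\<And>y. y \<in> N \<Longrightarrow> f y = g y) \<Longrightarrow> Cinf_on N f \<longleftrightarrow> Cinf_on N g"
  unfolding Cinf_on_def using Ck_on_cong by metis

lemma Cinf_on_subset: "Cinf_on N f \<Longrightarrow> M \<subseteq> N \<Longrightarrow> Cinf_on M f"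
  unfolding Cinf_on_def using Ck_on_subset by metis

lemma Cinf_on_open_cover:
  assumes "\<And>x. x \<in> U \<Longrightarrow> \<exists>V. open V \<and> x \<in> V \<and> Cinf_on V f"
  shows "Cinf_on U f"
  unfolding Cinf_on_def using assms Ck_on_open_cover Cinf_on_def by metis

lemma smooth_on_iff_Cinf_on:
  assumes "open U" shows "smooth_on U f \<longleftrightarrow> Cinf_on U f"
proof
  assume "smooth_on U f"
  show "Cinf_on U f"
  proof (rule Cinf_on_open_cover)
    fix x assume "x \<in> U"
    with \<open>smooth_on U f\<close> obtain N g where N: "open N" "x \<in> N" "Cinf_on N g" "\<forall>y\<in>N \<inter> U. g y = f y"
      unfolding smooth_on_def Cinf_on_def by metis
    then have "Cinf_on (N \<inter> U) f"
      using Cinf_on_cong[of "N \<inter> U" f g] Cinf_on_subset[of N g "N \<inter> U"] assms by auto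
    then show "\<exists>V. open V \<and> x \<in> V \<and> Cinf_on V f"
      using N \<open>x \<in> U\<close> assms by blast
  qed
next
  assume "Cinf_on U f" then show "smooth_on U f"
    unfolding smooth_on_def Cinf_on_def using assms by blast
qed

lemma Cinf_on_const: "Cinf_on U (\<lambda>x. c)"
  and Cinf_on_bounded_linear: "bounded_linear f \<Longrightarrow> Cinf_on U f"
  and Cinf_on_add: "open U \<Longrightarrow> Cinf_on U g \<Longrightarrow> Cinf_on U g' \<Longrightarrow> Cinf_on U (\<lambda>x. g x + g' x)"
  by (simp_all add: Cinf_on_def Ck_on_const Ck_on_bounded_linear Ck_on_add)

lemma Cinf_on_bilinear:
  "bounded_bilinear B \<Longrightarrow> open U \<Longrightarrow> Cinf_on U g \<Longrightarrow> Cinf_on U g' \<Longrightarrow> Cinf_on U (\<lambda>x. B (g x) (g' x))"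
  by (simp add: Cinf_on_def bounded_bilinear.Ck_on_prod)

lemmas Cinf_on_mult = Cinf_on_bilinear[OF bounded_bilinear_mult]
lemmas Cinf_on_scaleR = Cinf_on_bilinear[OF bounded_bilinear_scaleR]

lemma Cinf_on_compose:
  fixes f :: "'a::real_normed_vector \<Rightarrow> 'b::euclidean_space" and g :: "'b \<Rightarrow> 'c::real_normed_vector"
  shows "open U \<Longrightarrow> open V \<Longrightarrow> f ` U \<subseteq> V \<Longrightarrow> Cinf_on U f \<Longrightarrow> Cinf_on V g \<Longrightarrow> Cinf_on U (\<lambda>x. g (f x))"
  unfolding Cinf_on_def using Ck_on_compose by metis

lemma Cinf_on_minus: "open U \<Longrightarrow> Cinf_on U f \<Longrightarrow> Cinf_on U (\<lambda>x. - f x)"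
  using Cinf_on_scaleR[of U "\<lambda>x. -1" f] by (simp add: Cinf_on_const)

lemma Cinf_on_diff: "open U \<Longrightarrow> Cinf_on U f \<Longrightarrow> Cinf_on U g \<Longrightarrow> Cinf_on U (\<lambda>x. f x - g x)"
  using Cinf_on_add[of U f "\<lambda>x. - g x"] Cinf_on_minus[of U g] by simp

lemma Cinf_on_iff_derivative:
  "Cinf_on U f \<longleftrightarrow> (\<forall>x\<in>U. f differentiable (at x)) \<and> (\<forall>v. Cinf_on U (\<lambda>x. frechet_derivative f (at x) v))"
proof
  assume f: "Cinf_on U f"
  then have "Ck_on (Suc k) U f" for k unfolding Cinf_on_def by blast
  then show "(\<forall>x\<in>U. f differentiable (at x)) \<and> (\<forall>v. Cinf_on U (\<lambda>x. frechet_derivative f (at x) v))"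
    unfolding Cinf_on_def by simp
next
  assume "(\<forall>x\<in>U. f differentiable (at x)) \<and> (\<forall>v. Cinf_on U (\<lambda>x. frechet_derivative f (at x) v))"
  then have "Ck_on (Suc k) U f" for k unfolding Cinf_on_def by simp
  then show "Cinf_on U f" unfolding Cinf_on_def using Ck_on_SucD by blast
qed

lemma Cinf_on_differentiable: "Cinf_on U f \<Longrightarrow> x \<in> U \<Longrightarrow> f differentiable (at x)"
  using Cinf_on_iff_derivative by blast

lemma Cinf_on_continuous: "Cinf_on U f \<Longrightarrow> continuous_on U f"
  unfolding Cinf_on_def by (metis Ck_on.simps(1))

lemma Cinf_on_frechet_derivative: "Cinf_on U f \<Longrightarrow> Cinf_on U (\<lambda>x. frechet_derivative f (at x) v)"
  using Cinf_on_iff_derivative by blast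

section \<open>Smoothness of elementary functions of one variable\<close>

lemma Ck_on_DERIV:
  fixes f f' :: "real \<Rightarrow> real"
  assumes "open U" "\<And>x. x \<in> U \<Longrightarrow> (f has_real_derivative f' x) (at x)" "Ck_on k U f'"
  shows "Ck_on (Suc k) U f"
proof -
  have D: "f differentiable (at x)" "frechet_derivative f (at x) v = f' x * v" if "x \<in> U" for x v
    using assms(2)[OF that] unfolding has_field_derivative_def
    by (auto simp: differentiable_def frechet_derivative_eqI)
  have "Ck_on k U (\<lambda>x. f' x * v)" for v
    by (intro bounded_bilinear.Ck_on_prod[OF bounded_bilinear_mult] assms Ck_on_const)
  then have "Ck_on k U (\<lambda>x. frechet_derivative f (at x) v)" for v
    using D by (subst Ck_on_cong[OF \<open>open U\<close>]) auto
  then show ?thesis using D by simp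
qed

lemma Cinf_on_DERIV:
  fixes f f' :: "real \<Rightarrow> real"
  assumes "open U" "\<And>x. x \<in> U \<Longrightarrow> (f has_real_derivative f' x) (at x)" "Cinf_on U f'"
  shows "Cinf_on U f"
  using Ck_on_DERIV[OF assms(1,2)] assms(3) unfolding Cinf_on_def by (metis Ck_on_SucD)

text \<open>The derivative is a polynomial in \<open>inverse\<close> itself, so each order of
  differentiability yields the next. The same bootstrap serves \<open>sqrt\<close>, and
  \<open>sin\<close> and \<open>cos\<close> jointly.\<close>

lemma Cinf_on_inverse: "Cinf_on (- {0::real}) inverse"
proof -
  have "Ck_on k (- {0::real}) inverse" for k
  proof (induction k)
    case 0 show ?case by (auto intro!: continuous_on_inverse continuous_on_id)
  next
    case (Suc k)
    show ?case
    proof (rule Ck_on_DERIV)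
      show "(inverse has_real_derivative (-1) * (inverse x * inverse x)) (at x)" if "x \<in> - {0}" for x
        using that by (auto intro!: derivative_eq_intros)
      show "Ck_on k (- {0::real}) (\<lambda>x. -1 * (inverse x * inverse x))"
        by (intro bounded_bilinear.Ck_on_prod[OF bounded_bilinear_mult] Suc Ck_on_const) auto
    qed auto
  qed
  then show ?thesis by (simp add: Cinf_on_def)
qed

lemma Cinf_on_sqrt: "Cinf_on {0<..} sqrt"
proof -
  have "Ck_on k {0<..} sqrt" for k
  proof (induction k)
    case 0 show ?case by (auto intro!: continuous_intros)
  next
    case (Suc k)
    show ?case
    proof (rule Ck_on_DERIV)
      show "(sqrt has_real_derivative inverse (sqrt x) * (1/2)) (at x)" if "x \<in> {0<..}" for x
        using that DERIV_real_sqrt[of x] by (simp add: mult.commute)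
      have "Ck_on k {0<..} (\<lambda>x. inverse (sqrt x))"
        by (rule Ck_on_compose[where V="- {0}"]) (use Suc Cinf_on_inverse in \<open>auto simp: Cinf_on_def\<close>)
      then show "Ck_on k {0<..} (\<lambda>x. inverse (sqrt x) * (1/2))"
        by (intro bounded_bilinear.Ck_on_prod[OF bounded_bilinear_mult] Ck_on_const) auto
    qed auto
  qed
  then show ?thesis by (simp add: Cinf_on_def)
qed

lemma Cinf_on_sin_cos: "Cinf_on UNIV (sin :: real \<Rightarrow> real)" "Cinf_on UNIV (cos :: real \<Rightarrow> real)"
proof -
  have "Ck_on k UNIV (sin :: real \<Rightarrow> real) \<and> Ck_on k UNIV (cos :: real \<Rightarrow> real)" for k
  proof (induction k)
    case 0 show ?case by (auto intro!: continuous_intros)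
  next
    case (Suc k)
    have "Ck_on k UNIV (\<lambda>x::real. (-1) * sin x)"
      by (intro bounded_bilinear.Ck_on_prod[OF bounded_bilinear_mult] Ck_on_const) (use Suc in auto)
    then show ?case
      using Ck_on_DERIV[of UNIV sin cos k] Ck_on_DERIV[of UNIV cos "\<lambda>x. -1 * sin x" k] Suc
      by (auto simp del: Ck_on.simps intro: derivative_eq_intros)
  qed
  then show "Cinf_on UNIV (sin :: real \<Rightarrow> real)" "Cinf_on UNIV (cos :: real \<Rightarrow> real)"
    by (simp_all add: Cinf_on_def)
qed

section \<open>Mixed derivatives and smooth inverses\<close>

text \<open>The second difference is an increment along \<open>w\<close> of an increment along
  \<open>v\<close>. The mean value theorem in direction \<open>v\<close> and then in direction
  \<open>w\<close> rewrites it as a mixed derivative at some point of the parallelogram, while the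
  second difference itself is symmetric in \<open>v\<close> and \<open>w\<close>.\<close>

lemma second_difference_quotient:
  fixes f :: "'a::real_normed_vector \<Rightarrow> real"
  assumes f: "Cinf_on U f" and "0 < h"
    and inU: "\<And>s r. s \<in> {0..h} \<Longrightarrow> r \<in> {0..h} \<Longrightarrow> x + s *\<^sub>R v + r *\<^sub>R w \<in> U"
  shows "\<exists>s\<in>{0..h}. \<exists>r\<in>{0..h}.
    f (x + h *\<^sub>R v + h *\<^sub>R w) - f (x + h *\<^sub>R v) - f (x + h *\<^sub>R w) + f x
    = h * h * frechet_derivative (\<lambda>y. frechet_derivative f (at y) v) (at (x + s *\<^sub>R v + r *\<^sub>R w)) w"
proof -
  define D where "D y = frechet_derivative f (at y) v" for y
  have D: "Cinf_on U D" unfolding D_def using f by (rule Cinf_on_frechet_derivative)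
  have line: "((\<lambda>s. g (c + s *\<^sub>R d)) has_real_derivative frechet_derivative g (at (c + s *\<^sub>R d)) d)
    (at s)"
    if "Cinf_on U g" "c + s *\<^sub>R d \<in> U" for g :: "'a \<Rightarrow> real" and c d s
  proof -
    have g: "(g has_derivative frechet_derivative g (at (c + s *\<^sub>R d))) (at (c + s *\<^sub>R d))"
      using Cinf_on_differentiable[OF that] by (simp add: frechet_derivative_works)
    have "((\<lambda>s. g (c + s *\<^sub>R d)) has_derivative (\<lambda>r. frechet_derivative g (at (c + s *\<^sub>R d)) (r *\<^sub>R
      d))) (at s)"
      by (rule has_derivative_compose[where f="\<lambda>s. c + s *\<^sub>R d" and g=g, OF _ g]) (auto intro!:
      derivative_eq_intros)
    moreover have "frechet_derivative g (at (c + s *\<^sub>R d)) (r *\<^sub>R d) = frechet_derivative g (at (c +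
      s *\<^sub>R d)) d * r" for r
      using linear_cmul[OF has_derivative_linear[OF g]] by simp
    ultimately show ?thesis by (simp add: has_field_derivative_def)
  qed
  have "\<exists>s. 0 < s \<and> s < h \<and>
     (f (x + h *\<^sub>R w + h *\<^sub>R v) - f (x + h *\<^sub>R v)) - (f (x + h *\<^sub>R w + 0 *\<^sub>R v) - f (x + 0 *\<^sub>R v))
     = (h - 0) * (D (x + h *\<^sub>R w + s *\<^sub>R v) - D (x + s *\<^sub>R v))"
  proof (rule MVT2[OF \<open>0 < h\<close>])
    fix s assume s: "0 \<le> s" "s \<le> h"
    have 1: "x + h *\<^sub>R w + s *\<^sub>R v \<in> U" using inU[of s h] s \<open>0 < h\<close> by (simp add: algebra_simps)
    have 2: "x + s *\<^sub>R v \<in> U" using inU[of s 0] s \<open>0 < h\<close> by simp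
    show "((\<lambda>s. f (x + h *\<^sub>R w + s *\<^sub>R v) - f (x + s *\<^sub>R v)) has_real_derivative
       D (x + h *\<^sub>R w + s *\<^sub>R v) - D (x + s *\<^sub>R v)) (at s)"
      unfolding D_def by (intro DERIV_diff line f 1 2)
  qed
  then obtain s where s: "0 < s" "s < h" and
    eq1: "f (x + h *\<^sub>R v + h *\<^sub>R w) - f (x + h *\<^sub>R v) - f (x + h *\<^sub>R w) + f x
     = h * (D (x + s *\<^sub>R v + h *\<^sub>R w) - D (x + s *\<^sub>R v))"
    by (auto simp: algebra_simps)
  have "\<exists>r. 0 < r \<and> r < h \<and> D (x + s *\<^sub>R v + h *\<^sub>R w) - D (x + s *\<^sub>R v + 0 *\<^sub>R w)
     = (h - 0) * frechet_derivative D (at (x + s *\<^sub>R v + r *\<^sub>R w)) w"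
    by (rule MVT2[OF \<open>0 < h\<close>]) (use s in \<open>intro line D inU, auto\<close>)
  then obtain r where r: "0 < r" "r < h" and
    eq2: "D (x + s *\<^sub>R v + h *\<^sub>R w) - D (x + s *\<^sub>R v) = h * frechet_derivative D (at (x + s *\<^sub>R v +
      r *\<^sub>R w)) w"
    by auto
  show ?thesis
    using s r eq1 eq2 unfolding D_def by (intro bexI[of _ s] bexI[of _ r]) auto
qed

text \<open>The symmetric second difference equals \<open>h\<^sup>2\<close> times either mixed
  derivative at some nearby point; for small \<open>h\<close> continuity identifies the two values
  at \<open>x\<close>.\<close>

lemma mixed_derivatives_commute:
  fixes f :: "'a::real_normed_vector \<Rightarrow> real"
  assumes "open U" "x \<in> U" "Cinf_on U f"
  shows "frechet_derivative (\<lambda>y. frechet_derivative f (at y) v) (at x) w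
       = frechet_derivative (\<lambda>y. frechet_derivative f (at y) w) (at x) v"
proof -
  define A where "A v w y = frechet_derivative (\<lambda>y. frechet_derivative f (at y) v) (at y) w" for v w y
  have cont: "continuous_on U (A v w)" for v w
    unfolding A_def using assms by (intro Cinf_on_continuous Cinf_on_frechet_derivative)
  have "\<bar>A v w x - A w v x\<bar> < 2 * e" if "e > 0" for e
  proof -
    obtain d where d: "d > 0"
      "\<And>y. dist y x < d \<Longrightarrow> y \<in> U \<and> dist (A v w y) (A v w x) < e \<and> dist (A w v y) (A w v x) < e"
    proof -
      have "eventually (\<lambda>y. y \<in> U \<and> dist (A v w y) (A v w x) < e \<and> dist (A w v y) (A w v x) < e)
        (nhds x)"
        using cont assms(1,2) \<open>e > 0\<close>
        by (intro eventually_conj eventually_nhds_in_open tendstoD)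
          (auto simp: continuous_on_eq_continuous_at continuous_at tendsto_at_iff_tendsto_nhds)
      then show ?thesis using that by (auto simp: eventually_nhds_metric)
    qed
    \<comment> \<open>Small enough that the whole parallelogram spanned by \<open>h v\<close> and
      \<open>h w\<close> stays in the ball of radius \<open>d\<close>; the summand 1 avoids a
      division by zero.\<close>
    define h where "h = d / (2 * (norm v + norm w + 1))"
    have pos: "norm v + norm w + 1 > 0" by (smt (verit) norm_ge_zero)
    have h: "h > 0" unfolding h_def using d pos by simp
    have hd: "h * (norm v + norm w) < d"
    proof -
      have "h * (norm v + norm w) < h * (norm v + norm w + 1)" using h by simp
      also have "\<dots> = d / 2" unfolding h_def using pos by (simp add: field_simps)
      finally show ?thesis using d by simp
    qed
    \<comment> \<open>Stated for any two vectors with the same sum of norms, so that it serves both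
      orders of \<open>v\<close> and \<open>w\<close>.\<close>
    have near: "dist (x + s *\<^sub>R a + r *\<^sub>R b) x < d"
      if "s \<in> {0..h}" "r \<in> {0..h}" "norm a + norm b = norm v + norm w" for s r a b
    proof -
      have "norm (s *\<^sub>R a + r *\<^sub>R b) \<le> s * norm a + r * norm b"
        using norm_triangle_ineq[of "s *\<^sub>R a" "r *\<^sub>R b"] that by simp
      also have "\<dots> \<le> h * norm a + h * norm b"
        using that by (intro add_mono mult_right_mono) auto
      also have "\<dots> = h * (norm v + norm w)" using that(3) by (metis distrib_left)
      finally show ?thesis using hd by (simp add: dist_norm add.assoc)
    qed
    obtain s r where 1: "s \<in> {0..h}" "r \<in> {0..h}"
      "f (x + h *\<^sub>R v + h *\<^sub>R w) - f (x + h *\<^sub>R v) - f (x + h *\<^sub>R w) + f x = h * h * A v w (x + s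
        *\<^sub>R v + r *\<^sub>R w)"
      unfolding A_def using second_difference_quotient[OF assms(3) h] near d by blast
    obtain s' r' where 2: "s' \<in> {0..h}" "r' \<in> {0..h}"
      "f (x + h *\<^sub>R w + h *\<^sub>R v) - f (x + h *\<^sub>R w) - f (x + h *\<^sub>R v) + f x = h * h * A w v (x + s'
        *\<^sub>R w + r' *\<^sub>R v)"
      unfolding A_def using second_difference_quotient[OF assms(3) h, of x w v] near[of _ _ w v] d
      by (metis add.commute)
    have "h * h * A v w (x + s *\<^sub>R v + r *\<^sub>R w) = h * h * A w v (x + s' *\<^sub>R w + r' *\<^sub>R v)"
      using 1(3) 2(3) by (simp add: algebra_simps)
    then have "A v w (x + s *\<^sub>R v + r *\<^sub>R w) = A w v (x + s' *\<^sub>R w + r' *\<^sub>R v)" using h by simp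
    moreover have "dist (A v w (x + s *\<^sub>R v + r *\<^sub>R w)) (A v w x) < e"
      using d(2)[OF near[OF 1(1,2), of v w]] by simp
    moreover have "dist (A w v (x + s' *\<^sub>R w + r' *\<^sub>R v)) (A w v x) < e"
      using d(2)[OF near[OF 2(1,2), of w v]] by (simp add: add.commute)
    ultimately show ?thesis unfolding dist_real_def by (simp add: abs_less_iff)
  qed
  from this[of "\<bar>A v w x - A w v x\<bar> / 2"] have "A v w x = A w v x"
    by (cases "A v w x = A w v x") auto
  then show ?thesis by (simp add: A_def)
qed

lemma Cinf_on_bounded_linear_comp:
  fixes f :: "'a::real_normed_vector \<Rightarrow> 'b::euclidean_space"
  shows "bounded_linear L \<Longrightarrow> open U \<Longrightarrow> Cinf_on U f \<Longrightarrow> Cinf_on U (\<lambda>x. L (f x))"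
  by (rule Cinf_on_compose[where V=UNIV]) (auto intro: Cinf_on_bounded_linear)

lemma Cinf_on_inverse_comp:
  fixes f :: "'a::real_normed_vector \<Rightarrow> real"
  shows "open U \<Longrightarrow> Cinf_on U f \<Longrightarrow> (\<And>x. x \<in> U \<Longrightarrow> f x \<noteq> 0) \<Longrightarrow> Cinf_on U (\<lambda>x. inverse (f x))"
  by (rule Cinf_on_compose[where V="- {0}"]) (auto intro: Cinf_on_inverse)

text \<open>Openness of the image comes from invariance of domain, the derivative of the inverse
  from Cramer's rule, and smoothness by bootstrapping, since that derivative is a smooth function of
  the inverse itself.\<close>

lemma smooth_inverse_of_immersion:
  fixes F :: "real^2 \<Rightarrow> real^2"
  assumes "open U" "inj_on F U" "Cinf_on U F"
    and imm: "\<And>x. x \<in> U \<Longrightarrow> inj (frechet_derivative F (at x))"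
  shows "open (F ` U)" "Cinf_on (F ` U) (inv_into U F)"
proof -
  let ?G = "inv_into U F"
  show oV: "open (F ` U)"
    using assms Cinf_on_continuous by (intro invariance_of_domain)
  \<comment> \<open>The columns \<open>a\<close> and \<open>b\<close> of the Jacobian matrix of
    \<open>F\<close> and its determinant \<open>c\<close>.\<close>
  define a where "a i x = frechet_derivative F (at x) (axis 1 1) $ i" for i x
  define b where "b i x = frechet_derivative F (at x) (axis 2 1) $ i" for i x
  define c where "c x = a 1 x * b 2 x - a 2 x * b 1 x" for x
  have lin: "linear (frechet_derivative F (at x))" if "x \<in> U" for x
    using Cinf_on_differentiable[OF assms(3) that] by (rule linear_frechet_derivative)
  have DF: "frechet_derivative F (at x) w $ i = w $ 1 * a i x + w $ 2 * b i x" if "x \<in> U" for x w i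
  proof -
    have "w = w $ 1 *\<^sub>R axis 1 1 + w $ 2 *\<^sub>R axis 2 1"
      by (simp add: vec_eq_iff forall_2 axis_def)
    from arg_cong[OF this, of "\<lambda>w. frechet_derivative F (at x) w $ i"] show ?thesis
      by (simp add: a_def b_def linear_add[OF lin[OF that]] linear_cmul[OF lin[OF that]])
  qed
  have c0: "c x \<noteq> 0" if x: "x \<in> U" for x
  proof
    assume 0: "c x = 0"
    have inj0: "w = 0" if "frechet_derivative F (at x) w = 0" for w
      using imm[OF x] that lin[OF x] by (metis injD linear_0)
    \<comment> \<open>The matrix maps this vector and the next one to vectors whose components are
      \<open>0\<close> or the determinant up to sign, so both lie in the kernel if the determinant
      vanishes.\<close>
    have "vector [b 2 x, - a 2 x] = (0::real^2)"
      by (rule inj0) (use 0 x in \<open>simp add: vec_eq_iff forall_2 DF vector_2 c_def algebra_simps\<close>)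
    moreover have "vector [b 1 x, - a 1 x] = (0::real^2)"
      by (rule inj0) (use 0 x in \<open>simp add: vec_eq_iff forall_2 DF vector_2 c_def algebra_simps\<close>)
    ultimately have "a 1 x = 0" "a 2 x = 0" by (auto simp: vec_eq_iff forall_2 vector_2)
    then have "frechet_derivative F (at x) (axis 1 1) = 0" by (simp add: vec_eq_iff forall_2 a_def)
    then show False using inj0[of "axis 1 1"] by (simp add: axis_eq_0_iff)
  qed
  \<comment> \<open>The inverse matrix by Cramer's rule, applied to \<open>w\<close>.\<close>
  define D where "D x w = (inverse (c x) * (w $ 1 * b 2 x - w $ 2 * b 1 x)) *\<^sub>R axis 1 1
      + (inverse (c x) * (w $ 2 * a 1 x - w $ 1 * a 2 x)) *\<^sub>R (axis 2 1 :: real^2)"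
    for x and w :: "real^2"
  have G': "(?G has_derivative D x) (at (F x))" if x: "x \<in> U" for x
  proof (rule has_derivative_inverse_strong[OF \<open>open U\<close> x Cinf_on_continuous[OF assms(3)]])
    show "inv_into U F (F y) = y" if "y \<in> U" for y using that assms(2) by simp
    show "(F has_derivative frechet_derivative F (at x)) (at x)"
      using Cinf_on_differentiable[OF assms(3) x] by (simp add: frechet_derivative_works)
    have "D x w $ 1 = (w $ 1 * b 2 x - w $ 2 * b 1 x) / c x"
      "D x w $ 2 = (w $ 2 * a 1 x - w $ 1 * a 2 x) / c x" for w
      by (simp_all add: D_def axis_def divide_inverse mult.commute)
    then have "frechet_derivative F (at x) (D x w) $ i
       = (a i x * (w $ 1 * b 2 x - w $ 2 * b 1 x) + b i x * (w $ 2 * a 1 x - w $ 1 * a 2 x)) / c x"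
         for w i
      by (simp add: DF[OF x] add_divide_distrib mult.commute)
    moreover have "a 1 x * (w $ 1 * b 2 x - w $ 2 * b 1 x) + b 1 x * (w $ 2 * a 1 x - w $ 1 * a 2 x)
      = w $ 1 * c x"
      "a 2 x * (w $ 1 * b 2 x - w $ 2 * b 1 x) + b 2 x * (w $ 2 * a 1 x - w $ 1 * a 2 x) = w $ 2 * c x"
        for w :: "real^2"
      by (simp_all add: c_def algebra_simps)
    ultimately have "frechet_derivative F (at x) (D x w) = w" for w
      using c0[OF x] by (simp add: vec_eq_iff forall_2)
    then show "frechet_derivative F (at x) \<circ> D x = id" by auto
  qed
  have GU: "?G y \<in> U" "F (?G y) = y" if "y \<in> F ` U" for y
    using that by (simp_all add: inv_into_into f_inv_into_f)
  have fd: "frechet_derivative ?G (at y) w = D (?G y) w" if "y \<in> F ` U" for y w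
    using frechet_derivative_eqI[OF G'[OF GU(1)[OF that]]] GU[OF that] by simp
  have smc: "Cinf_on U (a i)" "Cinf_on U (b i)" for i
    unfolding a_def b_def
    by (intro Cinf_on_bounded_linear_comp[OF bounded_linear_vec_nth] Cinf_on_frechet_derivative assms)+
  have smc': "Cinf_on U (\<lambda>x. inverse (c x))"
    using c0 unfolding c_def by (intro Cinf_on_inverse_comp Cinf_on_diff Cinf_on_mult smc \<open>open U\<close>)
  have smD: "Cinf_on U (\<lambda>x. D x w)" for w
    unfolding D_def
    by (intro Cinf_on_add Cinf_on_scaleR Cinf_on_mult Cinf_on_diff Cinf_on_const smc smc' \<open>open U\<close>)
  have "Ck_on k (F ` U) ?G" for k
  proof (induction k)
    case 0
    show ?case using G' GU
      by (auto intro!: continuous_at_imp_continuous_on intro: has_derivative_continuous)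
  next
    case (Suc k)
    \<comment> \<open>The derivative of the inverse is \<open>D\<close> evaluated along the inverse,
      which is of class \<open>k\<close> by the induction hypothesis.\<close>
    have "Ck_on k (F ` U) (\<lambda>y. D (?G y) w)" for w
      by (rule Ck_on_compose[OF oV \<open>open U\<close> _ Suc]) (use GU smD in \<open>auto simp: Cinf_on_def\<close>)
    then have "Ck_on k (F ` U) (\<lambda>y. frechet_derivative ?G (at y) w)" for w
      by (rule Ck_on_cong[OF oV, THEN iffD1, rotated]) (simp add: fd)
    moreover have "?G differentiable (at y)" if "y \<in> F ` U" for y
      using G'[OF GU(1)[OF that]] GU[OF that] by (auto simp: differentiable_def)
    ultimately show ?case by simp
  qed
  then show "Cinf_on (F ` U) ?G" by (simp add: Cinf_on_def)
qed

section \<open>Cutoff functions on the line\<close>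

text \<open>The powers of \<open>1/x\<close> are included because the derivative of
  \<open>exp (- 1 / x) / x ^ n\<close> is a combination of members of the family, so that one
  induction proves all of them smooth.\<close>

definition flat :: "nat \<Rightarrow> real \<Rightarrow> real" where
  "flat n x = (if x > 0 then exp (- inverse x) * inverse x ^ n else 0)"

lemma power_div_fact_le_exp: "0 \<le> (x::real) \<Longrightarrow> x ^ n / fact n \<le> exp x"
proof -
  assume x: "0 \<le> x"
  have "(\<Sum>k<Suc n. inverse (fact k) *\<^sub>R x ^ k) \<le> exp x"
    unfolding exp_def using x by (intro sum_le_suminf summable_exp_generic) auto
  moreover have "(\<Sum>k<n. inverse (fact k) *\<^sub>R x ^ k) \<ge> 0"
    using x by (intro sum_nonneg) auto
  ultimately show ?thesis by (simp add: divide_inverse mult.commute)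
qed

text \<open>With \<open>y = 1/x\<close> the exponential dominates
  \<open>y ^ (n + 2) / fact (n + 2)\<close>. The two extra powers leave the factor
  \<open>x\<^sup>2\<close>, which makes the difference quotient at \<open>0\<close> tend to
  \<open>0\<close>.\<close>

lemma flat_le: "\<bar>flat n x\<bar> \<le> fact (n + 2) * x\<^sup>2"
proof (cases "x > 0")
  case True
  define y where "y = inverse x"
  have y: "y > 0" using True by (simp add: y_def)
  have "y ^ (n + 2) \<le> fact (n + 2) * exp y"
    using power_div_fact_le_exp[of y "n + 2"] y by (simp add: field_simps del: fact_Suc)
  then have "exp (- y) * y ^ (n + 2) \<le> fact (n + 2)"
    by (simp add: exp_minus field_simps del: fact_Suc)
  then have "exp (- y) * y ^ (n + 2) * x\<^sup>2 \<le> fact (n + 2) * x\<^sup>2"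
    by (intro mult_right_mono) auto
  moreover have "exp (- y) * y ^ (n + 2) * x\<^sup>2 = exp (- y) * y ^ n"
    using True by (simp add: y_def power_add power2_eq_square mult.assoc[symmetric])
  ultimately have "exp (- y) * y ^ n \<le> fact (n + 2) * x\<^sup>2" by (simp only:)
  moreover have "\<bar>flat n x\<bar> = exp (- y) * y ^ n" using True by (simp add: flat_def y_def abs_mult)
  ultimately show ?thesis by (simp only:)
qed (simp add: flat_def)

lemma flat_deriv: "(flat n has_real_derivative flat (n + 2) x - n * flat (n + 1) x) (at x)"
proof -
  consider "x > 0" | "x < 0" | "x = 0" by linarith
  then show ?thesis
  proof cases
    case 1
    have "((\<lambda>x. exp (- inverse x) * inverse x ^ n) has_real_derivative
        flat (n + 2) x - n * flat (n + 1) x) (at x)"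
      using 1 by (auto intro!: derivative_eq_intros simp: flat_def)
        (cases n; simp add: field_simps power2_eq_square)
    then show ?thesis
      by (rule has_field_derivative_transform_within_open[of _ _ _ "{0<..}"]) (use 1 in \<open>auto simp:
      flat_def\<close>)
  next
    case 2
    have "((\<lambda>x. 0) has_real_derivative flat (n + 2) x - n * flat (n + 1) x) (at x)"
      using 2 by (auto simp: flat_def)
    then show ?thesis
      by (rule has_field_derivative_transform_within_open[of _ _ _ "{..<0}"]) (use 2 in \<open>auto simp:
      flat_def\<close>)
  next
    case 3
    have "((\<lambda>h. (flat n (0 + h) - flat n 0) / h) \<longlongrightarrow> 0) (at 0)"
    proof (rule Lim_null_comparison)
      have "norm ((flat n (0 + h) - flat n 0) / h) \<le> fact (n + 2) * \<bar>h\<bar>" for h :: real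
        using flat_le[of n h]
        by (cases "h = 0") (simp_all add: flat_def field_simps power2_eq_square del: fact_Suc)
      then show "\<forall>\<^sub>F h in at 0. norm ((flat n (0 + h) - flat n 0) / h) \<le> fact (n + 2) * \<bar>h\<bar>"
        by simp
      show "((\<lambda>h. fact (n + 2) * \<bar>h\<bar>) \<longlongrightarrow> 0) (at (0::real))"
        by (auto intro!: tendsto_eq_intros)
    qed
    then show ?thesis using 3 by (simp add: DERIV_def flat_def)
  qed
qed

lemma Cinf_on_flat: "Cinf_on UNIV (flat n)"
proof -
  have "Ck_on k UNIV (flat n)" for k
  proof (induction k arbitrary: n)
    case 0
    show ?case using flat_deriv
      by (auto intro!: continuous_at_imp_continuous_on intro: DERIV_isCont)
  next
    case (Suc k)
    have "Ck_on k UNIV (\<lambda>x. flat (n + 2) x + (- real n) * flat (n + 1) x)"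
      by (intro Ck_on_add bounded_bilinear.Ck_on_prod[OF bounded_bilinear_mult] Suc Ck_on_const) auto
    then show ?case
      using flat_deriv
      by (intro Ck_on_DERIV[where f'="\<lambda>x. flat (n + 2) x + (- real n) * flat (n + 1) x"]) auto
  qed
  then show ?thesis by (simp add: Cinf_on_def)
qed

lemma flat_pos_iff: "flat n x > 0 \<longleftrightarrow> x > 0" and flat_nonneg: "flat n x \<ge> 0"
  and flat_eq_0: "x \<le> 0 \<Longrightarrow> flat n x = 0"
  by (auto simp: flat_def)

lemma flat_mono: "x \<le> y \<Longrightarrow> flat 0 x \<le> flat 0 y"
  by (auto simp: flat_def le_imp_inverse_le)

definition step :: "real \<Rightarrow> real" where
  "step x = flat 0 x / (flat 0 x + flat 0 (1 - x))"

lemma step_denom_pos: "flat 0 x + flat 0 (1 - x) > 0"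
  by (metis add_nonneg_pos add_pos_nonneg diff_gt_0_iff_gt flat_nonneg flat_pos_iff less_trans
  not_less_iff_gr_or_eq zero_less_one)

lemma step_eq_0: "x \<le> 0 \<Longrightarrow> step x = 0"
  and step_eq_1: "1 \<le> x \<Longrightarrow> step x = 1"
  and step_pos: "0 < x \<Longrightarrow> 0 < step x"
  and step_nonneg: "0 \<le> step x"
  using step_denom_pos[of x] flat_nonneg[of 0 x] flat_pos_iff[of 0 x]
  by (auto simp: step_def flat_eq_0 flat_nonneg intro: divide_pos_pos)

lemma step_mono: "x \<le> y \<Longrightarrow> step x \<le> step y"
proof -
  assume "x \<le> y"
  then have "flat 0 x \<le> flat 0 y" "flat 0 (1 - y) \<le> flat 0 (1 - x)" by (auto intro: flat_mono)
  then have "flat 0 x * flat 0 (1 - y) \<le> flat 0 y * flat 0 (1 - x)"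
    by (intro mult_mono flat_nonneg)
  then show ?thesis
    using step_denom_pos[of x] step_denom_pos[of y] by (simp add: step_def field_simps)
qed

lemma Cinf_on_step: "Cinf_on UNIV step"
proof -
  have "Cinf_on UNIV (\<lambda>x. 1 - x :: real)"
    by (intro Cinf_on_diff Cinf_on_const Cinf_on_bounded_linear bounded_linear_ident) auto
  then have 1: "Cinf_on UNIV (\<lambda>x. flat 0 (1 - x))"
    by (rule Cinf_on_compose[where V=UNIV, rotated 3]) (simp_all add: Cinf_on_flat)
  have "Cinf_on UNIV (\<lambda>x. flat 0 x * inverse (flat 0 x + flat 0 (1 - x)))"
    using step_denom_pos
    by (intro Cinf_on_mult Cinf_on_inverse_comp Cinf_on_add Cinf_on_flat 1) (auto simp: less_le)
  then show ?thesis by (simp add: step_def[abs_def] divide_inverse)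
qed

lemma step_deriv: "\<exists>s\<ge>0. (step has_real_derivative s) (at x)"
proof -
  have "step differentiable (at x)"
    using Cinf_on_differentiable[OF Cinf_on_step] by auto
  then obtain s where s: "(step has_real_derivative s) (at x)"
    using real_differentiable_def by blast
  moreover have "s \<ge> 0"
    by (rule mono_on_imp_deriv_nonneg[of UNIV, OF _ s]) (auto simp: mono_on_def step_mono)
  ultimately show ?thesis by blast
qed

text \<open>A plateau as a function of \<open>t\<^sup>2\<close> rather than of \<open>|t|\<close>:
  it is smooth at \<open>0\<close>, its derivative has the explicit factor \<open>- t\<close>, and
  in a chart it can be evaluated on a squared distance.\<close>

definition bell :: "real \<Rightarrow> real \<Rightarrow> real \<Rightarrow> real" where
  "bell a b t = step ((b\<^sup>2 - t\<^sup>2) / (b\<^sup>2 - a\<^sup>2))"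

lemma
  assumes "0 \<le> a" "a < b"
  shows bell_eq_1: "\<bar>t\<bar> \<le> a \<Longrightarrow> bell a b t = 1"
    and bell_eq_0: "b \<le> \<bar>t\<bar> \<Longrightarrow> bell a b t = 0"
    and bell_pos: "\<bar>t\<bar> < b \<Longrightarrow> 0 < bell a b t"
proof -
  have ab: "b\<^sup>2 - a\<^sup>2 > 0" using assms by (simp add: power_strict_mono)
  show "bell a b t = 1" if "\<bar>t\<bar> \<le> a"
  proof -
    have "t\<^sup>2 \<le> a\<^sup>2" using that assms by (simp add: abs_le_square_iff[symmetric])
    then show ?thesis using ab by (auto simp: bell_def intro!: step_eq_1 simp: field_simps)
  qed
  show "bell a b t = 0" if "b \<le> \<bar>t\<bar>"
  proof -
    have "b\<^sup>2 \<le> t\<^sup>2" using that assms by (simp add: abs_le_square_iff[symmetric])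
    then show ?thesis using ab by (auto simp: bell_def intro!: step_eq_0 divide_nonpos_pos)
  qed
  show "0 < bell a b t" if "\<bar>t\<bar> < b"
  proof -
    have "t\<^sup>2 < b\<^sup>2" using that assms by (metis abs_ge_zero power2_abs power_strict_mono pos2)
    then show ?thesis using ab by (auto simp: bell_def intro!: step_pos)
  qed
qed

lemma bell_nonneg: "bell a b t \<ge> 0"
  by (simp add: bell_def step_nonneg)

lemma Cinf_on_bell: "Cinf_on UNIV (bell a b)"
proof -
  have "Cinf_on UNIV (\<lambda>t. (b\<^sup>2 - t * t) * inverse (b\<^sup>2 - a\<^sup>2))"
    by (intro Cinf_on_mult Cinf_on_diff Cinf_on_const Cinf_on_bounded_linear bounded_linear_ident) auto
  from Cinf_on_compose[OF _ _ _ this Cinf_on_step] show ?thesis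
    by (simp add: bell_def[abs_def] divide_inverse power2_eq_square)
qed

text \<open>Kept in the form \<open>- t * s\<close> because the sign of the second derivative of the
  collar profile is read off from the factor \<open>t\<close>.\<close>

lemma bell_deriv:
  assumes "0 \<le> a" "a < b"
  shows "\<exists>s\<ge>0. (bell a b has_real_derivative - t * s) (at t)"
proof -
  have ab: "b\<^sup>2 - a\<^sup>2 > 0" using assms by (simp add: power_strict_mono)
  obtain s where s: "s \<ge> 0" "(step has_real_derivative s) (at ((b\<^sup>2 - t\<^sup>2) / (b\<^sup>2 - a\<^sup>2)))"
    using step_deriv by blast
  have "((\<lambda>t. (b\<^sup>2 - t\<^sup>2) / (b\<^sup>2 - a\<^sup>2)) has_real_derivative (- 2 * t) / (b\<^sup>2 - a\<^sup>2)) (at t)"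
    using ab by (auto intro!: derivative_eq_intros)
  from DERIV_chain2[OF s(2) this] have "(bell a b has_real_derivative - t * (s * 2 / (b\<^sup>2 - a\<^sup>2)))
    (at t)"
    unfolding bell_def[abs_def] by (simp add: field_simps)
  moreover have "s * 2 / (b\<^sup>2 - a\<^sup>2) \<ge> 0" using s ab by simp
  ultimately show ?thesis by blast
qed

text \<open>The reparametrisation \<open>h\<close> of the collar coordinate solves \<open>- h'' = h\<close> near \<open>0\<close>, so that the
  quotient \<open>- h'' / h\<close> extends smoothly and positively across \<open>0\<close>.\<close>

lemma profile_exists:
  obtains h h1 h2 :: "real \<Rightarrow> real" where
    "Cinf_on {-2<..<2} h"
    "\<And>t. \<bar>t\<bar> < 2 \<Longrightarrow> (h has_real_derivative h1 t) (at t)"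
    "\<And>t. \<bar>t\<bar> < 2 \<Longrightarrow> (h1 has_real_derivative h2 t) (at t)"
    "\<And>t. \<bar>t\<bar> \<le> 1/4 \<Longrightarrow> h t = sin t"
    "\<And>t. \<bar>t\<bar> < 1/4 \<Longrightarrow> h2 t = - sin t"
    "\<And>t. 1/2 \<le> t \<Longrightarrow> t < 2 \<Longrightarrow> h t = h (1/2)"
    "\<And>t. -2 < t \<Longrightarrow> t \<le> -1/2 \<Longrightarrow> h t = h (-1/2)"
    "\<And>t. 0 < t \<Longrightarrow> t < 2 \<Longrightarrow> 0 < h t"
    "\<And>t. -2 < t \<Longrightarrow> t < 0 \<Longrightarrow> h t < 0"
    "\<And>t. 0 < t \<Longrightarrow> t < 1/2 \<Longrightarrow> h2 t < 0"
    "\<And>t. - 1/2 < t \<Longrightarrow> t < 0 \<Longrightarrow> 0 < h2 t"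
    "\<And>t. 0 < t \<Longrightarrow> t \<le> 1 \<Longrightarrow> h2 t \<le> 0"
    "\<And>t. - 1 \<le> t \<Longrightarrow> t < 0 \<Longrightarrow> 0 \<le> h2 t"
proof -
  define chi where "chi = bell (1/4) (1/2)"
  \<comment> \<open>\<open>h1 = cos\<close> near \<open>0\<close> gives \<open>h = sin\<close>, and
    \<open>h1 = 0\<close> beyond \<open>1/2\<close> makes \<open>h\<close> constant there. The
    derivative of \<open>h1\<close> has two terms, one with \<open>sin t\<close> and one with the
    derivative of \<open>chi\<close>; neither has the sign of \<open>t\<close> for
    \<open>|t| \<le> 1\<close>.\<close>
  define h1 where "h1 t = cos t * chi t" for t
  \<comment> \<open>Integrating from \<open>-2\<close> keeps both signs of \<open>t\<close> in one
    interval; the subtracted constant makes \<open>h 0 = 0\<close>.\<close>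
  define h where "h t = integral {-2..t} h1 - integral {-2..0} h1" for t
  define h2 where "h2 t = deriv h1 t" for t
  have chi_smooth: "Cinf_on UNIV chi" unfolding chi_def by (rule Cinf_on_bell)
  have h1_smooth: "Cinf_on UNIV h1"
    unfolding h1_def[abs_def] by (intro Cinf_on_mult Cinf_on_sin_cos chi_smooth) auto
  have h': "(h has_real_derivative h1 t) (at t)" if "\<bar>t\<bar> < 2" for t
  proof -
    have "((\<lambda>t. integral {-2..t} h1) has_real_derivative h1 t) (at t within {-2..2})"
      using that Cinf_on_subset[OF h1_smooth]
      by (intro integral_has_real_derivative Cinf_on_continuous) auto
    then have "((\<lambda>t. integral {-2..t} h1) has_real_derivative h1 t) (at t)"
      using that by (subst (asm) at_within_interior) auto
    then show ?thesis
      unfolding h_def[abs_def] by (auto intro!: derivative_eq_intros)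
  qed
  obtain chi' where chi': "\<And>t. (chi has_real_derivative - t * chi' t) (at t)" "\<And>t. chi' t \<ge> 0"
    using bell_deriv[of "1/4" "1/2"] unfolding chi_def by (simp, metis)
  have h1': "(h1 has_real_derivative - sin t * chi t - t * chi' t * cos t) (at t)" for t
    unfolding h1_def[abs_def] using chi'(1)[of t] by (auto intro!: derivative_eq_intros)
  have h2_eq: "h2 t = - sin t * chi t - t * chi' t * cos t" for t
    unfolding h2_def using h1' by (rule DERIV_imp_deriv)
  have chi1: "chi t = 1" if "\<bar>t\<bar> \<le> 1/4" for t using that by (simp add: chi_def bell_eq_1)
  have chi0: "chi t = 0" if "1/2 \<le> \<bar>t\<bar>" for t using that by (simp add: chi_def bell_eq_0)
  have chi_pos: "chi t > 0" if "\<bar>t\<bar> < 1/2" for t using that by (simp add: chi_def bell_pos)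
  have h0: "h 0 = 0" by (simp add: h_def)
  have cos_pos: "cos t > 0" if "\<bar>t\<bar> \<le> 1/2" for t :: real
    using that pi_gt3 by (intro cos_gt_zero_pi) auto
  have h1_nonneg: "h1 t \<ge> 0" for t
    using cos_pos[of t] chi0[of t] bell_nonneg by (cases "\<bar>t\<bar> \<le> 1/2") (auto simp: h1_def chi_def)
  have h_sin: "h t = sin t" if "\<bar>t\<bar> \<le> 1/4" for t
  proof -
    have "((\<lambda>t. h t - sin t) has_real_derivative 0) (at s within {-1/4..1/4})" if "s \<in> {-1/4..1/4}" for s
    proof -
      have "\<bar>s\<bar> \<le> 1/4" "\<bar>s\<bar> < 2" using that by auto
      then have "(h has_real_derivative cos s) (at s)" using h'[of s] chi1[of s] by (simp add: h1_def)
      from DERIV_diff[OF this DERIV_sin] show ?thesis by (simp add: has_field_derivative_at_within)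
    qed
    then have "\<exists>c. \<forall>s\<in>{-1/4..1/4}. h s - sin s = c"
      by (intro has_field_derivative_zero_constant) auto
    then obtain c where c: "\<forall>s\<in>{-1/4..1/4}. h s - sin s = c" by blast
    moreover have "c = 0" using c[rule_format, of 0] h0 by simp
    moreover have "t \<in> {-1/4..1/4}" using that unfolding abs_le_iff by auto
    then have "h t - sin t = c" using c by blast
    ultimately show ?thesis by simp
  qed
  have const: "h s = h t" if "s \<le> t" "-2 < s" "t < 2" and outer: "\<And>x. s \<le> x \<Longrightarrow> x \<le> t \<Longrightarrow> 1/2 \<le> \<bar>x\<bar>" for s t
  proof -
    have "(h has_real_derivative 0) (at x within {s..t})" if "x \<in> {s..t}" for x
    proof -
      have "\<bar>x\<bar> < 2" "1/2 \<le> \<bar>x\<bar>" using that \<open>-2 < s\<close> \<open>t < 2\<close> outer by auto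
      then show ?thesis using h'[of x] chi0[of x] by (simp add: h1_def has_field_derivative_at_within)
    qed
    then have "\<exists>c. \<forall>x\<in>{s..t}. h x = c"
      by (intro has_field_derivative_zero_constant) auto
    then show ?thesis using \<open>s \<le> t\<close> by fastforce
  qed
  have mono: "h s \<le> h t" if "s \<le> t" "-2 < s" "t < 2" for s t
  proof (rule DERIV_nonneg_imp_nondecreasing[OF \<open>s \<le> t\<close>])
    fix x assume "s \<le> x" "x \<le> t"
    then have "\<bar>x\<bar> < 2" using that by auto
    then show "\<exists>y. (h has_real_derivative y) (at x) \<and> 0 \<le> y" using h' h1_nonneg by blast
  qed
  have sin_pos: "sin t > 0" if "0 < t" "t \<le> 1/2" for t :: real
    using that pi_gt3 by (intro sin_gt_zero) auto
  \<comment> \<open>Monotonicity carries the positivity of \<open>sin\<close> on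
    \<open>(0, 1/4]\<close> outwards.\<close>
  have pos: "0 < h t" if "0 < t" "t < 2" for t
  proof -
    have "0 < sin (min t (1/4))" using that by (intro sin_pos) auto
    also have "\<dots> = h (min t (1/4))" using that by (intro h_sin[symmetric]) auto
    also have "\<dots> \<le> h t" using that by (intro mono) auto
    finally show ?thesis .
  qed
  have neg: "h t < 0" if "-2 < t" "t < 0" for t
  proof -
    have "h t \<le> h (max t (-1/4))" using that by (intro mono) auto
    also have "\<dots> = sin (max t (-1/4))" using that by (intro h_sin) auto
    also have "\<dots> < 0" using sin_pos[of "- max t (-1/4)"] that by simp
    finally show ?thesis .
  qed
  show ?thesis
  proof (rule that[of h h1 h2])
    show "Cinf_on {-2<..<2} h"
      by (rule Cinf_on_DERIV[where f'=h1]) (use h' Cinf_on_subset[OF h1_smooth] in \<open>auto simp: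
      abs_less_iff\<close>)
    show "(h1 has_real_derivative h2 t) (at t)" for t using h1' by (simp add: h2_eq)
    show "h2 t = - sin t" if "\<bar>t\<bar> < 1/4" for t
    proof -
      have "(h1 has_real_derivative - sin t) (at t)"
        by (rule has_field_derivative_transform_within_open[of cos _ _ "{-1/4<..<1/4}"])
          (use that chi1 in \<open>auto intro!: derivative_eq_intros simp: h1_def abs_less_iff\<close>)
      then show ?thesis unfolding h2_def by (rule DERIV_imp_deriv)
    qed
    show "h t = h (1/2)" if "1/2 \<le> t" "t < 2" for t
      using const[of "1/2" t] that by auto
    show "h t = h (-1/2)" if "-2 < t" "t \<le> -1/2" for t
      using const[of t "-1/2"] that by auto
    show "h2 t < 0" if "0 < t" "t < 1/2" for t
    proof -
      have "sin t * chi t > 0" using sin_pos[of t] chi_pos[of t] that by simp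
      moreover have "t * chi' t * cos t \<ge> 0" using that chi'(2) cos_pos[of t] by simp
      ultimately show ?thesis by (simp add: h2_eq)
    qed
    show "0 < h2 t" if "-1/2 < t" "t < 0" for t
    proof -
      have "sin (- t) * chi t > 0" using sin_pos[of "-t"] chi_pos[of t] that by (intro mult_pos_pos) auto
      moreover have "- t * chi' t * cos t \<ge> 0" using that chi'(2) cos_pos[of t]
        by (intro mult_nonneg_nonneg) auto
      ultimately show ?thesis by (simp add: h2_eq)
    qed
    have pos1: "sin t \<ge> 0" "cos t \<ge> 0" if "0 < t" "t \<le> 1" for t :: real
      using that pi_gt3 by (auto intro!: sin_ge_zero cos_ge_zero)
    have chi_nonneg: "chi t \<ge> 0" for t by (simp add: chi_def bell_nonneg)
    show "h2 t \<le> 0" if "0 < t" "t \<le> 1" for t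
    proof -
      have "sin t * chi t \<ge> 0" "t * chi' t * cos t \<ge> 0"
        using pos1[OF that] that chi'(2) chi_nonneg by (simp_all add: mult_nonneg_nonneg)
      then show ?thesis by (simp add: h2_eq)
    qed
    show "0 \<le> h2 t" if "- 1 \<le> t" "t < 0" for t
    proof -
      have "sin (- t) * chi t \<ge> 0" "- t * chi' t * cos (- t) \<ge> 0"
        using pos1[of "- t"] that chi'(2) chi_nonneg by (intro mult_nonneg_nonneg; simp)+
      then show ?thesis by (simp add: h2_eq)
    qed
  qed (use h' h_sin pos neg in auto)
qed

section \<open>Calculus on an atlas\<close>

text \<open>A partial derivative as a function on the surface instead of on the chart image, so that
  derivatives in different charts can be compared at the same point.\<close>

definition pd :: "'a chart \<Rightarrow> 2 \<Rightarrow> ('a \<Rightarrow> real) \<Rightarrow> 'a \<Rightarrow> real" where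
  "pd \<kappa> i u p = frechet_derivative (u \<circ> chart_inv \<kappa>) (at (snd \<kappa> p)) (axis i 1)"

definition crd :: "'a chart \<Rightarrow> 2 \<Rightarrow> 'a \<Rightarrow> real" where
  "crd \<kappa> k p = snd \<kappa> p $ k"

text \<open>The coefficient of the wedge product of \<open>df\<close> and \<open>dg\<close> in the
  coordinates of the chart. For the coordinate functions of another chart it is the Jacobian
  determinant of the transition map.\<close>

definition wedge :: "'a chart \<Rightarrow> ('a \<Rightarrow> real) \<Rightarrow> ('a \<Rightarrow> real) \<Rightarrow> 'a \<Rightarrow> real" where
  "wedge \<kappa> f g p = pd \<kappa> 1 f p * pd \<kappa> 2 g p - pd \<kappa> 2 f p * pd \<kappa> 1 g p"

abbreviation jac :: "'a chart \<Rightarrow> 'a chart \<Rightarrow> 'a \<Rightarrow> real" where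
  "jac \<kappa> \<mu> \<equiv> wedge \<kappa> (crd \<mu> 1) (crd \<mu> 2)"

section \<open>Smooth functions on a surface given by an atlas\<close>

locale surface_atlas =
  fixes S :: "'a::t2_space set" and A :: "'a chart set"
  assumes atlas: "smooth_atlas S A"
begin

abbreviation oS :: "'a set \<Rightarrow> bool" where
  "oS W \<equiv> openin (top_of_set S) W"

definition smooth_in :: "'a set \<Rightarrow> ('a \<Rightarrow> real) \<Rightarrow> bool" where
  "smooth_in W u \<longleftrightarrow> (\<forall>\<kappa>\<in>A. Cinf_on (snd \<kappa> ` (fst \<kappa> \<inter> W)) (u \<circ> chart_inv \<kappa>))"

lemma oS_S: "oS S" and oS_Int: "oS V \<Longrightarrow> oS W \<Longrightarrow> oS (V \<inter> W)" and oS_sub: "oS W \<Longrightarrow> W \<subseteq> S"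
  by (auto dest: openin_imp_subset)

lemma oS_local: "(\<And>p. p \<in> W \<Longrightarrow> \<exists>V. oS V \<and> p \<in> V \<and> V \<subseteq> W) \<Longrightarrow> oS W"
  by (meson openin_subopen)

lemma chart_cover: "p \<in> S \<Longrightarrow> \<exists>\<kappa>\<in>A. p \<in> fst \<kappa>"
  using atlas unfolding smooth_atlas_def by blast

lemma smooth_atlas_chart: "\<kappa> \<in> A \<Longrightarrow> topological_chart S \<kappa>"
  using atlas unfolding smooth_atlas_def by blast

context
  fixes \<kappa> :: "'a chart" assumes \<kappa>: "\<kappa> \<in> A"
begin

lemma chart_open: "oS (fst \<kappa>)"
  and open_chart_image: "open (chart_image \<kappa>)"
  and chart_homeo: "homeomorphism (fst \<kappa>) (chart_image \<kappa>) (snd \<kappa>) (chart_inv \<kappa>)"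
  using smooth_atlas_chart[OF \<kappa>] by (auto simp: topological_chart_def)

lemma chart_inv_chart: "p \<in> fst \<kappa> \<Longrightarrow> chart_inv \<kappa> (snd \<kappa> p) = p"
  and chart_chart_inv: "x \<in> chart_image \<kappa> \<Longrightarrow> snd \<kappa> (chart_inv \<kappa> x) = x"
  and chart_inv_in: "x \<in> chart_image \<kappa> \<Longrightarrow> chart_inv \<kappa> x \<in> fst \<kappa>"
  using chart_homeo by (auto simp: homeomorphism_def)

lemma chart_inj: "inj_on (snd \<kappa>) (fst \<kappa>)"
  using chart_inv_chart by (metis inj_onI)

lemma chart_continuous: "continuous_on (fst \<kappa>) (snd \<kappa>)"
  and chart_inv_continuous: "continuous_on (chart_image \<kappa>) (chart_inv \<kappa>)"
  using chart_homeo by (auto simp: homeomorphism_def)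

lemma open_chart_part: "oS W \<Longrightarrow> open (snd \<kappa> ` (fst \<kappa> \<inter> W))"
proof -
  assume W: "oS W"
  have "openin (top_of_set (fst \<kappa>)) (fst \<kappa> \<inter> W)"
    using W chart_open by (meson Int_lower1 oS_Int oS_sub openin_subset_trans)
  then have "openin (top_of_set (chart_image \<kappa>)) (snd \<kappa> ` (fst \<kappa> \<inter> W))"
    by (rule homeomorphism_imp_open_map[OF chart_homeo])
  then show ?thesis using open_chart_image openin_open_eq by blast
qed

lemma oS_chart_vimage: "open V \<Longrightarrow> oS (fst \<kappa> \<inter> snd \<kappa> -` V)"
  by (meson chart_continuous chart_open continuous_openin_preimage_gen openin_trans)

end

lemma transition_smooth:
  assumes "\<kappa> \<in> A" "\<mu> \<in> A" shows "Cinf_on (snd \<kappa> ` (fst \<kappa> \<inter> fst \<mu>)) (transition \<kappa> \<mu>)"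
  using atlas assms smooth_on_iff_Cinf_on[OF open_chart_part[OF assms(1) chart_open[OF assms(2)]]]
  unfolding smooth_atlas_def by blast

lemma smooth_in_cong: "oS W \<Longrightarrow> (\<And>p. p \<in> W \<Longrightarrow> u p = v p) \<Longrightarrow> smooth_in W u \<longleftrightarrow> smooth_in W v"
  unfolding smooth_in_def using chart_inv_chart
  by (intro ball_cong refl Cinf_on_cong open_chart_part) auto

lemma smooth_in_subset: "smooth_in W u \<Longrightarrow> V \<subseteq> W \<Longrightarrow> smooth_in V u"
  unfolding smooth_in_def by (blast intro: Cinf_on_subset)

lemma smooth_in_local:
  assumes "\<And>p. p \<in> W \<Longrightarrow> \<exists>V. oS V \<and> p \<in> V \<and> smooth_in V u"
  shows "smooth_in W u"
  unfolding smooth_in_def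
proof (intro ballI Cinf_on_open_cover)
  fix \<kappa> x assume \<kappa>: "\<kappa> \<in> A" and x: "x \<in> snd \<kappa> ` (fst \<kappa> \<inter> W)"
  then obtain p where p: "p \<in> fst \<kappa>" "p \<in> W" "x = snd \<kappa> p" by auto
  obtain V where V: "oS V" "p \<in> V" "smooth_in V u" using assms p by blast
  show "\<exists>V. open V \<and> x \<in> V \<and> Cinf_on V (u \<circ> chart_inv \<kappa>)"
    using V p \<kappa> open_chart_part[OF \<kappa> V(1)] unfolding smooth_in_def by blast
qed

text \<open>In any other chart the function is its representation in \<kappa> composed with a
  transition map, so a single chart suffices.\<close>

lemma smooth_in_chartI:
  assumes \<kappa>: "\<kappa> \<in> A" and W: "oS W" "W \<subseteq> fst \<kappa>" and u: "Cinf_on (snd \<kappa> ` W) (u \<circ> chart_inv \<kappa>)"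
  shows "smooth_in W u"
  unfolding smooth_in_def
proof
  fix \<mu> assume \<mu>: "\<mu> \<in> A"
  let ?V = "snd \<mu> ` (fst \<mu> \<inter> W)"
  have W': "fst \<kappa> \<inter> W = W" using W by auto
  have oV: "open ?V" by (rule open_chart_part[OF \<mu> W(1)])
  have "Cinf_on ?V (\<lambda>x. (u \<circ> chart_inv \<kappa>) (transition \<mu> \<kappa> x))"
  proof (rule Cinf_on_compose[OF oV _ _ _ u])
    show "open (snd \<kappa> ` W)" using open_chart_part[OF \<kappa> W(1)] W' by simp
    show "transition \<mu> \<kappa> ` ?V \<subseteq> snd \<kappa> ` W"
      using chart_inv_chart[OF \<mu>] by (auto simp: transition_def)
    show "Cinf_on ?V (transition \<mu> \<kappa>)"
      using transition_smooth[OF \<mu> \<kappa>] W by (rule_tac Cinf_on_subset) auto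
  qed
  then show "Cinf_on ?V (u \<circ> chart_inv \<mu>)"
    by (rule Cinf_on_cong[OF oV, THEN iffD1, rotated])
      (use W in \<open>auto simp: transition_def chart_inv_chart[OF \<mu>] chart_inv_chart[OF \<kappa>]\<close>)
qed

lemma smooth_in_const: "smooth_in W (\<lambda>p. c)"
  by (simp add: smooth_in_def o_def Cinf_on_const)

context
  fixes W assumes W: "oS W"
begin

lemma smooth_in_add: "smooth_in W u \<Longrightarrow> smooth_in W v \<Longrightarrow> smooth_in W (\<lambda>p. u p + v p)"
  and smooth_in_diff: "smooth_in W u \<Longrightarrow> smooth_in W v \<Longrightarrow> smooth_in W (\<lambda>p. u p - v p)"
  and smooth_in_mult: "smooth_in W u \<Longrightarrow> smooth_in W v \<Longrightarrow> smooth_in W (\<lambda>p. u p * v p)"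
  and smooth_in_minus: "smooth_in W u \<Longrightarrow> smooth_in W (\<lambda>p. - u p)"
  by (auto simp: smooth_in_def o_def
      intro!: Cinf_on_add Cinf_on_diff Cinf_on_mult Cinf_on_minus open_chart_part[OF _ W])

lemma smooth_in_compose:
  assumes "open V" "Cinf_on V g" "\<And>p. p \<in> W \<Longrightarrow> u p \<in> V" "smooth_in W u"
  shows "smooth_in W (\<lambda>p. g (u p))"
  unfolding smooth_in_def o_def
proof
  fix \<kappa> assume \<kappa>: "\<kappa> \<in> A"
  show "Cinf_on (snd \<kappa> ` (fst \<kappa> \<inter> W)) (\<lambda>x. g (u (chart_inv \<kappa> x)))"
    by (rule Cinf_on_compose[OF open_chart_part[OF \<kappa> W] assms(1) _ _ assms(2)])
      (use assms(3,4) \<kappa> chart_inv_chart[OF \<kappa>] in \<open>auto simp: smooth_in_def o_def\<close>)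
qed

lemma smooth_in_inverse: "smooth_in W u \<Longrightarrow> (\<And>p. p \<in> W \<Longrightarrow> u p \<noteq> 0) \<Longrightarrow> smooth_in W (\<lambda>p. inverse (u p))"
  by (rule smooth_in_compose[where V="- {0}"]) (auto simp: Cinf_on_inverse)

lemma smooth_in_divide:
  "smooth_in W u \<Longrightarrow> smooth_in W v \<Longrightarrow> (\<And>p. p \<in> W \<Longrightarrow> v p \<noteq> 0) \<Longrightarrow> smooth_in W (\<lambda>p. u p / v p)"
  unfolding divide_inverse by (intro smooth_in_mult smooth_in_inverse)

lemma smooth_in_sqrt: "smooth_in W u \<Longrightarrow> (\<And>p. p \<in> W \<Longrightarrow> 0 < u p) \<Longrightarrow> smooth_in W (\<lambda>p. sqrt (u p))"
  by (rule smooth_in_compose[where V="{0<..}"]) (auto simp: Cinf_on_sqrt)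

end

lemma smooth_in_sum:
  assumes "oS W" "\<And>i. i \<in> I \<Longrightarrow> smooth_in W (u i)"
  shows "smooth_in W (\<lambda>p. \<Sum>i\<in>I. u i p)"
  using assms(2)
  by (induction I rule: infinite_finite_induct) (auto intro: smooth_in_add[OF assms(1)] smooth_in_const)

lemma smooth_in_sum_list:
  assumes "oS W" "\<And>f. f \<in> set fs \<Longrightarrow> smooth_in W (u f)"
  shows "smooth_in W (\<lambda>p. \<Sum>f\<leftarrow>fs. u f p)"
  using assms(2) by (induction fs) (auto intro: smooth_in_add[OF assms(1)] smooth_in_const)

lemma smooth_in_continuous:
  assumes W: "oS W" and u: "smooth_in W u"
  shows "continuous_on W u"
  unfolding continuous_openin_preimage_eq
proof (intro allI impI)
  fix T :: "real set" assume T: "open T"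
  have "oS (W \<inter> u -` T)"
  proof (rule oS_local)
    fix p assume p: "p \<in> W \<inter> u -` T"
    then obtain \<kappa> where \<kappa>: "\<kappa> \<in> A" "p \<in> fst \<kappa>" using chart_cover oS_sub[OF W] by blast
    let ?V = "snd \<kappa> ` (fst \<kappa> \<inter> W)"
    have oV: "open ?V" using open_chart_part \<kappa> W by blast
    have "continuous_on ?V (u \<circ> chart_inv \<kappa>)"
      using u \<kappa> Cinf_on_continuous unfolding smooth_in_def by blast
    then have "open (?V \<inter> (u \<circ> chart_inv \<kappa>) -` T)"
      using oV T continuous_on_open_vimage by (metis Int_commute)
    then have "oS (fst \<kappa> \<inter> snd \<kappa> -` (?V \<inter> (u \<circ> chart_inv \<kappa>) -` T))"
      by (rule oS_chart_vimage[OF \<kappa>(1)])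
    moreover have "p \<in> fst \<kappa> \<inter> snd \<kappa> -` (?V \<inter> (u \<circ> chart_inv \<kappa>) -` T)"
      using p \<kappa> chart_inv_chart by auto
    moreover have "fst \<kappa> \<inter> snd \<kappa> -` (?V \<inter> (u \<circ> chart_inv \<kappa>) -` T) \<subseteq> W \<inter> u -` T"
      by (auto simp: chart_inv_chart[OF \<kappa>(1)] dest: inj_onD[OF chart_inj[OF \<kappa>(1)]])
    ultimately show "\<exists>V. oS V \<and> p \<in> V \<and> V \<subseteq> W \<inter> u -` T" by blast
  qed
  then show "openin (top_of_set W) (W \<inter> u -` T)"
    by (meson Int_lower1 W oS_sub openin_subset_trans)
qed

lemma smooth_in_greater: "oS W \<Longrightarrow> smooth_in W u \<Longrightarrow> oS {p \<in> W. c < u p}"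
proof -
  assume "oS W" "smooth_in W u"
  then have "openin (top_of_set W) (W \<inter> u -` {c<..})"
    by (intro continuous_openin_preimage_gen smooth_in_continuous) auto
  then have "oS (W \<inter> u -` {c<..})" using \<open>oS W\<close> openin_trans by blast
  then show ?thesis by (simp add: vimage_def Int_def)
qed

section \<open>Partial derivatives in a chart and their transformation\<close>

lemma smooth_in_has_derivative:
  assumes "\<kappa> \<in> A" "smooth_in W u" "p \<in> fst \<kappa> \<inter> W"
  shows "(u \<circ> chart_inv \<kappa> has_derivative (\<lambda>v. v $ 1 * pd \<kappa> 1 u p + v $ 2 * pd \<kappa> 2 u p)) (at (snd \<kappa> p))"
proof -
  let ?D = "frechet_derivative (u \<circ> chart_inv \<kappa>) (at (snd \<kappa> p))"
  have D: "(u \<circ> chart_inv \<kappa> has_derivative ?D) (at (snd \<kappa> p))"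
    using assms Cinf_on_differentiable unfolding smooth_in_def by (metis frechet_derivative_works imageI)
  have "?D v = v $ 1 * pd \<kappa> 1 u p + v $ 2 * pd \<kappa> 2 u p" for v
  proof -
    have "v = v $ 1 *\<^sub>R axis 1 1 + v $ 2 *\<^sub>R axis 2 1"
      by (simp add: vec_eq_iff forall_2 axis_def)
    from arg_cong[OF this, of ?D] show ?thesis
      using has_derivative_linear[OF D] by (simp add: pd_def linear_add linear_cmul)
  qed
  then have "?D = (\<lambda>v. v $ 1 * pd \<kappa> 1 u p + v $ 2 * pd \<kappa> 2 u p)" by (rule ext)
  with D show ?thesis by (simp only:)
qed

lemma pd_eqI:
  assumes "(u \<circ> chart_inv \<kappa> has_derivative D) (at (snd \<kappa> p))"
  shows "pd \<kappa> i u p = D (axis i 1)"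
  using frechet_derivative_eqI[OF assms] by (simp add: pd_def)

lemma has_derivative_of_pd:
  assumes "\<kappa> \<in> A" "smooth_in W u" "p \<in> fst \<kappa> \<inter> W"
  shows "(u \<circ> chart_inv \<kappa> has_derivative frechet_derivative (u \<circ> chart_inv \<kappa>) (at (snd \<kappa> p))) (at
    (snd \<kappa> p))"
  using smooth_in_has_derivative[OF assms]
  unfolding frechet_derivative_eqI[OF smooth_in_has_derivative[OF assms]] .

lemma pd_cong:
  assumes "\<kappa> \<in> A" "oS V" "p \<in> V" "p \<in> fst \<kappa>" "\<And>q. q \<in> V \<Longrightarrow> u q = v q"
  shows "pd \<kappa> i u p = pd \<kappa> i v p"
proof -
  have "frechet_derivative (u \<circ> chart_inv \<kappa>) (at (snd \<kappa> p)) = frechet_derivative (v \<circ> chart_inv \<kappa>)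
    (at (snd \<kappa> p))"
    by (rule frechet_derivative_cong_open[OF open_chart_part[OF assms(1,2)]])
      (use assms chart_inv_chart in auto)
  then show ?thesis by (simp add: pd_def)
qed

lemma pd_const: "pd \<kappa> i (\<lambda>p. c) p = 0"
  by (simp add: pd_def o_def)

context
  fixes \<kappa> W p assumes \<kappa>: "\<kappa> \<in> A" and p: "p \<in> fst \<kappa> \<inter> W"
begin

lemma pd_add: "smooth_in W u \<Longrightarrow> smooth_in W v \<Longrightarrow> pd \<kappa> i (\<lambda>p. u p + v p) p = pd \<kappa> i u p + pd \<kappa> i v p"
  and pd_diff: "smooth_in W u \<Longrightarrow> smooth_in W v \<Longrightarrow> pd \<kappa> i (\<lambda>p. u p - v p) p = pd \<kappa> i u p - pd \<kappa> i v p"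
  and pd_mult: "smooth_in W u \<Longrightarrow> smooth_in W v \<Longrightarrow>
    pd \<kappa> i (\<lambda>p. u p * v p) p = pd \<kappa> i u p * v p + u p * pd \<kappa> i v p"
proof -
  have cp: "chart_inv \<kappa> (snd \<kappa> p) = p" using chart_inv_chart[OF \<kappa>] p by auto
  note D = has_derivative_of_pd[OF \<kappa> _ p, unfolded o_def]
  assume u: "smooth_in W u"
  assume v: "smooth_in W v"
  show "pd \<kappa> i (\<lambda>p. u p + v p) p = pd \<kappa> i u p + pd \<kappa> i v p"
    using pd_eqI[unfolded o_def, OF has_derivative_add[OF D[OF u] D[OF v]], of i]
    by (simp add: pd_def o_def)
  show "pd \<kappa> i (\<lambda>p. u p - v p) p = pd \<kappa> i u p - pd \<kappa> i v p"
    using pd_eqI[unfolded o_def, OF has_derivative_diff[OF D[OF u] D[OF v]], of i]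
    by (simp add: pd_def o_def)
  show "pd \<kappa> i (\<lambda>p. u p * v p) p = pd \<kappa> i u p * v p + u p * pd \<kappa> i v p"
    using pd_eqI[unfolded o_def, OF has_derivative_mult[OF D[OF u] D[OF v]], of i]
    by (simp add: pd_def o_def cp)
qed

lemma pd_compose:
  assumes "smooth_in W u" "(g has_real_derivative g') (at (u p))"
  shows "pd \<kappa> i (\<lambda>p. g (u p)) p = g' * pd \<kappa> i u p"
proof -
  have cp: "chart_inv \<kappa> (snd \<kappa> p) = p" using chart_inv_chart[OF \<kappa>] p by auto
  have g: "(g has_derivative (*) g') (at ((u \<circ> chart_inv \<kappa>) (snd \<kappa> p)))"
    using assms(2) cp by (simp add: has_field_derivative_def)
  from pd_eqI[unfolded o_def, OF has_derivative_compose[OF has_derivative_of_pd[OF \<kappa> assms(1) p] g,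
    unfolded o_def], of i]
  show ?thesis by (simp add: pd_def o_def)
qed

end

lemma pd_smooth: "\<kappa> \<in> A \<Longrightarrow> oS W \<Longrightarrow> smooth_in W u \<Longrightarrow> smooth_in (fst \<kappa> \<inter> W) (pd \<kappa> i u)"
proof -
  assume \<kappa>: "\<kappa> \<in> A" and W: "oS W" and u: "smooth_in W u"
  have o: "open (snd \<kappa> ` (fst \<kappa> \<inter> W))" by (rule open_chart_part[OF \<kappa> W])
  have "Cinf_on (snd \<kappa> ` (fst \<kappa> \<inter> W)) (\<lambda>x. frechet_derivative (u \<circ> chart_inv \<kappa>) (at x) (axis i 1))"
    using u \<kappa> by (intro Cinf_on_frechet_derivative) (auto simp: smooth_in_def)
  then have "Cinf_on (snd \<kappa> ` (fst \<kappa> \<inter> W)) (pd \<kappa> i u \<circ> chart_inv \<kappa>)"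
    by (rule Cinf_on_cong[OF o, THEN iffD1, rotated]) (auto simp: pd_def chart_inv_chart[OF \<kappa>])
  then show ?thesis
    by (intro smooth_in_chartI[OF \<kappa>] oS_Int chart_open \<kappa> W) auto
qed

lemma pd_commute:
  assumes "\<kappa> \<in> A" "oS W" "smooth_in W u" "p \<in> fst \<kappa> \<inter> W"
  shows "pd \<kappa> i (pd \<kappa> k u) p = pd \<kappa> k (pd \<kappa> i u) p"
proof -
  let ?U = "snd \<kappa> ` (fst \<kappa> \<inter> W)" and ?f = "u \<circ> chart_inv \<kappa>"
  have U: "open ?U" "snd \<kappa> p \<in> ?U" "Cinf_on ?U ?f"
    using open_chart_part[OF assms(1,2)] assms by (auto simp: smooth_in_def)
  have "frechet_derivative (pd \<kappa> k u \<circ> chart_inv \<kappa>) (at (snd \<kappa> p))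
      = frechet_derivative (\<lambda>y. frechet_derivative ?f (at y) (axis k 1)) (at (snd \<kappa> p))" for k
    by (rule frechet_derivative_cong_open[OF U(1,2)]) (auto simp: pd_def chart_inv_chart[OF assms(1)])
  then show ?thesis
    using mixed_derivatives_commute[OF U] by (simp add: pd_def)
qed

lemma crd_smooth: "\<kappa> \<in> A \<Longrightarrow> smooth_in (fst \<kappa>) (crd \<kappa> k)"
proof (rule smooth_in_chartI)
  assume \<kappa>: "\<kappa> \<in> A"
  have "Cinf_on (chart_image \<kappa>) (\<lambda>x. x $ k)" by (rule Cinf_on_bounded_linear[OF bounded_linear_vec_nth])
  then show "Cinf_on (chart_image \<kappa>) (crd \<kappa> k \<circ> chart_inv \<kappa>)"
    by (rule Cinf_on_cong[OF open_chart_image[OF \<kappa>], THEN iffD1, rotated]) (simp add: crd_def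
    chart_inv_chart[OF \<kappa>] chart_chart_inv[OF \<kappa>])
qed (auto simp: chart_open)

lemma pd_crd:
  assumes "\<kappa> \<in> A" "p \<in> fst \<kappa>" shows "pd \<kappa> i (crd \<kappa> k) p = (if i = k then 1 else 0)"
proof -
  have "((\<lambda>x. x $ k) has_derivative (\<lambda>x. x $ k)) (at (snd \<kappa> p))"
    by (intro bounded_linear_imp_has_derivative bounded_linear_vec_nth)
  then have "((crd \<kappa> k \<circ> chart_inv \<kappa>) has_derivative (\<lambda>x. x $ k)) (at (snd \<kappa> p))"
    by (rule has_derivative_transform_within_open[OF _ open_chart_image[OF assms(1)]])
      (use assms in \<open>auto simp: crd_def chart_inv_chart[OF assms(1)]\<close>)
  from pd_eqI[OF this] show ?thesis by (simp add: axis_def)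
qed

text \<open>The entries of the Jacobian matrix of a transition map are partial derivatives of
  coordinate functions, so every change of chart can be computed with \<open>pd\<close>
  alone.\<close>

lemma transition_has_derivative:
  assumes "\<kappa> \<in> A" "\<mu> \<in> A" "p \<in> fst \<kappa> \<inter> fst \<mu>"
  shows "(transition \<kappa> \<mu> has_derivative frechet_derivative (transition \<kappa> \<mu>) (at (snd \<kappa> p))) (at (snd
    \<kappa> p))"
    and "frechet_derivative (transition \<kappa> \<mu>) (at (snd \<kappa> p)) v $ k
      = v $ 1 * pd \<kappa> 1 (crd \<mu> k) p + v $ 2 * pd \<kappa> 2 (crd \<mu> k) p"
proof -
  let ?D = "frechet_derivative (transition \<kappa> \<mu>) (at (snd \<kappa> p))"
  show D: "(transition \<kappa> \<mu> has_derivative ?D) (at (snd \<kappa> p))"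
    using Cinf_on_differentiable[OF transition_smooth[OF assms(1,2)]] assms(3)
    by (metis frechet_derivative_works imageI)
  have 1: "((\<lambda>x. transition \<kappa> \<mu> x $ k) has_derivative (\<lambda>v. ?D v $ k)) (at (snd \<kappa> p))"
    using bounded_linear.has_derivative[OF bounded_linear_vec_nth D] .
  have 2: "(crd \<mu> k \<circ> chart_inv \<kappa>) = (\<lambda>x. transition \<kappa> \<mu> x $ k)"
    by (auto simp: crd_def transition_def)
  have "smooth_in (fst \<mu>) (crd \<mu> k)" by (rule crd_smooth[OF assms(2)])
  from has_derivative_unique[OF 1 smooth_in_has_derivative[OF assms(1) this assms(3), unfolded 2]]
  show "?D v $ k = v $ 1 * pd \<kappa> 1 (crd \<mu> k) p + v $ 2 * pd \<kappa> 2 (crd \<mu> k) p"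
    by (rule fun_cong)
qed

lemma pd_chain:
  assumes \<kappa>: "\<kappa> \<in> A" and \<mu>: "\<mu> \<in> A" and W: "oS W" "smooth_in W u" and p: "p \<in> fst \<kappa> \<inter> fst \<mu> \<inter> W"
  shows "pd \<kappa> i u p = pd \<mu> 1 u p * pd \<kappa> i (crd \<mu> 1) p + pd \<mu> 2 u p * pd \<kappa> i (crd \<mu> 2) p"
proof -
  have pk: "p \<in> fst \<kappa> \<inter> fst \<mu>" "p \<in> fst \<mu> \<inter> W" using p by auto
  have t: "transition \<kappa> \<mu> (snd \<kappa> p) = snd \<mu> p" using p chart_inv_chart[OF \<kappa>]
    by (auto simp: transition_def)
  have 1: "((\<lambda>x. (u \<circ> chart_inv \<mu>) (transition \<kappa> \<mu> x)) has_derivative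
     (\<lambda>v. frechet_derivative (transition \<kappa> \<mu>) (at (snd \<kappa> p)) v $ 1 * pd \<mu> 1 u p
        + frechet_derivative (transition \<kappa> \<mu>) (at (snd \<kappa> p)) v $ 2 * pd \<mu> 2 u p)) (at (snd \<kappa> p))"
    by (rule has_derivative_compose[OF transition_has_derivative(1)[OF \<kappa> \<mu> pk(1)]])
      (unfold t, rule smooth_in_has_derivative[OF \<mu> W(2) pk(2)])
  then have "(u \<circ> chart_inv \<kappa> has_derivative
     (\<lambda>v. frechet_derivative (transition \<kappa> \<mu>) (at (snd \<kappa> p)) v $ 1 * pd \<mu> 1 u p
        + frechet_derivative (transition \<kappa> \<mu>) (at (snd \<kappa> p)) v $ 2 * pd \<mu> 2 u p)) (at (snd \<kappa> p))"
    by (rule has_derivative_transform_within_open[OF _ open_chart_part[OF \<kappa> chart_open[OF \<mu>]]])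
      (use p in \<open>auto simp: transition_def chart_inv_chart[OF \<kappa>] chart_inv_chart[OF \<mu>]\<close>)
  from pd_eqI[OF this, of i] show ?thesis
    using exhaust_2[of i]
    by (auto simp: transition_has_derivative(2)[OF \<kappa> \<mu> pk(1)] axis_def algebra_simps)
qed

lemma wedge_chain:
  assumes "\<kappa> \<in> A" "\<mu> \<in> A" "oS W" "smooth_in W f" "smooth_in W g" "p \<in> fst \<kappa> \<inter> fst \<mu> \<inter> W"
  shows "wedge \<kappa> f g p = jac \<kappa> \<mu> p * wedge \<mu> f g p"
  unfolding wedge_def
  unfolding pd_chain[OF assms(1-4,6)] pd_chain[OF assms(1-3,5,6)] by (simp add: algebra_simps)

text \<open>The Jacobian of the identity, which is \<open>1\<close>, factors through the other
  chart.\<close>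

lemma jac_nonzero:
  assumes "\<kappa> \<in> A" "\<mu> \<in> A" "p \<in> fst \<kappa> \<inter> fst \<mu>" shows "jac \<kappa> \<mu> p \<noteq> 0"
proof -
  have "jac \<kappa> \<kappa> p = 1" using assms by (simp add: wedge_def pd_crd)
  moreover have "jac \<kappa> \<kappa> p = jac \<kappa> \<mu> p * wedge \<mu> (crd \<kappa> 1) (crd \<kappa> 2) p"
    by (rule wedge_chain[of _ _ "fst \<kappa>"]) (use assms crd_smooth chart_open in auto)
  ultimately show ?thesis by auto
qed

end

section \<open>The Laplacian of an immersion\<close>

text \<open>The metric is the pullback of the Euclidean metric under the map with components \<open>fs\<close>;
  this makes its transformation behaviour a consequence of the chain rule for functions.\<close>

definition gE :: "('a \<Rightarrow> real) list \<Rightarrow> 'a chart \<Rightarrow> 'a \<Rightarrow> real" where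
  "gE fs \<kappa> p = (\<Sum>f\<leftarrow>fs. pd \<kappa> 1 f p * pd \<kappa> 1 f p)"

definition gF :: "('a \<Rightarrow> real) list \<Rightarrow> 'a chart \<Rightarrow> 'a \<Rightarrow> real" where
  "gF fs \<kappa> p = (\<Sum>f\<leftarrow>fs. pd \<kappa> 1 f p * pd \<kappa> 2 f p)"

definition gG :: "('a \<Rightarrow> real) list \<Rightarrow> 'a chart \<Rightarrow> 'a \<Rightarrow> real" where
  "gG fs \<kappa> p = (\<Sum>f\<leftarrow>fs. pd \<kappa> 2 f p * pd \<kappa> 2 f p)"

text \<open>The square root of the Gram determinant, the density of Riemannian area in the
  chart.\<close>

definition rt :: "('a \<Rightarrow> real) list \<Rightarrow> 'a chart \<Rightarrow> 'a \<Rightarrow> real" where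
  "rt fs \<kappa> p = sqrt (gE fs \<kappa> p * gG fs \<kappa> p - gF fs \<kappa> p * gF fs \<kappa> p)"

text \<open>\<open>(star1, star2)\<close> are the components of \<open>du \<circ> j\<close> for the rotation \<open>j\<close> by \<open>\<pi>/2\<close> with respect
  to the orientation of the chart. Hence \<open>lap_in\<close> is minus the Laplace-Beltrami operator.\<close>

definition star1 :: "('a \<Rightarrow> real) list \<Rightarrow> 'a chart \<Rightarrow> ('a \<Rightarrow> real) \<Rightarrow> 'a \<Rightarrow> real" where
  "star1 fs \<kappa> u p = (gE fs \<kappa> p * pd \<kappa> 2 u p - gF fs \<kappa> p * pd \<kappa> 1 u p) / rt fs \<kappa> p"

definition star2 :: "('a \<Rightarrow> real) list \<Rightarrow> 'a chart \<Rightarrow> ('a \<Rightarrow> real) \<Rightarrow> 'a \<Rightarrow> real" where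
  "star2 fs \<kappa> u p = (gF fs \<kappa> p * pd \<kappa> 2 u p - gG fs \<kappa> p * pd \<kappa> 1 u p) / rt fs \<kappa> p"

definition lap_in :: "('a \<Rightarrow> real) list \<Rightarrow> 'a chart \<Rightarrow> ('a \<Rightarrow> real) \<Rightarrow> 'a \<Rightarrow> real" where
  "lap_in fs \<kappa> u p = (pd \<kappa> 1 (star2 fs \<kappa> u) p - pd \<kappa> 2 (star1 fs \<kappa> u) p) / rt fs \<kappa> p"

text \<open>The squared norm of \<open>du\<close>: the inverse of the metric matrix, written with
  its adjugate, evaluated on the partial derivatives of \<open>u\<close>.\<close>

definition gradsq :: "('a \<Rightarrow> real) list \<Rightarrow> 'a chart \<Rightarrow> ('a \<Rightarrow> real) \<Rightarrow> 'a \<Rightarrow> real" where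
  "gradsq fs \<kappa> u p = (gG fs \<kappa> p * (pd \<kappa> 1 u p * pd \<kappa> 1 u p) - 2 * gF fs \<kappa> p * (pd \<kappa> 1 u p * pd \<kappa> 2 u p)
     + gE fs \<kappa> p * (pd \<kappa> 2 u p * pd \<kappa> 2 u p)) / (rt fs \<kappa> p * rt fs \<kappa> p)"

locale immersed_surface = surface_atlas S A
  for S :: "'a::t2_space set" and A :: "'a chart set" +
  fixes fs :: "('a \<Rightarrow> real) list"
  assumes smooth_fs: "f \<in> set fs \<Longrightarrow> smooth_in S f"
    and immersion: "\<kappa> \<in> A \<Longrightarrow> p \<in> fst \<kappa> \<Longrightarrow> \<exists>f\<in>set fs. \<exists>g\<in>set fs. wedge \<kappa> f g p \<noteq> 0"
begin

text \<open>The pulled-back metric on two tangent vectors with components \<open>(x, y)\<close> and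
  \<open>(z, w)\<close>. Positivity and the behaviour under a change of chart are both read off from
  this identity.\<close>

lemma metric_sum:
  "(\<Sum>f\<leftarrow>fs. (x * pd \<kappa> 1 f p + y * pd \<kappa> 2 f p) * (z * pd \<kappa> 1 f p + w * pd \<kappa> 2 f p))
   = x * z * gE fs \<kappa> p + (x * w + y * z) * gF fs \<kappa> p + y * w * gG fs \<kappa> p"
proof -
  have "(\<Sum>f\<leftarrow>l. (x * pd \<kappa> 1 f p + y * pd \<kappa> 2 f p) * (z * pd \<kappa> 1 f p + w * pd \<kappa> 2 f p))
   = x * z * gE l \<kappa> p + (x * w + y * z) * gF l \<kappa> p + y * w * gG l \<kappa> p" for l
    by (induction l) (simp_all add: gE_def gF_def gG_def algebra_simps)
  then show ?thesis .
qed

context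
  fixes \<kappa> p assumes \<kappa>: "\<kappa> \<in> A" and p: "p \<in> fst \<kappa>"
begin

text \<open>Two components of the immersion have independent differentials, so one of them does not
  annihilate the vector \<open>(x, y)\<close> and contributes a positive term to a sum of
  squares.\<close>

lemma metric_pos:
  assumes "x \<noteq> 0 \<or> y \<noteq> 0"
  shows "0 < x * x * gE fs \<kappa> p + 2 * x * y * gF fs \<kappa> p + y * y * gG fs \<kappa> p"
proof -
  define l where "l f = x * pd \<kappa> 1 f p + y * pd \<kappa> 2 f p" for f
  obtain f g where fg: "f \<in> set fs" "g \<in> set fs" "wedge \<kappa> f g p \<noteq> 0"
    using immersion[OF \<kappa> p] by blast
  have "l f \<noteq> 0 \<or> l g \<noteq> 0"
  proof (rule ccontr)
    assume "\<not> ?thesis"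
    then have 0: "l f = 0" "l g = 0" by auto
    \<comment> \<open>Cramer's rule recovers \<open>(x, y)\<close> from the two values
      \<open>l f\<close> and \<open>l g\<close>.\<close>
    have "x * wedge \<kappa> f g p = pd \<kappa> 2 g p * l f - pd \<kappa> 2 f p * l g"
      "y * wedge \<kappa> f g p = pd \<kappa> 1 f p * l g - pd \<kappa> 1 g p * l f"
      by (simp_all add: wedge_def l_def algebra_simps)
    then show False using 0 fg assms by auto
  qed
  then obtain h where h: "h \<in> set fs" "l h \<noteq> 0" using fg by blast
  have "0 < (\<Sum>f\<leftarrow>fs. l f * l f)"
  proof -
    have "l h * l h \<le> (\<Sum>f\<leftarrow>fs. l f * l f)"
      using h(1) by (intro member_le_sum_list) (auto simp: image_iff)
    moreover have "0 < l h * l h" using h(2) by (simp add: zero_less_mult_iff) linarith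
    ultimately show ?thesis by linarith
  qed
  then show ?thesis unfolding l_def metric_sum by (simp add: algebra_simps)
qed

lemma gE_pos: "gE fs \<kappa> p > 0" and gG_pos: "gG fs \<kappa> p > 0"
  using metric_pos[of 1 0] metric_pos[of 0 1] by simp_all

text \<open>The metric at the vector \<open>(G, - F)\<close> equals \<open>G\<close> times the
  discriminant.\<close>

lemma disc_pos: "gE fs \<kappa> p * gG fs \<kappa> p - gF fs \<kappa> p * gF fs \<kappa> p > 0"
proof -
  have "0 < gG fs \<kappa> p * (gE fs \<kappa> p * gG fs \<kappa> p - gF fs \<kappa> p * gF fs \<kappa> p)"
    using metric_pos[of "gG fs \<kappa> p" "- gF fs \<kappa> p"] gG_pos by (simp add: algebra_simps)
  then show ?thesis using gG_pos by (simp add: zero_less_mult_iff)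
qed

lemma rt_pos: "rt fs \<kappa> p > 0"
  and rt_sq: "rt fs \<kappa> p * rt fs \<kappa> p = gE fs \<kappa> p * gG fs \<kappa> p - gF fs \<kappa> p * gF fs \<kappa> p"
  using disc_pos by (simp_all add: rt_def)

text \<open>The numerator is the metric at the rotated vector of partial derivatives of
  \<open>u\<close>.\<close>

lemma gradsq_pos: "pd \<kappa> 1 u p \<noteq> 0 \<or> pd \<kappa> 2 u p \<noteq> 0 \<Longrightarrow> gradsq fs \<kappa> u p > 0"
proof -
  assume "pd \<kappa> 1 u p \<noteq> 0 \<or> pd \<kappa> 2 u p \<noteq> 0"
  then show ?thesis
    using metric_pos[of "pd \<kappa> 2 u p" "- pd \<kappa> 1 u p"] rt_pos
    unfolding gradsq_def by (intro divide_pos_pos mult_pos_pos) (auto simp: algebra_simps)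
qed

end

context
  fixes \<kappa> assumes \<kappa>: "\<kappa> \<in> A"
begin

lemma metric_smooth: "smooth_in (fst \<kappa>) (gE fs \<kappa>)" "smooth_in (fst \<kappa>) (gF fs \<kappa>)"
  "smooth_in (fst \<kappa>) (gG fs \<kappa>)"
proof -
  have o: "oS (fst \<kappa>)" by (rule chart_open[OF \<kappa>])
  have "smooth_in (fst \<kappa>) (pd \<kappa> i f)" if "f \<in> set fs" for f i
    using pd_smooth[OF \<kappa> oS_S smooth_fs[OF that]] oS_sub[OF o] by (simp add: Int_absorb2)
  then show "smooth_in (fst \<kappa>) (gE fs \<kappa>)" "smooth_in (fst \<kappa>) (gF fs \<kappa>)" "smooth_in (fst \<kappa>) (gG fs \<kappa>)"
    unfolding gE_def[abs_def] gF_def[abs_def] gG_def[abs_def]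
    by (auto intro!: smooth_in_sum_list smooth_in_mult o)
qed

lemma rt_smooth: "smooth_in (fst \<kappa>) (rt fs \<kappa>)"
  unfolding rt_def[abs_def]
  by (intro smooth_in_sqrt smooth_in_diff smooth_in_mult metric_smooth chart_open \<kappa> disc_pos)

lemma star_smooth:
  assumes W: "oS W" "smooth_in W u"
  shows "smooth_in (fst \<kappa> \<inter> W) (star1 fs \<kappa> u)" "smooth_in (fst \<kappa> \<inter> W) (star2 fs \<kappa> u)"
proof -
  have o: "oS (fst \<kappa> \<inter> W)" using chart_open[OF \<kappa>] W oS_Int by blast
  note sub = smooth_in_subset[of "fst \<kappa>" _ "fst \<kappa> \<inter> W", OF _ Int_lower1]
  show "smooth_in (fst \<kappa> \<inter> W) (star1 fs \<kappa> u)" "smooth_in (fst \<kappa> \<inter> W) (star2 fs \<kappa> u)"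
    unfolding star1_def[abs_def] star2_def[abs_def]
    by (intro smooth_in_divide smooth_in_diff smooth_in_mult o sub metric_smooth rt_smooth pd_smooth \<kappa> W;
        use rt_pos[OF \<kappa>] in force)+
qed

lemma lap_in_smooth:
  assumes W: "oS W" "smooth_in W u"
  shows "smooth_in (fst \<kappa> \<inter> W) (lap_in fs \<kappa> u)"
proof -
  have o: "oS (fst \<kappa> \<inter> W)" using chart_open[OF \<kappa>] W oS_Int by blast
  have *: "smooth_in (fst \<kappa> \<inter> W) (pd \<kappa> i f)" if "smooth_in (fst \<kappa> \<inter> W) f" for f i
    using pd_smooth[OF \<kappa> o that] by (simp add: Int_assoc[symmetric])
  show ?thesis
    unfolding lap_in_def[abs_def]
    by (intro smooth_in_divide smooth_in_diff o * star_smooth W smooth_in_subset[OF rt_smooth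
    Int_lower1])
      (use rt_pos[OF \<kappa>] in force)
qed

end

lemma metric_chain:
  assumes \<kappa>: "\<kappa> \<in> A" and \<mu>: "\<mu> \<in> A" and p: "p \<in> fst \<kappa> \<inter> fst \<mu>"
  defines "a \<equiv> pd \<kappa> 1 (crd \<mu> 1) p" and "b \<equiv> pd \<kappa> 2 (crd \<mu> 1) p"
    and "c \<equiv> pd \<kappa> 1 (crd \<mu> 2) p" and "d \<equiv> pd \<kappa> 2 (crd \<mu> 2) p"
  shows "gE fs \<kappa> p = a * a * gE fs \<mu> p + (a * c + c * a) * gF fs \<mu> p + c * c * gG fs \<mu> p"
    and "gF fs \<kappa> p = a * b * gE fs \<mu> p + (a * d + c * b) * gF fs \<mu> p + c * d * gG fs \<mu> p"
    and "gG fs \<kappa> p = b * b * gE fs \<mu> p + (b * d + d * b) * gF fs \<mu> p + d * d * gG fs \<mu> p"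
proof -
  have pS: "p \<in> fst \<kappa> \<inter> fst \<mu> \<inter> S" using p oS_sub[OF chart_open[OF \<kappa>]] by auto
  have 1: "pd \<kappa> 1 f p = a * pd \<mu> 1 f p + c * pd \<mu> 2 f p"
    and 2: "pd \<kappa> 2 f p = b * pd \<mu> 1 f p + d * pd \<mu> 2 f p" if "f \<in> set fs" for f
    unfolding a_def b_def c_def d_def
    using pd_chain[OF \<kappa> \<mu> oS_S smooth_fs[OF that] pS] by (simp_all add: mult.commute)
  show "gE fs \<kappa> p = a * a * gE fs \<mu> p + (a * c + c * a) * gF fs \<mu> p + c * c * gG fs \<mu> p"
    "gF fs \<kappa> p = a * b * gE fs \<mu> p + (a * d + c * b) * gF fs \<mu> p + c * d * gG fs \<mu> p"
    "gG fs \<kappa> p = b * b * gE fs \<mu> p + (b * d + d * b) * gF fs \<mu> p + d * d * gG fs \<mu> p"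
    unfolding metric_sum[symmetric] gE_def[of _ \<kappa>] gF_def[of _ \<kappa>] gG_def[of _ \<kappa>]
    by (intro arg_cong[where f=sum_list] map_cong refl; simp add: 1 2)+
qed

lemma jac_eq: "jac \<kappa> \<mu> p = pd \<kappa> 1 (crd \<mu> 1) p * pd \<kappa> 2 (crd \<mu> 2) p - pd \<kappa> 2 (crd \<mu> 1) p * pd \<kappa> 1
  (crd \<mu> 2) p"
  by (simp add: wedge_def)

text \<open>The discriminant is the determinant of a quadratic form, so it picks up the square of
  the Jacobian.\<close>

lemma rt_chain:
  assumes "\<kappa> \<in> A" "\<mu> \<in> A" "p \<in> fst \<kappa> \<inter> fst \<mu>"
  shows "rt fs \<kappa> p = \<bar>jac \<kappa> \<mu> p\<bar> * rt fs \<mu> p"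
proof -
  have "gE fs \<kappa> p * gG fs \<kappa> p - gF fs \<kappa> p * gF fs \<kappa> p
    = (jac \<kappa> \<mu> p)\<^sup>2 * (gE fs \<mu> p * gG fs \<mu> p - gF fs \<mu> p * gF fs \<mu> p)"
    unfolding metric_chain[OF assms] jac_eq by (simp add: power2_eq_square algebra_simps)
  then show ?thesis by (simp add: rt_def real_sqrt_mult)
qed

text \<open>The rotation in a chart follows the orientation of that chart, so the components
  transform like those of a one-form only up to the sign of the Jacobian.\<close>

lemma star_chain:
  assumes \<kappa>: "\<kappa> \<in> A" and \<mu>: "\<mu> \<in> A" and W: "oS W" "smooth_in W u" and p: "p \<in> fst \<kappa> \<inter> fst \<mu> \<inter> W"
  shows "star1 fs \<kappa> u p = sgn (jac \<kappa> \<mu> p) * (pd \<kappa> 1 (crd \<mu> 1) p * star1 fs \<mu> u p + pd \<kappa> 1 (crd \<mu> 2)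
    p * star2 fs \<mu> u p)"
    and "star2 fs \<kappa> u p = sgn (jac \<kappa> \<mu> p) * (pd \<kappa> 2 (crd \<mu> 1) p * star1 fs \<mu> u p + pd \<kappa> 2 (crd \<mu> 2)
      p * star2 fs \<mu> u p)"
proof -
  have p': "p \<in> fst \<kappa> \<inter> fst \<mu>" "p \<in> fst \<mu>" using p by auto
  define J r where "J = jac \<kappa> \<mu> p" and "r = rt fs \<mu> p"
  have J: "J \<noteq> 0" unfolding J_def by (rule jac_nonzero[OF \<kappa> \<mu> p'(1)])
  have r: "r > 0" unfolding r_def by (rule rt_pos[OF \<mu> p'(2)])
  \<comment> \<open>The numerators contribute \<open>J\<close> and the density contributes
    \<open>|J|\<close>; only the sign survives.\<close>
  have sJ: "J * x / (\<bar>J\<bar> * r) = sgn J * (x / r)" for x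
    using J r by (simp add: sgn_if)
  note chain = metric_chain[OF \<kappa> \<mu> p'(1)] pd_chain[OF \<kappa> \<mu> W p]
  have "gE fs \<kappa> p * pd \<kappa> 2 u p - gF fs \<kappa> p * pd \<kappa> 1 u p
      = J * (pd \<kappa> 1 (crd \<mu> 1) p * (gE fs \<mu> p * pd \<mu> 2 u p - gF fs \<mu> p * pd \<mu> 1 u p)
          + pd \<kappa> 1 (crd \<mu> 2) p * (gF fs \<mu> p * pd \<mu> 2 u p - gG fs \<mu> p * pd \<mu> 1 u p))"
    unfolding J_def chain jac_eq by (simp only: algebra_simps)
  then show "star1 fs \<kappa> u p = sgn (jac \<kappa> \<mu> p) * (pd \<kappa> 1 (crd \<mu> 1) p * star1 fs \<mu> u p + pd \<kappa> 1 (crd \<mu>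
    2) p * star2 fs \<mu> u p)"
    unfolding star1_def star2_def rt_chain[OF \<kappa> \<mu> p'(1)] J_def[symmetric] r_def[symmetric]
    by (simp only: sJ times_divide_eq_right add_divide_distrib[symmetric])
  have "gF fs \<kappa> p * pd \<kappa> 2 u p - gG fs \<kappa> p * pd \<kappa> 1 u p
      = J * (pd \<kappa> 2 (crd \<mu> 1) p * (gE fs \<mu> p * pd \<mu> 2 u p - gF fs \<mu> p * pd \<mu> 1 u p)
          + pd \<kappa> 2 (crd \<mu> 2) p * (gF fs \<mu> p * pd \<mu> 2 u p - gG fs \<mu> p * pd \<mu> 1 u p))"
    unfolding J_def chain jac_eq by (simp only: algebra_simps)
  then show "star2 fs \<kappa> u p = sgn (jac \<kappa> \<mu> p) * (pd \<kappa> 2 (crd \<mu> 1) p * star1 fs \<mu> u p + pd \<kappa> 2 (crd \<mu>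
    2) p * star2 fs \<mu> u p)"
    unfolding star1_def star2_def rt_chain[OF \<kappa> \<mu> p'(1)] J_def[symmetric] r_def[symmetric]
    by (simp only: sJ times_divide_eq_right add_divide_distrib[symmetric])
qed

end

section \<open>Independence of the chart and rules for the Laplacian\<close>

context surface_atlas
begin

lemma crd_pd_smooth: "\<kappa> \<in> A \<Longrightarrow> \<mu> \<in> A \<Longrightarrow> smooth_in (fst \<kappa> \<inter> fst \<mu>) (pd \<kappa> i (crd \<mu> k))"
  by (intro pd_smooth crd_smooth chart_open)

lemma wedge_smooth:
  "\<kappa> \<in> A \<Longrightarrow> oS W \<Longrightarrow> smooth_in W f \<Longrightarrow> smooth_in W g \<Longrightarrow> smooth_in (fst \<kappa> \<inter> W) (wedge \<kappa> f g)"
  unfolding wedge_def[abs_def] by (intro smooth_in_diff smooth_in_mult pd_smooth oS_Int chart_open)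

text \<open>A continuous function keeps its sign near a point where it is nonzero, so the sign of a
  Jacobian can be treated as a constant under differentiation.\<close>

lemma wedge_sgn_const:
  assumes "\<kappa> \<in> A" "oS W" "smooth_in W f" "smooth_in W g" "p \<in> fst \<kappa> \<inter> W" "wedge \<kappa> f g p \<noteq> 0"
  obtains N where "oS N" "p \<in> N" "N \<subseteq> fst \<kappa> \<inter> W" "\<And>q. q \<in> N \<Longrightarrow> sgn (wedge \<kappa> f g q) = sgn (wedge \<kappa> f g p)"
proof (rule that)
  let ?s = "sgn (wedge \<kappa> f g p)"
  let ?N = "{q \<in> fst \<kappa> \<inter> W. 0 < ?s * wedge \<kappa> f g q}"
  have o: "oS (fst \<kappa> \<inter> W)" using assms chart_open oS_Int by blast
  show "oS ?N"
    by (intro smooth_in_greater smooth_in_mult smooth_in_const wedge_smooth o assms)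
  show "p \<in> ?N" "?N \<subseteq> fst \<kappa> \<inter> W" using assms(5,6) by (auto simp: sgn_if zero_less_mult_iff)
  show "sgn (wedge \<kappa> f g q) = ?s" if "q \<in> ?N" for q
    using that by (auto simp: sgn_if zero_less_mult_iff split: if_splits)
qed

end

context immersed_surface
begin

text \<open>Near \<open>p\<close> the one-form transforms with a constant sign \<open>s\<close>, so
  its exterior derivative picks up the factor \<open>s J\<close>. The density picks up
  \<open>|J| = s J\<close>, and the quotient is unchanged, whether or not the two charts have the
  same orientation.\<close>

lemma lap_in_chart_independent:
  assumes \<kappa>: "\<kappa> \<in> A" and \<mu>: "\<mu> \<in> A" and W: "oS W" "smooth_in W u" and p: "p \<in> fst \<kappa> \<inter> fst \<mu> \<inter> W"
  shows "lap_in fs \<kappa> u p = lap_in fs \<mu> u p"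
proof -
  have p': "p \<in> fst \<kappa> \<inter> fst \<mu>" "p \<in> fst \<kappa>" "p \<in> fst \<mu>" "p \<in> fst \<kappa> \<inter> (fst \<mu> \<inter> W)"
    "p \<in> fst \<kappa> \<inter> (fst \<kappa> \<inter> (fst \<mu> \<inter> W))" "p \<in> fst \<kappa> \<inter> fst \<mu> \<inter> (fst \<mu> \<inter> W)" using p by auto
  let ?K = "fst \<kappa> \<inter> (fst \<mu> \<inter> W)"
  have oM: "oS (fst \<mu> \<inter> W)" and oK: "oS ?K" using chart_open \<kappa> \<mu> W oS_Int by blast+
  define s where "s = sgn (jac \<kappa> \<mu> p)"
  have J: "jac \<kappa> \<mu> p \<noteq> 0" by (rule jac_nonzero[OF \<kappa> \<mu> p'(1)])
  obtain N where N: "oS N" "p \<in> N" "N \<subseteq> fst \<kappa> \<inter> fst \<mu>" "\<And>q. q \<in> N \<Longrightarrow> sgn (jac \<kappa> \<mu> q) = s"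
    using wedge_sgn_const[OF \<kappa> chart_open[OF \<mu>] crd_smooth[OF \<mu>] crd_smooth[OF \<mu>] p'(1) J]
    unfolding s_def by blast
  have oN: "oS (N \<inter> W)" "p \<in> N \<inter> W" using N W p oS_Int by auto
  let ?t = "\<lambda>i k. pd \<kappa> i (crd \<mu> k)" and ?b1 = "star1 fs \<mu> u" and ?b2 = "star2 fs \<mu> u"
  have st: "smooth_in ?K ?b1" "smooth_in ?K ?b2"
    using star_smooth[OF \<mu> W] by (auto intro: smooth_in_subset)
  have sp: "smooth_in ?K (?t i k)" for i k
    by (rule smooth_in_subset[OF crd_pd_smooth[OF \<kappa> \<mu>]]) auto
  have D: "pd \<kappa> i (\<lambda>q. s * (?t j 1 q * ?b1 q + ?t j 2 q * ?b2 q)) p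
      = s * (pd \<kappa> i (?t j 1) p * ?b1 p + ?t j 1 p * pd \<kappa> i ?b1 p + (pd \<kappa> i (?t j 2) p * ?b2 p + ?t j
        2 p * pd \<kappa> i ?b2 p))"
    for i j
    using pd_mult[OF \<kappa> p'(5) smooth_in_const smooth_in_add[OF oK smooth_in_mult[OF oK sp st(1)]
    smooth_in_mult[OF oK sp st(2)]]]
      pd_add[OF \<kappa> p'(5) smooth_in_mult[OF oK sp st(1)] smooth_in_mult[OF oK sp st(2)]]
      pd_mult[OF \<kappa> p'(5) sp st(1)] pd_mult[OF \<kappa> p'(5) sp st(2)]
    by (simp add: pd_const)
  have NW: "q \<in> fst \<kappa> \<inter> fst \<mu> \<inter> W" "sgn (jac \<kappa> \<mu> q) = s" if "q \<in> N \<inter> W" for q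
    using that N(3,4) by auto
  have S2: "pd \<kappa> 1 (star2 fs \<kappa> u) p = pd \<kappa> 1 (\<lambda>q. s * (?t 2 1 q * ?b1 q + ?t 2 2 q * ?b2 q)) p"
    by (rule pd_cong[OF \<kappa> oN p'(2)]) (simp only: star_chain(2)[OF \<kappa> \<mu> W NW(1)] NW(2))
  have S1: "pd \<kappa> 2 (star1 fs \<kappa> u) p = pd \<kappa> 2 (\<lambda>q. s * (?t 1 1 q * ?b1 q + ?t 1 2 q * ?b2 q)) p"
    by (rule pd_cong[OF \<kappa> oN p'(2)]) (simp only: star_chain(1)[OF \<kappa> \<mu> W NW(1)] NW(2))
  \<comment> \<open>The terms with second derivatives of the transition map cancel by this
    symmetry.\<close>
  have comm: "pd \<kappa> 1 (?t 2 k) p = pd \<kappa> 2 (?t 1 k) p" for k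
    by (rule pd_commute[OF \<kappa> chart_open[OF \<mu>] crd_smooth[OF \<mu>] p'(1)])
  have c1: "pd \<kappa> i ?b1 p = pd \<mu> 1 ?b1 p * ?t i 1 p + pd \<mu> 2 ?b1 p * ?t i 2 p" for i
    by (rule pd_chain[OF \<kappa> \<mu> oM star_smooth(1)[OF \<mu> W] p'(6)])
  have c2: "pd \<kappa> i ?b2 p = pd \<mu> 1 ?b2 p * ?t i 1 p + pd \<mu> 2 ?b2 p * ?t i 2 p" for i
    by (rule pd_chain[OF \<kappa> \<mu> oM star_smooth(2)[OF \<mu> W] p'(6)])
  have "pd \<kappa> 1 (star2 fs \<kappa> u) p - pd \<kappa> 2 (star1 fs \<kappa> u) p
      = s * jac \<kappa> \<mu> p * (pd \<mu> 1 ?b2 p - pd \<mu> 2 ?b1 p)"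
    unfolding S1 S2 D comm c1 c2 jac_eq by (simp only: algebra_simps)
  moreover have "s * jac \<kappa> \<mu> p = \<bar>jac \<kappa> \<mu> p\<bar>" by (simp add: s_def sgn_if)
  ultimately show ?thesis
    using J by (simp add: lap_in_def rt_chain[OF \<kappa> \<mu> p'(1)])
qed

definition lap :: "('a \<Rightarrow> real) \<Rightarrow> 'a \<Rightarrow> real" where
  "lap u p = lap_in fs (chart_at A p) u p"

lemma chart_at: "p \<in> S \<Longrightarrow> chart_at A p \<in> A" "p \<in> S \<Longrightarrow> p \<in> fst (chart_at A p)"
  using someI_ex[of "\<lambda>\<kappa>. \<kappa> \<in> A \<and> p \<in> fst \<kappa>"] chart_cover[of p] unfolding chart_at_def by blast+

lemma lap_eq: "\<kappa> \<in> A \<Longrightarrow> oS W \<Longrightarrow> smooth_in W u \<Longrightarrow> p \<in> fst \<kappa> \<Longrightarrow> p \<in> W \<Longrightarrow> lap u p = lap_in fs \<kappa> u p"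
  unfolding lap_def using oS_sub chart_at
  by (intro lap_in_chart_independent[where W=W]) auto

lemma lap_smooth: assumes "oS W" "smooth_in W u" shows "smooth_in W (lap u)"
proof (rule smooth_in_local)
  fix p assume p: "p \<in> W"
  then obtain \<kappa> where \<kappa>: "\<kappa> \<in> A" "p \<in> fst \<kappa>" using chart_cover oS_sub assms by blast
  have "smooth_in (fst \<kappa> \<inter> W) (lap u)"
    by (rule smooth_in_cong[THEN iffD1, OF _ _ lap_in_smooth[OF \<kappa>(1) assms]])
      (use lap_eq[OF \<kappa>(1) assms] oS_Int chart_open \<kappa> assms in auto)
  then show "\<exists>V. oS V \<and> p \<in> V \<and> smooth_in V (lap u)"
    using p \<kappa> assms chart_open oS_Int by blast
qed

lemma lap_cong:
  assumes "oS V" "p \<in> V" "\<And>q. q \<in> V \<Longrightarrow> u q = v q"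
  shows "lap u p = lap v p"
proof -
  let ?k = "chart_at A p"
  have k: "?k \<in> A" "p \<in> fst ?k" using chart_at oS_sub assms by blast+
  have o: "oS (fst ?k \<inter> V)" "p \<in> fst ?k \<inter> V" using k assms chart_open oS_Int by auto
  have eq: "pd ?k i u q = pd ?k i v q" if "q \<in> fst ?k \<inter> V" for q i
    by (rule pd_cong[OF k(1) assms(1)]) (use that assms in auto)
  have "pd ?k i (star1 fs ?k u) p = pd ?k i (star1 fs ?k v) p"
    "pd ?k i (star2 fs ?k u) p = pd ?k i (star2 fs ?k v) p" for i
    by (rule pd_cong[OF k(1) o k(2)]; use eq in \<open>simp add: star1_def star2_def\<close>)+
  then show ?thesis by (simp add: lap_def lap_in_def)
qed

lemma lap_const: "lap (\<lambda>p. c) p = 0"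
  by (simp add: lap_def lap_in_def star1_def[abs_def] star2_def[abs_def] pd_const)

lemma lap_add:
  assumes W: "oS W" "smooth_in W u" "smooth_in W v" "p \<in> W"
  shows "lap (\<lambda>p. u p + v p) p = lap u p + lap v p"
proof -
  let ?k = "chart_at A p"
  have k: "?k \<in> A" "p \<in> fst ?k" using chart_at oS_sub assms by blast+
  have o: "oS (fst ?k \<inter> W)" "p \<in> fst ?k \<inter> W" "p \<in> fst ?k \<inter> (fst ?k \<inter> W)" using k assms chart_open oS_Int
    by auto
  have "pd ?k i (star1 fs ?k (\<lambda>p. u p + v p)) p = pd ?k i (\<lambda>q. star1 fs ?k u q + star1 fs ?k v q) p"
    "pd ?k i (star2 fs ?k (\<lambda>p. u p + v p)) p = pd ?k i (\<lambda>q. star2 fs ?k u q + star2 fs ?k v q) p" for i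
    by (rule pd_cong[OF k(1) o(1,2) k(2)];
        simp add: star1_def star2_def pd_add[OF k(1) _ W(2,3)] add_divide_distrib[symmetric], simp
          add: algebra_simps)+
  then show ?thesis
    using pd_add[OF k(1) o(3) star_smooth(1)[OF k(1) W(1,2)] star_smooth(1)[OF k(1) W(1,3)]]
      pd_add[OF k(1) o(3) star_smooth(2)[OF k(1) W(1,2)] star_smooth(2)[OF k(1) W(1,3)]]
    by (simp add: lap_def lap_in_def add_divide_distrib[symmetric])
qed

text \<open>The chain rule for a second-order operator. As \<open>lap\<close> is minus the
  Laplacian, the gradient term enters with a minus sign.\<close>

lemma lap_compose:
  assumes W: "oS W" "smooth_in W u" "p \<in> W" and \<kappa>: "\<kappa> \<in> A" "p \<in> fst \<kappa>"
    and V: "open V" "\<And>q. q \<in> W \<Longrightarrow> u q \<in> V" "Cinf_on V g" "Cinf_on V g'"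
    and g: "\<And>x. x \<in> V \<Longrightarrow> (g has_real_derivative g' x) (at x)" "(g' has_real_derivative g2) (at (u p))"
  shows "lap (\<lambda>p. g (u p)) p = g' (u p) * lap u p - g2 * gradsq fs \<kappa> u p"
proof -
  have o: "oS (fst \<kappa> \<inter> W)" "p \<in> fst \<kappa> \<inter> W" "p \<in> fst \<kappa> \<inter> (fst \<kappa> \<inter> W)" using \<kappa> W chart_open oS_Int by auto
  have dg: "pd \<kappa> i (\<lambda>p. g (u p)) q = g' (u q) * pd \<kappa> i u q" if "q \<in> fst \<kappa> \<inter> W" for q i
    using that V g by (intro pd_compose[OF \<kappa>(1) _ W(2)]) auto
  have sg: "smooth_in (fst \<kappa> \<inter> W) (\<lambda>q. g' (u q))"
    using V by (intro smooth_in_compose[OF o(1) V(1,4)] smooth_in_subset[OF W(2)]) auto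
  have dg': "pd \<kappa> i (\<lambda>p. g' (u p)) p = g2 * pd \<kappa> i u p" for i
    by (rule pd_compose[OF \<kappa>(1) o(2) W(2) g(2)])
  have st: "pd \<kappa> i (star1 fs \<kappa> (\<lambda>p. g (u p))) p = pd \<kappa> i (\<lambda>q. g' (u q) * star1 fs \<kappa> u q) p"
    "pd \<kappa> i (star2 fs \<kappa> (\<lambda>p. g (u p))) p = pd \<kappa> i (\<lambda>q. g' (u q) * star2 fs \<kappa> u q) p" for i
    by (rule pd_cong[OF \<kappa>(1) o(1,2) \<kappa>(2)]; simp add: star1_def star2_def dg algebra_simps)+
  have sm: "smooth_in W (\<lambda>p. g (u p))" by (rule smooth_in_compose[OF W(1) V(1,3,2) W(2)])
  have r: "rt fs \<kappa> p > 0" by (rule rt_pos[OF \<kappa>])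
  have "lap (\<lambda>p. g (u p)) p = lap_in fs \<kappa> (\<lambda>p. g (u p)) p"
    by (rule lap_eq[OF \<kappa>(1) W(1) sm \<kappa>(2) W(3)])
  also have "\<dots> = ((g2 * pd \<kappa> 1 u p * star2 fs \<kappa> u p + g' (u p) * pd \<kappa> 1 (star2 fs \<kappa> u) p)
      - (g2 * pd \<kappa> 2 u p * star1 fs \<kappa> u p + g' (u p) * pd \<kappa> 2 (star1 fs \<kappa> u) p)) / rt fs \<kappa> p"
    unfolding lap_in_def st
    using pd_mult[OF \<kappa>(1) o(3) sg star_smooth(1)[OF \<kappa>(1) W(1,2)]] pd_mult[OF \<kappa>(1) o(3) sg
    star_smooth(2)[OF \<kappa>(1) W(1,2)]]
    by (simp add: dg')
  also have "\<dots> = g' (u p) * lap_in fs \<kappa> u p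
      + g2 * ((pd \<kappa> 1 u p * star2 fs \<kappa> u p - pd \<kappa> 2 u p * star1 fs \<kappa> u p) / rt fs \<kappa> p)"
    using r by (simp add: lap_in_def field_simps)
  also have "(pd \<kappa> 1 u p * star2 fs \<kappa> u p - pd \<kappa> 2 u p * star1 fs \<kappa> u p) / rt fs \<kappa> p = - gradsq fs \<kappa> u p"
    using r by (simp add: star1_def star2_def gradsq_def field_simps)
  also have "lap_in fs \<kappa> u p = lap u p"
    by (rule lap_eq[OF \<kappa>(1) W(1,2) \<kappa>(2) W(3), symmetric])
  finally show ?thesis by simp
qed

lemma lap_mult_const:
  assumes W: "oS W" "smooth_in W u" "p \<in> W" shows "lap (\<lambda>p. c * u p) p = c * lap u p"
proof -
  obtain \<kappa> where \<kappa>: "\<kappa> \<in> A" "p \<in> fst \<kappa>" using chart_cover oS_sub W by blast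
  have "lap (\<lambda>p. c * u p) p = c * lap u p - 0 * gradsq fs \<kappa> u p"
    by (rule lap_compose[OF W \<kappa> open_UNIV, where g="\<lambda>x. c * x" and g'="\<lambda>x. c"])
      (auto intro!: derivative_eq_intros Cinf_on_const Cinf_on_bounded_linear bounded_linear_mult_right)
  then show ?thesis by simp
qed

lemma lap_sum:
  assumes "oS W" "p \<in> W" "\<And>i. i \<in> I \<Longrightarrow> smooth_in W (u i)"
  shows "lap (\<lambda>p. \<Sum>i\<in>I. u i p) p = (\<Sum>i\<in>I. lap (u i) p)"
  using assms(3)
proof (induction I rule: infinite_finite_induct)
  case (insert i I)
  then show ?case
    using lap_add[OF assms(1) _ smooth_in_sum[OF assms(1)] assms(2), of "u i" I u] by simp
qed (auto simp: lap_const)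

text \<open>For the metric \<open>dt\<^sup>2 + d\<theta>\<^sup>2\<close> the rotated differential of
  \<open>t\<close> is \<open>d\<theta>\<close> up to a locally constant sign, hence closed, and
  \<open>dt\<close> has norm one. So \<open>L t = 0\<close>, and in the chain rule only the second
  derivative of \<open>g\<close> remains.\<close>

lemma lap_flat:
  assumes V: "oS V" "smooth_in V t" "smooth_in V \<theta>" "p \<in> V"
    and std: "\<And>\<kappa> q. \<kappa> \<in> A \<Longrightarrow> q \<in> fst \<kappa> \<inter> V \<Longrightarrow> wedge \<kappa> t \<theta> q \<noteq> 0"
      "\<And>\<kappa> q. \<kappa> \<in> A \<Longrightarrow> q \<in> fst \<kappa> \<inter> V \<Longrightarrow> gE fs \<kappa> q = pd \<kappa> 1 t q * pd \<kappa> 1 t q + pd \<kappa> 1 \<theta> q * pd \<kappa> 1 \<theta> q"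
      "\<And>\<kappa> q. \<kappa> \<in> A \<Longrightarrow> q \<in> fst \<kappa> \<inter> V \<Longrightarrow> gF fs \<kappa> q = pd \<kappa> 1 t q * pd \<kappa> 2 t q + pd \<kappa> 1 \<theta> q * pd \<kappa> 2 \<theta> q"
      "\<And>\<kappa> q. \<kappa> \<in> A \<Longrightarrow> q \<in> fst \<kappa> \<inter> V \<Longrightarrow> gG fs \<kappa> q = pd \<kappa> 2 t q * pd \<kappa> 2 t q + pd \<kappa> 2 \<theta> q * pd \<kappa> 2 \<theta> q"
    and U: "open U" "\<And>q. q \<in> V \<Longrightarrow> t q \<in> U" "Cinf_on U g" "Cinf_on U g'"
    and g: "\<And>x. x \<in> U \<Longrightarrow> (g has_real_derivative g' x) (at x)" "(g' has_real_derivative g2) (at (t p))"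
  shows "lap (\<lambda>q. g (t q)) p = - g2"
proof -
  obtain \<kappa> where \<kappa>: "\<kappa> \<in> A" "p \<in> fst \<kappa>" using chart_cover oS_sub V by blast
  have pV: "p \<in> fst \<kappa> \<inter> V" using \<kappa> V by auto
  define w where "w = wedge \<kappa> t \<theta>"
  define s where "s = sgn (w p)"
  have disc: "gE fs \<kappa> q * gG fs \<kappa> q - gF fs \<kappa> q * gF fs \<kappa> q = (w q)\<^sup>2" if "q \<in> fst \<kappa> \<inter> V" for q
    unfolding std[OF \<kappa>(1) that] w_def wedge_def by (simp add: power2_eq_square algebra_simps)
  have rt: "rt fs \<kappa> q = \<bar>w q\<bar>" if "q \<in> fst \<kappa> \<inter> V" for q
    using disc[OF that] by (simp add: rt_def)
  have w0: "w q \<noteq> 0" if "q \<in> fst \<kappa> \<inter> V" for q using std(1)[OF \<kappa>(1) that] by (simp add: w_def)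
  have st: "star1 fs \<kappa> t q = - sgn (w q) * pd \<kappa> 1 \<theta> q" "star2 fs \<kappa> t q = - sgn (w q) * pd \<kappa> 2 \<theta> q"
    if "q \<in> fst \<kappa> \<inter> V" for q
  proof -
    have "gE fs \<kappa> q * pd \<kappa> 2 t q - gF fs \<kappa> q * pd \<kappa> 1 t q = - w q * pd \<kappa> 1 \<theta> q"
      "gF fs \<kappa> q * pd \<kappa> 2 t q - gG fs \<kappa> q * pd \<kappa> 1 t q = - w q * pd \<kappa> 2 \<theta> q"
      unfolding std[OF \<kappa>(1) that] w_def wedge_def by (simp_all add: algebra_simps)
    then show "star1 fs \<kappa> t q = - sgn (w q) * pd \<kappa> 1 \<theta> q" "star2 fs \<kappa> t q = - sgn (w q) * pd \<kappa> 2 \<theta> q"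
      using w0[OF that] by (simp_all add: star1_def star2_def rt[OF that] sgn_if)
  qed
  obtain N where N: "oS N" "p \<in> N" "N \<subseteq> fst \<kappa> \<inter> V" "\<And>q. q \<in> N \<Longrightarrow> sgn (w q) = s"
    using wedge_sgn_const[OF \<kappa>(1) V(1-3) pV] w0[OF pV] unfolding w_def s_def by blast
  have pN: "p \<in> fst \<kappa> \<inter> N" "p \<in> fst \<kappa> \<inter> (fst \<kappa> \<inter> V)" using N \<kappa> V by auto
  have D: "pd \<kappa> i (\<lambda>q. - s * pd \<kappa> j \<theta> q) p = - s * pd \<kappa> i (pd \<kappa> j \<theta>) p" for i j
    using pd_mult[OF \<kappa>(1) pN(2) smooth_in_const pd_smooth[OF \<kappa>(1) V(1,3)], of i "- s" j]
    by (simp add: pd_const)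
  have D1: "pd \<kappa> 1 (star2 fs \<kappa> t) p = - s * pd \<kappa> 1 (pd \<kappa> 2 \<theta>) p"
    unfolding D[symmetric] by (rule pd_cong[OF \<kappa>(1) N(1,2) \<kappa>(2)]) (use st(2) N in auto)
  have D2: "pd \<kappa> 2 (star1 fs \<kappa> t) p = - s * pd \<kappa> 2 (pd \<kappa> 1 \<theta>) p"
    unfolding D[symmetric] by (rule pd_cong[OF \<kappa>(1) N(1,2) \<kappa>(2)]) (use st(1) N in auto)
  have "lap t p = lap_in fs \<kappa> t p" by (rule lap_eq[OF \<kappa>(1) V(1,2) \<kappa>(2) V(4)])
  also have "\<dots> = 0"
    unfolding lap_in_def D1 D2 using pd_commute[OF \<kappa>(1) V(1,3) pV, of 1 2] by simp
  finally have 1: "lap t p = 0" .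
  have "gG fs \<kappa> p * (pd \<kappa> 1 t p * pd \<kappa> 1 t p) - 2 * gF fs \<kappa> p * (pd \<kappa> 1 t p * pd \<kappa> 2 t p)
     + gE fs \<kappa> p * (pd \<kappa> 2 t p * pd \<kappa> 2 t p) = (w p)\<^sup>2"
    unfolding std[OF \<kappa>(1) pV] w_def wedge_def by (simp add: power2_eq_square algebra_simps)
  then have 2: "gradsq fs \<kappa> t p = 1"
    using w0[OF pV] unfolding gradsq_def rt[OF pV] by (simp add: power2_eq_square)
  show ?thesis
    using lap_compose[OF V(1,2,4) \<kappa> U g] 1 2 by simp
qed

end

section \<open>Sweeping out the sign of the Laplacian\<close>

context surface_atlas
begin

text \<open>The preimage of the closed ball is compact, hence closed in the Hausdorff surface. The
  chart domain and the complement of this preimage form an open cover, and the extension by zero is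
  smooth on each of the two sets.\<close>

lemma smooth_extension:
  assumes \<kappa>: "\<kappa> \<in> A" and K: "cball x r \<subseteq> chart_image \<kappa>" and u: "smooth_in (fst \<kappa>) u"
    and zero: "\<And>p. p \<in> fst \<kappa> \<Longrightarrow> snd \<kappa> p \<notin> cball x r \<Longrightarrow> u p = 0"
  defines "v \<equiv> \<lambda>p. if p \<in> fst \<kappa> then u p else 0" and "Z \<equiv> S - chart_inv \<kappa> ` cball x r"
  shows "smooth_in S v" and "oS Z" and "\<And>p. p \<in> Z \<Longrightarrow> v p = 0" and "S - fst \<kappa> \<subseteq> Z"
proof -
  have "compact (chart_inv \<kappa> ` cball x r)"
    using chart_inv_continuous[OF \<kappa>] K
    by (intro compact_continuous_image) (auto intro: continuous_on_subset)
  then show Z: "oS Z"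
    unfolding Z_def by (simp add: Diff_Int_distrib compact_imp_closed openin_open_Int Diff_eq open_Compl)
  show 0: "v p = 0" if "p \<in> Z" for p
  proof (cases "p \<in> fst \<kappa>")
    case True
    then have "snd \<kappa> p \<notin> cball x r"
      using that chart_inv_chart[OF \<kappa> True] unfolding Z_def by (metis DiffD2 imageI)
    then show ?thesis using zero True by (simp add: v_def)
  qed (simp add: v_def)
  show sub: "S - fst \<kappa> \<subseteq> Z"
    using K chart_inv_in[OF \<kappa>] by (auto simp: Z_def)
  show "smooth_in S v"
  proof (rule smooth_in_local)
    fix p assume p: "p \<in> S"
    show "\<exists>V. oS V \<and> p \<in> V \<and> smooth_in V v"
    proof (cases "p \<in> fst \<kappa>")
      case True
      have "smooth_in (fst \<kappa>) v"
        by (rule smooth_in_cong[OF chart_open[OF \<kappa>], THEN iffD1, OF _ u]) (simp add: v_def)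
      then show ?thesis using True chart_open[OF \<kappa>] by blast
    next
      case False
      have "smooth_in Z v"
        by (rule smooth_in_cong[OF Z, THEN iffD1, OF _ smooth_in_const]) (simp add: 0)
      then show ?thesis using False sub p Z by blast
    qed
  qed
qed

text \<open>The squared distance in coordinates, which unlike the distance is smooth at the
  centre.\<close>

definition rsq :: "'a chart \<Rightarrow> real^2 \<Rightarrow> 'a \<Rightarrow> real" where
  "rsq \<kappa> x p = (crd \<kappa> 1 p - x $ 1) * (crd \<kappa> 1 p - x $ 1) + (crd \<kappa> 2 p - x $ 2) * (crd \<kappa> 2 p - x $ 2)"

lemma rsq_eq: "rsq \<kappa> x p = (dist x (snd \<kappa> p))\<^sup>2"
proof -
  have "(dist x (snd \<kappa> p))\<^sup>2 = (snd \<kappa> p - x) \<bullet> (snd \<kappa> p - x)"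
    by (subst dist_commute) (simp add: dist_norm power2_norm_eq_inner)
  then show ?thesis by (simp add: rsq_def crd_def inner_vec_def sum_2)
qed

lemma rsq_smooth: "\<kappa> \<in> A \<Longrightarrow> smooth_in (fst \<kappa>) (rsq \<kappa> x)"
  unfolding rsq_def[abs_def]
  by (intro smooth_in_add smooth_in_mult smooth_in_diff smooth_in_const crd_smooth chart_open)

lemma pd_rsq:
  assumes "\<kappa> \<in> A" "p \<in> fst \<kappa>" shows "pd \<kappa> i (rsq \<kappa> x) p = 2 * (crd \<kappa> i p - x $ i)"
proof -
  have o: "oS (fst \<kappa>)" and p: "p \<in> fst \<kappa> \<inter> fst \<kappa>" using assms chart_open by auto
  note c = crd_smooth[OF assms(1)]
  have d: "smooth_in (fst \<kappa>) (\<lambda>p. crd \<kappa> k p - x $ k)" for k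
    by (intro smooth_in_diff smooth_in_const c o)
  have pd: "pd \<kappa> i (\<lambda>p. crd \<kappa> k p - x $ k) p = (if i = k then 1 else 0)" for k
    using pd_diff[OF assms(1) p c smooth_in_const, of i k "x $ k"]
    by (simp add: pd_crd[OF assms] pd_const)
  show ?thesis
    unfolding rsq_def[abs_def]
    using pd_add[OF assms(1) p smooth_in_mult[OF o d d] smooth_in_mult[OF o d d], of i 1 1 2 2]
      pd_mult[OF assms(1) p d d, of i 1 1] pd_mult[OF assms(1) p d d, of i 2 2] exhaust_2[of i]
    by (auto simp: pd)
qed

lemma chart_cball:
  assumes "\<kappa> \<in> A" "oS W" "p \<in> fst \<kappa> \<inter> W"
  obtains r where "r > 0" "cball (snd \<kappa> p) r \<subseteq> snd \<kappa> ` (fst \<kappa> \<inter> W)"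
  using open_chart_part[OF assms(1,2)] assms(3) open_contains_cball by (metis imageI)

text \<open>Coordinate functions of a chart are cut off by a bump that is \<open>1\<close> on the
  half-size ball. They supply independent differentials near \<open>p\<close> without disturbing the
  complement of \<open>W\<close>.\<close>

lemma local_coordinate_functions:
  assumes W: "oS W" and p: "p \<in> W"
  obtains V f g where "oS V" "p \<in> V" "V \<subseteq> W" "smooth_in S f" "smooth_in S g"
    "\<And>q. q \<in> S - W \<Longrightarrow> f q = 0 \<and> g q = 0"
    "\<And>\<kappa> q. \<kappa> \<in> A \<Longrightarrow> q \<in> fst \<kappa> \<inter> V \<Longrightarrow> wedge \<kappa> f g q \<noteq> 0"
proof -
  obtain \<mu> where \<mu>: "\<mu> \<in> A" "p \<in> fst \<mu>" using chart_cover p oS_sub[OF W] by blast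
  let ?x = "snd \<mu> p"
  obtain r where r: "r > 0" "cball ?x r \<subseteq> snd \<mu> ` (fst \<mu> \<inter> W)"
    using chart_cball[OF \<mu>(1) W] \<mu> p by blast
  have o: "oS (fst \<mu>)" by (rule chart_open[OF \<mu>(1)])
  define c where "c q = bell (r/2) r (dist ?x (snd \<mu> q))" for q
  have c_eq: "c = (\<lambda>q. step ((r\<^sup>2 - rsq \<mu> ?x q) * inverse (r\<^sup>2 - (r/2)\<^sup>2)))"
    by (rule ext) (simp only: c_def bell_def rsq_eq divide_inverse)
  have c: "smooth_in (fst \<mu>) c"
    unfolding c_eq
    by (intro smooth_in_compose[OF o open_UNIV Cinf_on_step] smooth_in_mult smooth_in_diff
        smooth_in_const rsq_smooth \<mu> o) auto
  have c0: "c q = 0" if "snd \<mu> q \<notin> cball ?x r" for q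
    unfolding c_def using r that by (intro bell_eq_0) auto
  have out: "snd \<mu> q \<notin> cball ?x r" if "q \<in> fst \<mu>" "q \<notin> W" for q
    using that r(2) inj_onD[OF chart_inj[OF \<mu>(1)]] by blast
  define f where "f k = (\<lambda>q. if q \<in> fst \<mu> then c q * crd \<mu> k q else 0)" for k
  define V where "V = fst \<mu> \<inter> snd \<mu> -` ball ?x (r/2)"
  have f_smooth: "smooth_in S (f k)" for k
  proof -
    have "cball ?x r \<subseteq> chart_image \<mu>" using r(2) by blast
    moreover have "smooth_in (fst \<mu>) (\<lambda>q. c q * crd \<mu> k q)"
      by (intro smooth_in_mult o c crd_smooth \<mu>)
    ultimately show ?thesis
      unfolding f_def by (rule smooth_extension(1)[OF \<mu>(1)]) (simp add: c0)
  qed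
  have oV: "oS V" unfolding V_def by (rule oS_chart_vimage[OF \<mu>(1) open_ball])
  have fV: "f k q = crd \<mu> k q" if "q \<in> V" for k q
    using that r by (auto simp: f_def V_def c_def bell_eq_1)
  show thesis
  proof (rule that[of V "f 1" "f 2"])
    show "p \<in> V" using \<mu> r by (simp add: V_def)
    show "V \<subseteq> W"
    proof
      fix q assume "q \<in> V"
      then have "q \<in> fst \<mu>" "snd \<mu> q \<in> cball ?x r" using r by (auto simp: V_def)
      then show "q \<in> W" using out by blast
    qed
    show "f 1 q = 0 \<and> f 2 q = 0" if "q \<in> S - W" for q
      using that out c0 by (auto simp: f_def)
    show "wedge \<kappa> (f 1) (f 2) q \<noteq> 0" if "\<kappa> \<in> A" "q \<in> fst \<kappa> \<inter> V" for \<kappa> q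
    proof -
      have "pd \<kappa> i (f k) q = pd \<kappa> i (crd \<mu> k) q" for i k
        by (rule pd_cong[OF that(1) oV]) (use that fV in auto)
      then have "wedge \<kappa> (f 1) (f 2) q = jac \<kappa> \<mu> q" by (simp add: wedge_def)
      then show ?thesis using jac_nonzero[OF that(1) \<mu>(1)] that(2) by (auto simp: V_def)
    qed
  qed (use oV f_smooth in auto)
qed

end

lemma compact_positive_bound:
  fixes f :: "'a::topological_space \<Rightarrow> real"
  assumes "compact K" "continuous_on K f" "\<And>x. x \<in> K \<Longrightarrow> 0 < f x"
  obtains m where "0 < m" "\<And>x. x \<in> K \<Longrightarrow> m \<le> f x"
proof (cases "K = {}")
  case False
  then obtain x where "x \<in> K" "\<forall>y\<in>K. f x \<le> f y" using continuous_attains_inf assms by blast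
  then show ?thesis using that[of "f x"] assms by blast
qed (use that[of 1] in auto)

lemma compact_abs_bound:
  fixes f :: "'a::topological_space \<Rightarrow> real"
  assumes "compact K" "continuous_on K f"
  obtains B where "0 \<le> B" "\<And>x. x \<in> K \<Longrightarrow> \<bar>f x\<bar> \<le> B"
proof (cases "K = {}")
  case False
  have "continuous_on K (\<lambda>x. \<bar>f x\<bar>)" using assms by (intro continuous_intros)
  then obtain x where "x \<in> K" "\<forall>y\<in>K. \<bar>f y\<bar> \<le> \<bar>f x\<bar>" using continuous_attains_sup False assms by blast
  then show ?thesis using that[of "\<bar>f x\<bar>"] by auto
qed (use that[of 0] in auto)

section \<open>Hopf barriers and the sweeping argument\<close>

context immersed_surface
begin

lemma gradsq_smooth:
  assumes "\<kappa> \<in> A" "smooth_in (fst \<kappa>) u"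
  shows "smooth_in (fst \<kappa>) (gradsq fs \<kappa> u)"
proof -
  have o: "oS (fst \<kappa>)" by (rule chart_open[OF assms(1)])
  have d: "smooth_in (fst \<kappa>) (pd \<kappa> i u)" for i using pd_smooth[OF assms(1) o assms(2)] by simp
  show ?thesis
    unfolding gradsq_def[abs_def]
    by (intro smooth_in_divide smooth_in_add smooth_in_diff smooth_in_mult o d metric_smooth rt_smooth
        smooth_in_const assms(1)) (use rt_pos[OF assms(1)] in force)
qed

text \<open>The barrier is \<open>- exp (- 1 / \<sigma>)\<close> with
  \<open>\<sigma> = (R\<^sup>2 - \<rho>) / \<alpha>\<close>, where \<open>\<rho>\<close> is the
  squared distance. For large \<open>\<alpha>\<close> its second derivative dominates the first,
  which gives the sign of \<open>L\<close> wherever the gradient of \<open>\<rho>\<close> is bounded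
  below. This gradient vanishes at the centre, which is why a disc of radius \<open>e\<close> is
  left out. On the outer circle all derivatives vanish, so the extension by zero is smooth.\<close>

lemma barrier_at:
  assumes \<kappa>: "\<kappa> \<in> A" and e: "0 < e" "e \<le> R" and R: "cball x R \<subseteq> chart_image \<kappa>"
  obtains \<phi> where "smooth_in S \<phi>" "\<And>q. q \<in> S - (fst \<kappa> \<inter> snd \<kappa> -` cball x R) \<Longrightarrow> \<phi> q = 0"
    "\<And>q. q \<in> S - (fst \<kappa> \<inter> snd \<kappa> -` ball x e) \<Longrightarrow> 0 \<le> lap \<phi> q"
    "\<And>q. q \<in> fst \<kappa> \<Longrightarrow> e \<le> dist x (snd \<kappa> q) \<Longrightarrow> dist x (snd \<kappa> q) < R \<Longrightarrow> 0 < lap \<phi> q"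
proof -
  have R0: "R > 0" using e by simp
  have o: "oS (fst \<kappa>)" by (rule chart_open[OF \<kappa>])
  let ?\<rho> = "rsq \<kappa> x"
  note rs = rsq_smooth[OF \<kappa>, of x]
  define K where "K = chart_inv \<kappa> ` (cball x R - ball x e)"
  have Kf: "K \<subseteq> fst \<kappa>" using R chart_inv_in[OF \<kappa>] by (auto simp: K_def)
  have cK: "compact K"
    unfolding K_def using chart_inv_continuous[OF \<kappa>] R
    by (intro compact_continuous_image compact_diff) (auto intro: continuous_on_subset)
  have memK: "q \<in> K" if "q \<in> fst \<kappa>" "e \<le> dist x (snd \<kappa> q)" "dist x (snd \<kappa> q) \<le> R" for q
    using that chart_inv_chart[OF \<kappa> that(1)] unfolding K_def by (intro image_eqI[of _ _ "snd \<kappa> q"]) auto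
  have grad: "0 < gradsq fs \<kappa> ?\<rho> q" if "q \<in> K" for q
  proof -
    have q: "q \<in> fst \<kappa>" using that Kf by blast
    have "snd \<kappa> q \<noteq> x" using that e R chart_chart_inv[OF \<kappa>] by (auto simp: K_def)
    then have "crd \<kappa> 1 q \<noteq> x $ 1 \<or> crd \<kappa> 2 q \<noteq> x $ 2" by (simp add: crd_def vec_eq_iff forall_2)
    then show ?thesis by (intro gradsq_pos[OF \<kappa> q]) (simp add: pd_rsq[OF \<kappa> q])
  qed
  obtain m where m: "0 < m" "\<And>q. q \<in> K \<Longrightarrow> m \<le> gradsq fs \<kappa> ?\<rho> q"
    using compact_positive_bound[OF cK continuous_on_subset[OF smooth_in_continuous[OF o
    gradsq_smooth[OF \<kappa> rs]] Kf] grad] by blast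
  obtain C where C: "0 \<le> C" "\<And>q. q \<in> K \<Longrightarrow> \<bar>lap ?\<rho> q\<bar> \<le> C"
    using compact_abs_bound[OF cK continuous_on_subset[OF smooth_in_continuous[OF o lap_smooth[OF o
    rs]] Kf]] by blast
  \<comment> \<open>Up to a positive factor, \<open>L\<close> of the barrier is
    \<open>\<alpha> \<sigma>\<^sup>2 (L \<rho>) + (1 - 2 \<sigma>) G\<close>, where
    \<open>L \<rho> \<ge> - C\<close>, the gradient term \<open>G\<close> is at least
    \<open>m\<close>, and \<open>\<alpha> \<sigma> \<le> R\<^sup>2\<close>. Multiplied by
    \<open>\<alpha>\<close>, its positivity follows from the third inequality below, which the final
    summand 1 makes strict.\<close>
  define \<alpha> where "\<alpha> = 2 * R\<^sup>2 + C * R\<^sup>2 * R\<^sup>2 / m + 1"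
  have \<alpha>: "\<alpha> > 0" "2 * R\<^sup>2 \<le> \<alpha>" "C * R\<^sup>2 * R\<^sup>2 < m * (\<alpha> - 2 * R\<^sup>2)"
    using m C R0 by (auto simp: \<alpha>_def field_simps intro!: add_nonneg_pos)
  define g where "g \<rho> = - flat 0 ((R\<^sup>2 - \<rho>) / \<alpha>)" for \<rho>
  define g1 where "g1 \<rho> = flat 2 ((R\<^sup>2 - \<rho>) / \<alpha>) / \<alpha>" for \<rho>
  define g2 where "g2 \<rho> = - (flat 4 ((R\<^sup>2 - \<rho>) / \<alpha>) - 2 * flat 3 ((R\<^sup>2 - \<rho>) / \<alpha>)) / (\<alpha> * \<alpha>)" for \<rho>
  have lin: "((\<lambda>\<rho>. (R\<^sup>2 - \<rho>) / \<alpha>) has_real_derivative - 1 / \<alpha>) (at \<rho>)" for \<rho>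
    using \<alpha> by (auto intro!: derivative_eq_intros)
  have dg: "(g has_real_derivative g1 \<rho>) (at \<rho>)" for \<rho>
    using DERIV_minus[OF DERIV_chain2[OF flat_deriv[of 0] lin[of \<rho>]]]
    by (simp add: g_def[abs_def] g1_def numeral_2_eq_2)
  have dg1: "(g1 has_real_derivative g2 \<rho>) (at \<rho>)" for \<rho>
    using DERIV_cdivide[OF DERIV_chain2[OF flat_deriv[of 2] lin[of \<rho>]], of \<alpha>]
    by (simp add: g1_def[abs_def] g2_def divide_inverse eval_nat_numeral algebra_simps)
  have lin_smooth: "Cinf_on UNIV (\<lambda>\<rho>. (R\<^sup>2 - \<rho>) * inverse \<alpha>)"
    by (intro Cinf_on_mult Cinf_on_diff Cinf_on_const Cinf_on_bounded_linear bounded_linear_ident) auto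
  have fl: "Cinf_on UNIV (\<lambda>\<rho>. flat n ((R\<^sup>2 - \<rho>) * inverse \<alpha>))" for n
    by (rule Cinf_on_compose[OF _ _ _ lin_smooth Cinf_on_flat]) auto
  have sg: "Cinf_on UNIV g" and sg1: "Cinf_on UNIV g1"
    unfolding g_def[abs_def] g1_def[abs_def] divide_inverse
    by (auto intro!: Cinf_on_minus Cinf_on_mult fl Cinf_on_const)
  have lapg: "lap (\<lambda>q. g (?\<rho> q)) q = g1 (?\<rho> q) * lap ?\<rho> q - g2 (?\<rho> q) * gradsq fs \<kappa> ?\<rho> q" if "q \<in> fst \<kappa>"
    for q
    by (rule lap_compose[OF o rs that \<kappa> that open_UNIV _ sg sg1 dg dg1]) auto
  have lap0: "lap (\<lambda>q. g (?\<rho> q)) q = 0" if "q \<in> fst \<kappa>" "R \<le> dist x (snd \<kappa> q)" for q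
  proof -
    have "R\<^sup>2 \<le> ?\<rho> q" using that R0 by (simp add: rsq_eq power_mono)
    then have "(R\<^sup>2 - ?\<rho> q) / \<alpha> \<le> 0" using \<alpha> by (intro divide_nonpos_pos) auto
    then show ?thesis using lapg[OF that(1)] by (simp add: g1_def g2_def flat_eq_0)
  qed
  have lap_pos: "0 < lap (\<lambda>q. g (?\<rho> q)) q" if q: "q \<in> fst \<kappa>" "e \<le> dist x (snd \<kappa> q)"
    "dist x (snd \<kappa> q) < R" for q
  proof -
    define \<sigma> where "\<sigma> = (R\<^sup>2 - ?\<rho> q) / \<alpha>"
    have qK: "q \<in> K" using memK q by simp
    have "?\<rho> q < R\<^sup>2" "0 \<le> ?\<rho> q" using q R0 by (auto simp: rsq_eq intro!: power_strict_mono)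
    then have \<sigma>: "\<sigma> > 0" "\<alpha> * \<sigma> \<le> R\<^sup>2" using \<alpha> by (auto simp: \<sigma>_def)
    define L G where "L = lap ?\<rho> q" and "G = gradsq fs \<kappa> ?\<rho> q"
    have LG: "- C \<le> L" "m \<le> G" using C(2)[OF qK] m(2)[OF qK] by (auto simp: L_def G_def)
    have pos: "0 < \<alpha> * \<sigma> * \<sigma> * L + (1 - 2 * \<sigma>) * G"
    proof -
      have a1: "\<alpha> * (\<alpha> * \<sigma> * \<sigma>) \<le> R\<^sup>2 * R\<^sup>2"
        using mult_mono[OF \<sigma>(2) \<sigma>(2)] \<sigma> \<alpha> by (simp add: algebra_simps)
      have "\<alpha> * (\<alpha> * \<sigma> * \<sigma> * L) = (\<alpha> * (\<alpha> * \<sigma> * \<sigma>)) * L" by simp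
      also have "\<dots> \<ge> (\<alpha> * (\<alpha> * \<sigma> * \<sigma>)) * (- C)"
        using LG \<alpha> \<sigma> by (intro mult_left_mono) auto
      finally have 1: "\<alpha> * (\<alpha> * \<sigma> * \<sigma> * L) \<ge> - (C * R\<^sup>2 * R\<^sup>2)"
        using mult_right_mono[OF a1 C(1)] by (simp add: algebra_simps)
      have 2: "\<alpha> - 2 * R\<^sup>2 \<le> \<alpha> * (1 - 2 * \<sigma>)" using \<sigma> by (simp add: algebra_simps)
      have "m * (\<alpha> - 2 * R\<^sup>2) \<le> G * (\<alpha> * (1 - 2 * \<sigma>))"
        using 2 LG m \<alpha>(2) by (intro mult_mono) auto
      then have "0 < \<alpha> * (\<alpha> * \<sigma> * \<sigma> * L) + G * (\<alpha> * (1 - 2 * \<sigma>))" using 1 \<alpha>(3) by linarith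
      also have "\<dots> = \<alpha> * (\<alpha> * \<sigma> * \<sigma> * L + (1 - 2 * \<sigma>) * G)" by (simp add: algebra_simps)
      finally show ?thesis using \<alpha> by (simp add: zero_less_mult_iff)
    qed
    define E where "E = flat 4 \<sigma>"
    \<comment> \<open>The members of the family differ by powers of \<sigma>, so a common positive
      factor \<open>E\<close> can be taken out.\<close>
    have fl: "flat 2 \<sigma> = \<sigma> * \<sigma> * E" "flat 3 \<sigma> = \<sigma> * E"
      using \<sigma> by (simp_all add: E_def flat_def numeral_eq_Suc) (simp_all add: field_simps)
    have "E > 0" using \<sigma> by (simp add: E_def flat_pos_iff)
    have "lap (\<lambda>q. g (?\<rho> q)) q = E / (\<alpha> * \<alpha>) * (\<alpha> * \<sigma> * \<sigma> * L + (1 - 2 * \<sigma>) * G)"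
      unfolding lapg[OF q(1)] g1_def g2_def \<sigma>_def[symmetric] fl L_def[symmetric] G_def[symmetric]
      E_def[symmetric]
      using \<alpha> by (simp add: field_simps)
    then show ?thesis using pos \<open>E > 0\<close> \<alpha> by simp
  qed
  have sm: "smooth_in (fst \<kappa>) (\<lambda>q. g (?\<rho> q))" by (rule smooth_in_compose[OF o open_UNIV sg _ rs]) auto
  have gz: "g (?\<rho> q) = 0" if "snd \<kappa> q \<notin> cball x R" for q
  proof -
    have "R\<^sup>2 \<le> ?\<rho> q" using that R0 by (simp add: rsq_eq power_mono)
    then have "(R\<^sup>2 - ?\<rho> q) / \<alpha> \<le> 0" using \<alpha> by (intro divide_nonpos_pos) auto
    then show ?thesis by (simp add: g_def flat_eq_0)
  qed
  define \<phi> where "\<phi> = (\<lambda>q. if q \<in> fst \<kappa> then g (?\<rho> q) else 0)"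
  note ext = smooth_extension[OF \<kappa> R sm gz, folded \<phi>_def]
  have lap_in: "lap \<phi> q = lap (\<lambda>q. g (?\<rho> q)) q" if "q \<in> fst \<kappa>" for q
    by (rule lap_cong[OF o that]) (simp add: \<phi>_def)
  have lap_out: "lap \<phi> q = 0" if "q \<in> S - fst \<kappa>" for q
  proof -
    have "lap \<phi> q = lap (\<lambda>q. 0) q"
      by (rule lap_cong[OF ext(2)]) (use that ext(3,4) in \<open>auto simp: \<phi>_def\<close>)
    then show ?thesis by (simp add: lap_const)
  qed
  show ?thesis
  proof (rule that[of \<phi>])
    show "smooth_in S \<phi>" by (rule ext(1))
    show "\<phi> q = 0" if "q \<in> S - (fst \<kappa> \<inter> snd \<kappa> -` cball x R)" for q
      using that gz by (auto simp: \<phi>_def)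
    show "0 < lap \<phi> q" if "q \<in> fst \<kappa>" "e \<le> dist x (snd \<kappa> q)" "dist x (snd \<kappa> q) < R" for q
      using lap_pos[OF that] lap_in[OF that(1)] by simp
    show "0 \<le> lap \<phi> q" if "q \<in> S - (fst \<kappa> \<inter> snd \<kappa> -` ball x e)" for q
    proof (cases "q \<in> fst \<kappa>")
      case True
      then have "e \<le> dist x (snd \<kappa> q)" using that by auto
      then show ?thesis using lap_pos[OF True] lap0[OF True] lap_in[OF True]
        by (cases "dist x (snd \<kappa> q) < R") auto
    qed (use that lap_out in auto)
  qed
qed

text \<open>One neighbourhood has to serve all pairs. The disc is therefore centred at
  \<open>q\<close>, its radius \<open>R\<close> reaches every other point of \<open>V\<close>, and
  the radius \<open>e\<close> of the excluded disc is adapted afterwards to \<open>p'\<close> and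
  \<open>O'\<close>.\<close>

lemma barrier:
  assumes W: "oS W" and p: "p \<in> W"
  obtains V where "oS V" "p \<in> V" "V \<subseteq> W"
    "\<And>q p' O'. q \<in> V \<Longrightarrow> p' \<in> V \<Longrightarrow> p' \<noteq> q \<Longrightarrow> oS O' \<Longrightarrow> q \<in> O' \<Longrightarrow>
      \<exists>\<phi>. smooth_in S \<phi> \<and> (\<forall>x\<in>S - W. \<phi> x = 0) \<and> 0 < lap \<phi> p' \<and> (\<forall>x\<in>S - O'. 0 \<le> lap \<phi> x)"
proof -
  obtain \<kappa> where \<kappa>: "\<kappa> \<in> A" "p \<in> fst \<kappa>" using chart_cover p oS_sub[OF W] by blast
  let ?x = "snd \<kappa> p"
  obtain r where r: "r > 0" "cball ?x r \<subseteq> snd \<kappa> ` (fst \<kappa> \<inter> W)"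
    using chart_cball[OF \<kappa>(1) W] \<kappa> p by blast
  \<comment> \<open>The centres lie within \<open>R / 2\<close> of the centre of the chart ball, so
    the discs of radius \<open>R\<close> around them stay in the ball of radius
    \<open>r = 2 R\<close>.\<close>
  define R where "R = r / 2"
  have R: "R > 0" using r by (simp add: R_def)
  define V where "V = fst \<kappa> \<inter> snd \<kappa> -` ball ?x (R/2)"
  have inW: "q \<in> W" if "q \<in> fst \<kappa>" "snd \<kappa> q \<in> cball ?x r" for q
    using that r(2) inj_onD[OF chart_inj[OF \<kappa>(1)]] by blast
  show thesis
  proof (rule that[of V])
    show "oS V" unfolding V_def by (rule oS_chart_vimage[OF \<kappa>(1) open_ball])
    show "p \<in> V" using \<kappa> R by (simp add: V_def)
    show "V \<subseteq> W" using inW R by (auto simp: V_def R_def)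
    fix q p' O' assume q: "q \<in> V" and p': "p' \<in> V" and ne: "p' \<noteq> q" and O': "oS O'" "q \<in> O'"
    let ?y = "snd \<kappa> q"
    have qk: "q \<in> fst \<kappa>" "p' \<in> fst \<kappa>" using q p' by (auto simp: V_def)
    have d: "dist ?x ?y < R/2" "dist ?x (snd \<kappa> p') < R/2" using q p' by (auto simp: V_def)
    then have dR: "dist ?y (snd \<kappa> p') < R" using dist_triangle3[of ?y "snd \<kappa> p'" ?x] by simp
    have "?y \<noteq> snd \<kappa> p'" using ne qk inj_onD[OF chart_inj[OF \<kappa>(1)]] by blast
    then have d0: "0 < dist ?y (snd \<kappa> p')" by simp
    obtain e0 where e0: "e0 > 0" "cball ?y e0 \<subseteq> snd \<kappa> ` (fst \<kappa> \<inter> O')"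
      using chart_cball[OF \<kappa>(1) O'(1)] O' qk by blast
    \<comment> \<open>The excluded open disc has to fit into \<open>O'\<close> and must not contain
      \<open>p'\<close>.\<close>
    define e where "e = min e0 (dist ?y (snd \<kappa> p'))"
    have e: "0 < e" "e \<le> R" using e0 d0 dR by (auto simp: e_def)
    have sub: "cball ?y R \<subseteq> cball ?x r"
    proof
      fix z assume "z \<in> cball ?y R"
      then have "dist ?x z \<le> R / 2 + R" using dist_triangle[of ?x z ?y] d by auto
      then show "z \<in> cball ?x r" using R by (simp add: R_def)
    qed
    then have "cball ?y R \<subseteq> chart_image \<kappa>" using r by blast
    then obtain \<phi> where \<phi>: "smooth_in S \<phi>" "\<And>q. q \<in> S - (fst \<kappa> \<inter> snd \<kappa> -` cball ?y R) \<Longrightarrow> \<phi> q = 0"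
      "\<And>q. q \<in> S - (fst \<kappa> \<inter> snd \<kappa> -` ball ?y e) \<Longrightarrow> 0 \<le> lap \<phi> q"
      "\<And>q. q \<in> fst \<kappa> \<Longrightarrow> e \<le> dist ?y (snd \<kappa> q) \<Longrightarrow> dist ?y (snd \<kappa> q) < R \<Longrightarrow> 0 < lap \<phi> q"
      using barrier_at[OF \<kappa>(1) e] by blast
    have "fst \<kappa> \<inter> snd \<kappa> -` ball ?y e \<subseteq> O'"
    proof
      fix z assume z: "z \<in> fst \<kappa> \<inter> snd \<kappa> -` ball ?y e"
      then have "snd \<kappa> z \<in> snd \<kappa> ` (fst \<kappa> \<inter> O')" using e0(2) by (auto simp: e_def)
      then show "z \<in> O'" using z inj_onD[OF chart_inj[OF \<kappa>(1)]] by blast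
    qed
    moreover have "fst \<kappa> \<inter> snd \<kappa> -` cball ?y R \<subseteq> W" using inW sub by blast
    moreover have "0 < lap \<phi> p'" by (rule \<phi>(4)[OF qk(2) _ dR]) (simp add: e_def)
    ultimately show "\<exists>\<phi>. smooth_in S \<phi> \<and> (\<forall>x\<in>S - W. \<phi> x = 0) \<and> 0 < lap \<phi> p' \<and> (\<forall>x\<in>S - O'. 0 \<le> lap \<phi> x)"
      using \<phi>(1-3) by (intro exI[of _ \<phi>]) blast
  qed
qed

lemma no_isolated_points:
  assumes V: "oS V" "p \<in> V" obtains q where "q \<in> V" "q \<noteq> p"
proof -
  obtain \<kappa> where \<kappa>: "\<kappa> \<in> A" "p \<in> fst \<kappa>" using chart_cover V oS_sub by blast
  have "open (snd \<kappa> ` (fst \<kappa> \<inter> V))" by (rule open_chart_part[OF \<kappa>(1) V(1)])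
  then have "snd \<kappa> ` (fst \<kappa> \<inter> V) \<noteq> {snd \<kappa> p}" using not_open_singleton by metis
  then obtain q where "q \<in> fst \<kappa> \<inter> V" "snd \<kappa> q \<noteq> snd \<kappa> p" using \<kappa> V by blast
  then show ?thesis using that by blast
qed

text \<open>The set of points at which the sign can be arranged, pushing the defect into \<open>N\<close>, is open and
  closed in \<open>W\<close>: a defect near \<open>q\<close> is absorbed by a multiple of a function that is good at \<open>q\<close>.\<close>

lemma sweep:
  assumes S: "compact S" "connected S" and W: "oS W" and N: "oS N" "N \<subseteq> W"
    and out: "oS (S - (W - N))" "S - (W - N) \<noteq> {}"
  obtains w where "smooth_in S w" "\<And>x. x \<in> S - W \<Longrightarrow> w x = 0" "\<And>x. x \<in> W - N \<Longrightarrow> 0 < lap w x"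
proof -
  define ok where "ok w \<longleftrightarrow> smooth_in S w \<and> (\<forall>x\<in>S - W. w x = 0) \<and> (\<forall>x\<in>S - N. 0 \<le> lap w x)" for w
  define Good where "Good = {p \<in> W. \<exists>w. ok w \<and> 0 < lap w p}"
  \<comment> \<open>For a point of \<open>N\<close> the defect of a barrier may stay inside
    \<open>N\<close>, so nothing has to be absorbed.\<close>
  have NG: "N \<subseteq> Good"
  proof
    fix p assume p: "p \<in> N"
    obtain V where V: "oS V" "p \<in> V"
      "V \<subseteq> N" and bar: "\<And>q p' O'. q \<in> V \<Longrightarrow> p' \<in> V \<Longrightarrow> p' \<noteq> q \<Longrightarrow> oS O' \<Longrightarrow> q \<in> O' \<Longrightarrow>
      \<exists>\<phi>. smooth_in S \<phi> \<and> (\<forall>x\<in>S - N. \<phi> x = 0) \<and> 0 < lap \<phi> p' \<and> (\<forall>x\<in>S - O'. 0 \<le> lap \<phi> x)"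
      using barrier[OF N(1) p] by metis
    obtain q where "q \<in> V" "q \<noteq> p" using no_isolated_points[OF V(1,2)] by blast
    then obtain \<phi> where "smooth_in S \<phi>" "\<forall>x\<in>S - N. \<phi> x = 0" "0 < lap \<phi> p" "\<forall>x\<in>S - V. 0 \<le> lap \<phi> x"
      using bar[of q p V] V by blast
    then show "p \<in> Good" using V N p unfolding Good_def ok_def by blast
  qed
  have step: "\<exists>V. oS V \<and> p \<in> V \<and> V \<subseteq> W \<and> (V \<inter> Good = {} \<or> V \<subseteq> Good)" if p: "p \<in> W" for p
  proof -
    obtain V where V: "oS V" "p \<in> V"
      "V \<subseteq> W" and bar: "\<And>q p' O'. q \<in> V \<Longrightarrow> p' \<in> V \<Longrightarrow> p' \<noteq> q \<Longrightarrow> oS O' \<Longrightarrow> q \<in> O' \<Longrightarrow>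
      \<exists>\<phi>. smooth_in S \<phi> \<and> (\<forall>x\<in>S - W. \<phi> x = 0) \<and> 0 < lap \<phi> p' \<and> (\<forall>x\<in>S - O'. 0 \<le> lap \<phi> x)"
      using barrier[OF W p] by metis
    have "p' \<in> Good" if q: "q \<in> V" "q \<in> Good" and p': "p' \<in> V" for q p'
    proof (cases "p' = q \<or> p' \<in> N")
      case False
      obtain w where w: "ok w" "0 < lap w q" using q by (auto simp: Good_def)
      have ws: "smooth_in S w" using w by (simp add: ok_def)
      \<comment> \<open>With this threshold \<open>O'\<close> is a neighbourhood of \<open>q\<close>
        on which \<open>lap w\<close> has a positive lower bound; the barrier is asked to have its
        defect there.\<close>
      define c where "c = lap w q / 2"
      have c: "0 < c" "c < lap w q" using w by (auto simp: c_def)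
      define O' where "O' = {x \<in> S. c < lap w x}"
      have "oS O'" unfolding O'_def by (rule smooth_in_greater[OF oS_S lap_smooth[OF oS_S ws]])
      moreover have "q \<in> O'" using q V(3) oS_sub[OF W] c by (auto simp: O'_def)
      ultimately obtain \<phi> where \<phi>: "smooth_in S \<phi>" "\<forall>x\<in>S - W. \<phi> x = 0" "0 < lap \<phi> p'"
        "\<forall>x\<in>S - O'. 0 \<le> lap \<phi> x"
        using bar[of q p' O'] False q p' by blast
      obtain B where B: "0 \<le> B" "\<And>x. x \<in> S \<Longrightarrow> \<bar>lap \<phi> x\<bar> \<le> B"
        using compact_abs_bound[OF S(1) smooth_in_continuous[OF oS_S lap_smooth[OF oS_S \<phi>(1)]]] by blast
      \<comment> \<open>Large enough that \<open>C * lap w\<close> exceeds the bound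
        \<open>B\<close> of \<open>lap \<phi>\<close> on \<open>O'\<close>.\<close>
      define C where "C = (B + 1) / c"
      have C: "0 < C" using B c by (simp add: C_def)
      define v where "v x = \<phi> x + C * w x" for x
      have Cw: "smooth_in S (\<lambda>x. C * w x)" by (intro smooth_in_mult oS_S smooth_in_const ws)
      have v: "smooth_in S v" unfolding v_def[abs_def] by (intro smooth_in_add oS_S \<phi>(1) Cw)
      have lv: "lap v x = lap \<phi> x + C * lap w x" if "x \<in> S" for x
        unfolding v_def[abs_def] using lap_add[OF oS_S \<phi>(1) Cw that] lap_mult_const[OF oS_S ws that]
        by simp
      have inO: "0 < lap v x" if "x \<in> O'" for x
      proof -
        have "C * c < C * lap w x" using that C by (simp add: O'_def)
        moreover have "C * c = B + 1" using c by (simp add: C_def)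
        ultimately show ?thesis using lv[of x] B(2)[of x] that by (auto simp: O'_def)
      qed
      have offO: "lap \<phi> x \<le> lap v x" if "x \<in> S - N" for x
        using lv[of x] that w(1) C by (simp add: ok_def)
      have "0 \<le> lap v x" if "x \<in> S - N" for x
      proof (cases "x \<in> O'")
        case False
        then have "0 \<le> lap \<phi> x" using \<phi>(4) that by blast
        then show ?thesis using offO[OF that] by linarith
      qed (use inO in \<open>simp add: less_imp_le\<close>)
      moreover have p'S: "p' \<in> S - N" using False p' V(3) oS_sub[OF W] by auto
      then have "0 < lap v p'"
        using offO \<phi>(3) by fastforce
      moreover have "\<forall>x\<in>S - W. v x = 0" using \<phi>(2) w(1) by (simp add: v_def ok_def)
      ultimately show ?thesis using v p' V(3) unfolding Good_def ok_def by blast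
    qed (use q NG in auto)
    then show ?thesis using V by blast
  qed
  have oG: "oS Good"
  proof (rule oS_local)
    fix p assume "p \<in> Good"
    then show "\<exists>V. oS V \<and> p \<in> V \<and> V \<subseteq> Good" using step[of p] by (auto simp: Good_def)
  qed
  have oB: "oS (W - Good)"
  proof (rule oS_local)
    fix p assume "p \<in> W - Good"
    then show "\<exists>V. oS V \<and> p \<in> V \<and> V \<subseteq> W - Good" using step[of p] by blast
  qed
  \<comment> \<open>\<open>W - Good\<close> and its complement are both open, and the complement
    contains the nonempty set \<open>S - (W - N)\<close>; connectedness leaves no bad point.\<close>
  have "W - Good = {}"
  proof (rule ccontr)
    assume ne: "W - Good \<noteq> {}"
    have "oS ((S - (W - N)) \<union> Good)" using out oG by blast
    moreover have "S \<subseteq> (W - Good) \<union> ((S - (W - N)) \<union> Good)" by blast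
    moreover have "(W - Good) \<inter> ((S - (W - N)) \<union> Good) = {}" using NG by blast
    moreover have "(S - (W - N)) \<union> Good \<noteq> {}" using out(2) by simp
    ultimately have "\<exists>E1 E2. oS E1 \<and> oS E2 \<and> S \<subseteq> E1 \<union> E2 \<and> E1 \<inter> E2 = {} \<and> E1 \<noteq> {} \<and> E2 \<noteq> {}"
      by (intro exI[of _ "W - Good"] exI[of _ "(S - (W - N)) \<union> Good"] conjI oB ne)
    then show False by (rule notE[OF S(2)[unfolded connected_openin]])
  qed
  then have good: "\<exists>w. ok w \<and> 0 < lap w p" if "p \<in> W" for p using that by (auto simp: Good_def)
  then obtain w where w: "\<And>p. p \<in> W \<Longrightarrow> ok (w p)" "\<And>p. p \<in> W \<Longrightarrow> 0 < lap (w p) p" by metis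
  have ws: "smooth_in S (w p)" if "p \<in> W" for p using w(1)[OF that] by (simp add: ok_def)
  have WS: "W - N \<subseteq> S" using oS_sub[OF W] by blast
  have "closedin (top_of_set S) (W - N)" unfolding closedin_def using out(1) WS by simp
  then have cK: "compact (W - N)" using S(1) closedin_compact by blast
  \<comment> \<open>Finitely many of these sets cover the compact set \<open>W - N\<close>. In the
    sum of the corresponding functions every \<open>lap\<close> is nonnegative outside
    \<open>N\<close>, and at each point of \<open>W - N\<close> one of them is positive.\<close>
  let ?O = "\<lambda>p. {x \<in> S. 0 < lap (w p) x}"
  have "\<exists>P. finite P \<and> P \<subseteq> W - N \<and> W - N \<subseteq> (\<Union>p\<in>P. ?O p)"
  proof -
    have op: "oS (?O p)" if "p \<in> W" for p
      by (rule smooth_in_greater[OF oS_S lap_smooth[OF oS_S ws[OF that]]])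
    then have "\<forall>p\<in>W - N. \<exists>T. open T \<and> ?O p = S \<inter> T" by (meson DiffD1 openin_open)
    then obtain T where T: "\<And>p. p \<in> W - N \<Longrightarrow> open (T p) \<and> ?O p = S \<inter> T p" by metis
    have "W - N \<subseteq> (\<Union>p\<in>W - N. T p)" using T w(2) WS by blast
    then obtain P where P: "P \<subseteq> W - N" "finite P" "W - N \<subseteq> (\<Union>p\<in>P. T p)"
      using compactE_image[OF cK, of "W - N" T] T by metis
    have "W - N \<subseteq> (\<Union>p\<in>P. ?O p)"
    proof
      fix x assume x: "x \<in> W - N"
      then obtain p where p: "p \<in> P" "x \<in> T p" using P(3) by blast
      then have "x \<in> ?O p" using T P(1) x WS by blast
      then show "x \<in> (\<Union>p\<in>P. ?O p)" using p by blast
    qed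
    then show ?thesis using P by blast
  qed
  then obtain P where P: "finite P" "P \<subseteq> W - N" "W - N \<subseteq> (\<Union>p\<in>P. ?O p)" by blast
  show thesis
  proof (rule that[of "\<lambda>x. \<Sum>p\<in>P. w p x"])
    show "smooth_in S (\<lambda>x. \<Sum>p\<in>P. w p x)" by (rule smooth_in_sum[OF oS_S]) (use ws P in blast)
    show "(\<Sum>p\<in>P. w p x) = 0" if "x \<in> S - W" for x
      by (rule sum.neutral) (use w(1) P that in \<open>unfold ok_def, blast\<close>)
    show "0 < lap (\<lambda>x. \<Sum>p\<in>P. w p x) x" if x: "x \<in> W - N" for x
    proof -
      have xS: "x \<in> S" "x \<in> S - N" using x WS by auto
      obtain p where p: "p \<in> P" "0 < lap (w p) x" using P(3) x by blast
      have "0 < (\<Sum>p\<in>P. lap (w p) x)"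
        by (rule sum_pos2[where f="\<lambda>p. lap (w p) x", OF P(1) p]) (use w(1) P(2) xS in \<open>unfold
        ok_def, blast\<close>)
      moreover have "lap (\<lambda>x. \<Sum>p\<in>P. w p x) x = (\<Sum>p\<in>P. lap (w p) x)"
        by (rule lap_sum[OF oS_S xS(1)]) (use ws P in blast)
      ultimately show ?thesis by simp
    qed
  qed
qed

end

section \<open>The collar coordinate\<close>

lemma cis_inj_near:
  assumes "cis a = cis b" "\<bar>a - b\<bar> < 2 * pi" shows "a = b"
proof -
  have "sin a = sin b" "cos a = cos b" using assms(1) by (metis cis.simps)+
  then obtain n :: int where n: "a = b + 2 * pi * n" using sin_cos_eq_iff by blast
  then have "2 * pi * \<bar>real_of_int n\<bar> < 2 * pi * 1" using assms(2) by (simp add: abs_mult)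
  then have "\<bar>real_of_int n\<bar> < 1" by (subst (asm) mult_less_cancel_left_pos) auto
  then have "n = 0" by linarith
  then show ?thesis using n by simp
qed

lemma sphere_cis: "z \<in> sphere 0 1 \<Longrightarrow> \<exists>\<theta>\<in>{- pi..pi}. z = cis \<theta>"
proof -
  assume z: "z \<in> sphere 0 1"
  then have "cis (Arg z) = z" using cis_Arg[of z] by (cases "z = 0") (auto simp: sgn_eq)
  then show ?thesis using Arg_bounded[of z] by (intro bexI[of _ "Arg z"]) auto
qed

lemma image_Int_vimage_eq: "Y \<subseteq> f ` X \<Longrightarrow> f ` (X \<inter> f -` Y) = Y"
  by blast

locale dividing_collar = surface_atlas S A
  for S :: "'a::t2_space set" and A :: "'a chart set" +
  fixes \<C> :: "'a set set" and \<tau> :: "real \<times> 'a \<Rightarrow> 'a" and S_minus S_plus :: "'a set"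
  assumes finite_circles: "finite \<C>" and disjoint_circles: "pairwise disjnt \<C>"
    and tube: "tubular_neighbourhood S A \<C> \<tau>"
    and regions: "openin (top_of_set S) S_minus" "openin (top_of_set S) S_plus"
    and decomposition: "S = S_minus \<union> \<tau> ` ({-1..1} \<times> \<Union>\<C>) \<union> S_plus"
      "disjnt S_minus (\<tau> ` ({-1..1} \<times> \<Union>\<C>))"
      "disjnt S_plus (\<tau> ` ({-1..1} \<times> \<Union>\<C>))"
      "disjnt S_minus S_plus"
    and boundaries:
      "(top_of_set S) frontier_of ((top_of_set S) closure_of S_minus) = \<tau> ` ({-1} \<times> \<Union>\<C>)"
      "(top_of_set S) frontier_of ((top_of_set S) closure_of S_plus) = \<tau> ` ({1} \<times> \<Union>\<C>)"
begin

definition circ :: "'a set \<Rightarrow> complex \<Rightarrow> 'a" where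
  "circ C = (SOME c. circle_embedding S A c \<and> C = c ` sphere 0 1 \<and>
        smooth_immersion S A ({-1..1} \<times> (UNIV :: real set)) (\<lambda>(t, \<theta>). \<tau> (t, c (cis \<theta>))))"

text \<open>The collar parametrised by a strip, periodic in the angle; this is the form in which
  smoothness of the tube is given.\<close>

definition coll :: "'a set \<Rightarrow> real \<times> real \<Rightarrow> 'a" where
  "coll C = (\<lambda>(t, \<theta>). \<tau> (t, circ C (cis \<theta>)))"

lemma circ:
  assumes "C \<in> \<C>"
  shows "circle_embedding S A (circ C)" "C = circ C ` sphere 0 1"
    "smooth_immersion S A ({-1..1} \<times> (UNIV :: real set)) (coll C)"
proof -
  have "\<exists>c. circle_embedding S A c \<and> C = c ` sphere 0 1 \<and>
        smooth_immersion S A ({-1..1} \<times> (UNIV :: real set)) (\<lambda>(t, \<theta>). \<tau> (t, c (cis \<theta>)))"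
    using tube assms by (simp add: tubular_neighbourhood_def)
  from someI_ex[OF this, folded circ_def]
  show "circle_embedding S A (circ C)" "C = circ C ` sphere 0 1"
    "smooth_immersion S A ({-1..1} \<times> (UNIV :: real set)) (coll C)"
    by (simp_all add: coll_def)
qed

lemma inj_tau: "inj_on \<tau> ({-1..1} \<times> \<Union>\<C>)" and tau_0: "p \<in> \<Union>\<C> \<Longrightarrow> \<tau> (0, p) = p"
  using tube by (auto simp: tubular_neighbourhood_def)

lemma circ_in: "C \<in> \<C> \<Longrightarrow> circ C (cis \<theta>) \<in> C"
  using circ(2)[of C] by auto

abbreviation tubeset :: "'a set" where
  "tubeset \<equiv> \<tau> ` ({-1..1} \<times> \<Union>\<C>)"

text \<open>The collar coordinate extended by its boundary values. Its smoothness is available only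
  in the open collar; elsewhere it enters through functions of \<open>T\<close> that are locally
  constant.\<close>

definition T :: "'a \<Rightarrow> real" where
  "T p = (if p \<in> tubeset then fst (inv_into ({-1..1} \<times> \<Union>\<C>) \<tau> p) else if p \<in> S_plus then 1 else - 1)"

text \<open>The circle coordinate, kept as a unit complex number because the angle is only locally
  defined. Outside the tube its value is arbitrary and is suppressed by a cutoff.\<close>

definition Z :: "'a \<Rightarrow> complex" where
  "Z p = (let x = snd (inv_into ({-1..1} \<times> \<Union>\<C>) \<tau> p)
     in inv_into (sphere 0 1) (circ (THE C. C \<in> \<C> \<and> x \<in> C)) x)"

lemma T_tau: "t \<in> {-1..1} \<Longrightarrow> x \<in> \<Union>\<C> \<Longrightarrow> T (\<tau> (t, x)) = t"
  using inv_into_f_f[OF inj_tau, of "(t, x)"] by (auto simp: T_def)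

lemma T_coll: "C \<in> \<C> \<Longrightarrow> t \<in> {-1..1} \<Longrightarrow> T (coll C (t, \<theta>)) = t"
  using T_tau[of t "circ C (cis \<theta>)"] circ_in[of C \<theta>] by (auto simp: coll_def)

lemma Z_coll:
  assumes C: "C \<in> \<C>" and t: "t \<in> {-1..1}" shows "Z (coll C (t, \<theta>)) = cis \<theta>"
proof -
  let ?x = "circ C (cis \<theta>)"
  have x: "?x \<in> C" by (rule circ_in[OF C])
  have "(THE C. C \<in> \<C> \<and> ?x \<in> C) = C"
    using x C disjoint_circles by (intro the_equality) (auto simp: pairwise_def disjnt_iff)
  moreover have "inv_into ({-1..1} \<times> \<Union>\<C>) \<tau> (\<tau> (t, ?x)) = (t, ?x)"
    using x C t by (intro inv_into_f_f[OF inj_tau]) auto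
  moreover have "inv_into (sphere 0 1) (circ C) ?x = cis \<theta>"
    using circ(1)[OF C] unfolding circle_embedding_def by (intro inv_into_f_f) auto
  ultimately show ?thesis by (simp add: Z_def coll_def)
qed

text \<open>Restricting the angle to a compact interval makes the closed parts of the tube finite
  unions of images of compact rectangles.\<close>

lemma tubeset_coll: "p \<in> \<tau> ` (I \<times> \<Union>\<C>) \<longleftrightarrow> (\<exists>C\<in>\<C>. \<exists>t\<in>I. \<exists>\<theta>\<in>{-pi..pi}. p = coll C (t, \<theta>))"
proof
  assume "p \<in> \<tau> ` (I \<times> \<Union>\<C>)"
  then obtain t x C where *: "p = \<tau> (t, x)" "t \<in> I" "C \<in> \<C>" "x \<in> C" by auto
  then have "x \<in> circ C ` sphere 0 1" using circ(2)[of C] by simp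
  then obtain z where "z \<in> sphere 0 1" "x = circ C z" by blast
  then show "\<exists>C\<in>\<C>. \<exists>t\<in>I. \<exists>\<theta>\<in>{-pi..pi}. p = coll C (t, \<theta>)"
    using * sphere_cis[of z] unfolding coll_def by auto
next
  assume "\<exists>C\<in>\<C>. \<exists>t\<in>I. \<exists>\<theta>\<in>{-pi..pi}. p = coll C (t, \<theta>)"
  then show "p \<in> \<tau> ` (I \<times> \<Union>\<C>)" using circ_in unfolding coll_def by auto
qed

lemma coll_in_S: "C \<in> \<C> \<Longrightarrow> t \<in> {-1..1} \<Longrightarrow> coll C (t, \<theta>) \<in> S"
  and coll_continuous: "C \<in> \<C> \<Longrightarrow> continuous_on ({-1..1} \<times> UNIV) (coll C)"
  using circ(3)[of C] unfolding smooth_immersion_def smooth_into_def by auto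

lemma tube_compact: "-1 \<le> a \<Longrightarrow> b \<le> 1 \<Longrightarrow> compact (\<tau> ` ({a..b} \<times> \<Union>\<C>))"
proof -
  assume ab: "-1 \<le> a" "b \<le> 1"
  have "\<tau> ` ({a..b} \<times> \<Union>\<C>) = (\<Union>C\<in>\<C>. coll C ` ({a..b} \<times> {-pi..pi}))"
    by (rule set_eqI, unfold tubeset_coll) auto
  moreover have "compact (coll C ` ({a..b} \<times> {-pi..pi}))" if "C \<in> \<C>" for C
    using ab
    by (intro compact_continuous_image continuous_on_subset[OF coll_continuous[OF that]]
    compact_Times) auto
  ultimately show ?thesis using finite_circles by (auto intro: compact_UN)
qed

text \<open>In a chart the parametrisation becomes an immersion of a small rectangle into the plane,
  injective because \<open>T\<close> and \<open>Z\<close> recover \<open>t\<close> and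
  \<open>cis \<theta>\<close>. Its smooth inverse has \<open>T\<close> and a branch of the angle as
  components.\<close>

lemma collar_chart:
  assumes C: "C \<in> \<C>" and t0: "t0 \<in> {-1<..<1}"
  obtains V \<theta> where "oS V" "coll C (t0, \<theta>0) \<in> V" "V \<subseteq> \<tau> ` ({-1<..<1} \<times> \<Union>\<C>)"
    "smooth_in V T" "smooth_in V \<theta>" "\<And>q. q \<in> V \<Longrightarrow> Z q = cis (\<theta> q)"
    "\<And>\<kappa> q. \<kappa> \<in> A \<Longrightarrow> q \<in> fst \<kappa> \<inter> V \<Longrightarrow> wedge \<kappa> T \<theta> q \<noteq> 0"
proof -
  let ?D = "{-1..1} \<times> (UNIV :: real set)"
  let ?p = "coll C (t0, \<theta>0)"
  have "?p \<in> S" using coll_in_S C t0 by simp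
  then obtain \<kappa> where \<kappa>: "\<kappa> \<in> A" "?p \<in> fst \<kappa>" using chart_cover by blast
  have "smooth_on (?D \<inter> coll C -` fst \<kappa>) (snd \<kappa> \<circ> coll C)"
    using circ(3)[OF C] \<kappa> unfolding smooth_immersion_def smooth_into_def by blast
  moreover have "(t0, \<theta>0) \<in> ?D \<inter> coll C -` fst \<kappa>" using t0 \<kappa> by auto
  ultimately obtain N g where N0: "open N" "(t0, \<theta>0) \<in> N" "\<forall>k. Ck_on k N g"
    "\<forall>y\<in>N \<inter> (?D \<inter> coll C -` fst \<kappa>). g y = (snd \<kappa> \<circ> coll C) y"
    unfolding smooth_on_def by blast
  have N: "open N" "(t0, \<theta>0) \<in> N" "Cinf_on N g"
    "\<And>y. y \<in> N \<Longrightarrow> y \<in> ?D \<Longrightarrow> coll C y \<in> fst \<kappa> \<Longrightarrow> g y = snd \<kappa> (coll C y)"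
    using N0 by (simp_all add: Cinf_on_def)
  obtain O' where O': "open O'" "fst \<kappa> = S \<inter> O'" using chart_open[OF \<kappa>(1)] openin_open by metis
  define \<iota> where "\<iota> y = (y $ 1, y $ 2)" for y :: "real^2"
  have \<iota>: "bounded_linear \<iota>"
    unfolding \<iota>_def[abs_def] by (intro bounded_linear_Pair bounded_linear_vec_nth)
  \<comment> \<open>The angles lie in a window of length 2, shorter than a full turn, so that
    \<open>cis\<close> is injective on it; \<open>t\<close> stays away from the boundary of the
    strip.\<close>
  define B where "B = {y :: real^2. -1 < y $ 1} \<inter> {y. y $ 1 < 1} \<inter> {y. \<theta>0 - 1 < y $ 2} \<inter> {y. y $ 2 <
    \<theta>0 + 1}"
  have oB: "open B"
    unfolding B_def by (intro open_Int open_Collect_less continuous_intros)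
  have BD: "\<iota> y \<in> {-1<..<1} \<times> UNIV" "\<iota> y \<in> ?D" if "y \<in> B" for y using that by (auto simp: B_def \<iota>_def)
  have cont: "continuous_on B (\<lambda>y. coll C (\<iota> y))"
    by (rule continuous_on_compose2[OF coll_continuous[OF C] linear_continuous_on[OF \<iota>]]) (use BD in
    blast)
  define U where "U = (B \<inter> (\<lambda>y. coll C (\<iota> y)) -` O') \<inter> (B \<inter> \<iota> -` N)"
  have oU: "open U"
    unfolding U_def using oB cont O' N linear_continuous_on[OF \<iota>]
    by (intro open_Int continuous_open_preimage) auto
  define y0 :: "real^2" where "y0 = (\<chi> i. if i = 1 then t0 else \<theta>0)"
  have \<iota>y0: "\<iota> y0 = (t0, \<theta>0)" by (simp add: \<iota>_def y0_def)
  have y0: "y0 \<in> U" using t0 \<kappa> N O' \<iota>y0 by (auto simp: U_def B_def y0_def)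
  have UB: "y \<in> B" if "y \<in> U" for y using that by (simp add: U_def)
  have Uk: "coll C (\<iota> y) \<in> fst \<kappa>" if "y \<in> U" for y
    using that BD[OF UB[OF that]] coll_in_S[OF C] O' by (auto simp: U_def \<iota>_def)
  define F where "F y = snd \<kappa> (coll C (\<iota> y))" for y
  \<comment> \<open>On the closed strip smoothness only provides a local extension \<open>g\<close>;
    over the open rectangle it coincides with the map itself.\<close>
  have Fg: "F y = g (\<iota> y)" if "y \<in> U" for y
    using N(4)[of "\<iota> y"] BD[OF UB[OF that]] Uk[OF that] that by (simp add: F_def U_def)
  have smF: "Cinf_on U F"
  proof -
    have "Cinf_on U (\<lambda>y. g (\<iota> y))"
      by (rule Cinf_on_compose[OF oU N(1) _ Cinf_on_bounded_linear[OF \<iota>] N(3)]) (auto simp: U_def)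
    then show ?thesis by (rule Cinf_on_cong[OF oU, THEN iffD1, rotated]) (simp add: Fg)
  qed
  have injF: "inj_on F U"
  proof (rule inj_onI)
    fix y y' assume y: "y \<in> U" "y' \<in> U" "F y = F y'"
    then have eq: "coll C (\<iota> y) = coll C (\<iota> y')"
      using inj_onD[OF chart_inj[OF \<kappa>(1)]] Uk by (simp add: F_def)
    have yt: "y $ 1 \<in> {-1..1}" "y' $ 1 \<in> {-1..1}" using UB[OF y(1)] UB[OF y(2)] by (auto simp: B_def)
    have "y $ 1 = y' $ 1"
      using arg_cong[OF eq, of T] T_coll[OF C yt(1)] T_coll[OF C yt(2)] by (simp add: \<iota>_def)
    moreover have "cis (y $ 2) = cis (y' $ 2)"
      using arg_cong[OF eq, of Z] Z_coll[OF C yt(1)] Z_coll[OF C yt(2)] by (simp add: \<iota>_def)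
    moreover have "\<bar>y $ 2 - y' $ 2\<bar> < 2 * pi" using UB[OF y(1)] UB[OF y(2)] pi_gt3
      by (auto simp: B_def abs_less_iff)
    ultimately show "y = y'" using cis_inj_near by (simp add: vec_eq_iff forall_2)
  qed
  have immF: "inj (frechet_derivative F (at y))" if "y \<in> U" for y
  proof -
    have "\<iota> y \<in> ?D" "coll C (\<iota> y) \<in> fst \<kappa>" using BD UB Uk that by blast+
    from circ(3)[OF C, unfolded smooth_immersion_def, THEN conjunct2, rule_format, OF \<kappa>(1) this]
    obtain L where L: "((snd \<kappa> \<circ> coll C) has_derivative L) (at (\<iota> y) within ?D)" "inj L"
      by blast
    \<comment> \<open>In the interior the derivative relative to the strip is the full
      derivative.\<close>
    have "\<iota> y \<in> interior ?D"
      using BD(1)[OF UB[OF that]] by (simp add: interior_Times)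
    then have "at (\<iota> y) within ?D = at (\<iota> y)" by (rule at_within_interior)
    with L(1) have "((snd \<kappa> \<circ> coll C) has_derivative L) (at (\<iota> y))" by (simp only:)
    from has_derivative_compose[OF bounded_linear_imp_has_derivative[OF \<iota>] this]
    have "frechet_derivative F (at y) = (\<lambda>v. L (\<iota> v))"
      by (intro frechet_derivative_eqI) (simp add: F_def[abs_def])
    moreover have "inj (\<lambda>v. L (\<iota> v))"
    proof (rule injI)
      fix v w assume "L (\<iota> v) = L (\<iota> w)"
      then have "\<iota> v = \<iota> w" by (rule injD[OF L(2)])
      then show "v = w" by (simp add: \<iota>_def vec_eq_iff forall_2)
    qed
    ultimately show ?thesis by simp
  qed
  let ?G = "inv_into U F"
  have oFU: "open (F ` U)" and smG: "Cinf_on (F ` U) ?G"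
    using smooth_inverse_of_immersion[OF oU injF smF immF] by auto
  define V where "V = fst \<kappa> \<inter> snd \<kappa> -` (F ` U)"
  define \<theta> where "\<theta> q = ?G (snd \<kappa> q) $ 2" for q
  have oV: "oS V" unfolding V_def by (rule oS_chart_vimage[OF \<kappa>(1) oFU])
  have FU: "F ` U \<subseteq> chart_image \<kappa>" using Uk by (auto simp: F_def)
  have snV: "snd \<kappa> ` V = F ` U" unfolding V_def using FU by (rule image_Int_vimage_eq)
  have Vrep: "\<exists>y\<in>U. q = coll C (\<iota> y) \<and> ?G (snd \<kappa> q) = y" if "q \<in> V" for q
  proof -
    from that obtain y where y: "y \<in> U" "snd \<kappa> q = F y" "q \<in> fst \<kappa>" by (auto simp: V_def)
    then have "q = coll C (\<iota> y)" using inj_onD[OF chart_inj[OF \<kappa>(1)]] Uk by (simp add: F_def)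
    moreover have "?G (snd \<kappa> q) = y" using y injF by simp
    ultimately show ?thesis using y by blast
  qed
  have TV: "T q = ?G (snd \<kappa> q) $ 1" and ZV: "Z q = cis (\<theta> q)" and PV: "q \<in> \<tau> ` ({-1<..<1} \<times> \<Union>\<C>)" if
    q: "q \<in> V" for q
  proof -
    obtain y where y: "y \<in> U" "q = coll C (y $ 1, y $ 2)" "?G (snd \<kappa> q) = y"
      using Vrep[OF q] by (auto simp: \<iota>_def)
    have y1: "y $ 1 \<in> {-1..1}" "y $ 1 \<in> {-1<..<1}" using UB[OF y(1)] by (auto simp: B_def)
    show "T q = ?G (snd \<kappa> q) $ 1" using T_coll[OF C y1(1)] y by simp
    show "Z q = cis (\<theta> q)" using Z_coll[OF C y1(1)] y by (simp add: \<theta>_def)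
    have "q = \<tau> (y $ 1, circ C (cis (y $ 2)))" using y(2) by (simp add: coll_def)
    then show "q \<in> \<tau> ` ({-1<..<1} \<times> \<Union>\<C>)" using y1 circ_in[OF C] C by blast
  qed
  have smGk: "Cinf_on (F ` U) (\<lambda>x. ?G x $ k)" for k
    by (rule Cinf_on_bounded_linear_comp[OF bounded_linear_vec_nth oFU smG])
  have TG: "(T \<circ> chart_inv \<kappa>) x = ?G x $ 1" and \<theta>G: "(\<theta> \<circ> chart_inv \<kappa>) x = ?G x $ 2" if "x \<in> F ` U" for x
  proof -
    have x: "x \<in> chart_image \<kappa>" using that FU by blast
    have "chart_inv \<kappa> x \<in> V" using that chart_inv_in[OF \<kappa>(1) x] chart_chart_inv[OF \<kappa>(1) x]
      by (simp add: V_def)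
    then show "(T \<circ> chart_inv \<kappa>) x = ?G x $ 1" using TV chart_chart_inv[OF \<kappa>(1) x] by simp
    show "(\<theta> \<circ> chart_inv \<kappa>) x = ?G x $ 2" using chart_chart_inv[OF \<kappa>(1) x] by (simp add: \<theta>_def)
  qed
  have sm: "smooth_in V f" if "\<And>x. x \<in> F ` U \<Longrightarrow> (f \<circ> chart_inv \<kappa>) x = ?G x $ k" for f k
  proof (rule smooth_in_chartI[OF \<kappa>(1) oV])
    show "V \<subseteq> fst \<kappa>" by (simp add: V_def)
    show "Cinf_on (snd \<kappa> ` V) (f \<circ> chart_inv \<kappa>)"
      unfolding snV by (rule Cinf_on_cong[OF oFU, THEN iffD2, OF _ smGk]) (rule that)
  qed
  have smT: "smooth_in V T" by (rule sm[OF TG])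
  have sm\<theta>: "smooth_in V \<theta>" by (rule sm[OF \<theta>G])
  \<comment> \<open>The derivative of the inverse is injective, since the derivative of
    \<open>F\<close> undoes it. A vanishing wedge would produce kernel vectors as in the inversion
    of the Jacobian matrix.\<close>
  have wedge\<kappa>: "wedge \<kappa> T \<theta> q \<noteq> 0" if q: "q \<in> V" for q
  proof
    assume w0: "wedge \<kappa> T \<theta> q = 0"
    have qk: "q \<in> fst \<kappa> \<inter> V" using q by (auto simp: V_def)
    let ?x = "snd \<kappa> q"
    have x: "?x \<in> F ` U" using q by (simp add: V_def)
    let ?DG = "frechet_derivative ?G (at ?x)"
    have DG: "(?G has_derivative ?DG) (at ?x)"
      using Cinf_on_differentiable[OF smG x] by (simp add: frechet_derivative_works)
    have comp: "?DG v $ k = v $ 1 * pd \<kappa> 1 f q + v $ 2 * pd \<kappa> 2 f q"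
      if f: "smooth_in V f" "\<And>x. x \<in> F ` U \<Longrightarrow> (f \<circ> chart_inv \<kappa>) x = ?G x $ k" for f k v
    proof -
      have "((\<lambda>x. ?G x $ k) has_derivative (\<lambda>v. ?DG v $ k)) (at ?x)"
        using bounded_linear.has_derivative[OF bounded_linear_vec_nth DG] .
      then have "(f \<circ> chart_inv \<kappa> has_derivative (\<lambda>v. ?DG v $ k)) (at ?x)"
        by (rule has_derivative_transform_within_open[OF _ oFU x]) (simp add: f(2)[unfolded o_def])
      from has_derivative_unique[OF this smooth_in_has_derivative[OF \<kappa>(1) f(1) qk]] show ?thesis
        by (rule fun_cong)
    qed
    have DGv: "?DG v $ 1 = v $ 1 * pd \<kappa> 1 T q + v $ 2 * pd \<kappa> 2 T q"
      "?DG v $ 2 = v $ 1 * pd \<kappa> 1 \<theta> q + v $ 2 * pd \<kappa> 2 \<theta> q" for v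
      by (simp_all only: comp[OF smT TG] comp[OF sm\<theta> \<theta>G])
    have Gx: "?G ?x \<in> U" using inv_into_into[OF x] .
    have "(F has_derivative frechet_derivative F (at (?G ?x))) (at (?G ?x))"
      using Cinf_on_differentiable[OF smF Gx] by (simp add: frechet_derivative_works)
    from has_derivative_compose[OF DG this]
    have "((\<lambda>x. F (?G x)) has_derivative (\<lambda>v. frechet_derivative F (at (?G ?x)) (?DG v))) (at ?x)" .
    moreover have "((\<lambda>x. F (?G x)) has_derivative (\<lambda>v. v)) (at ?x)"
      by (rule has_derivative_transform_within_open[OF has_derivative_ident oFU x]) (simp add:
      f_inv_into_f)
    ultimately have idv: "frechet_derivative F (at (?G ?x)) (?DG v) = v" for v
      using has_derivative_unique by metis
    have inj0: "v = 0" if "?DG v = 0" for v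
      using idv[of v] that linear_0[OF linear_frechet_derivative[OF Cinf_on_differentiable[OF smF Gx]]]
      by simp
    have "vector [pd \<kappa> 2 T q, - pd \<kappa> 1 T q] = (0::real^2)"
      by (rule inj0) (use w0 in \<open>simp add: vec_eq_iff forall_2 DGv vector_2 wedge_def algebra_simps\<close>)
    moreover have "vector [pd \<kappa> 2 \<theta> q, - pd \<kappa> 1 \<theta> q] = (0::real^2)"
      by (rule inj0) (use w0 in \<open>simp add: vec_eq_iff forall_2 DGv vector_2 wedge_def algebra_simps\<close>)
    ultimately have "pd \<kappa> 1 T q = 0" "pd \<kappa> 1 \<theta> q = 0" by (auto simp: vec_eq_iff forall_2 vector_2)
    then have "?DG (axis 1 1) = 0" by (simp add: vec_eq_iff forall_2 DGv axis_def)
    then show False using inj0[of "axis 1 1"] by (simp add: axis_eq_0_iff)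
  qed
  show thesis
  proof (rule that[of V \<theta>])
    show "oS V" "smooth_in V T" "smooth_in V \<theta>" by fact+
    show "?p \<in> V" using y0 \<kappa> \<iota>y0 by (auto simp: V_def F_def intro!: image_eqI[of _ _ y0])
    show "V \<subseteq> \<tau> ` ({-1<..<1} \<times> \<Union>\<C>)" using PV by blast
    show "Z q = cis (\<theta> q)" if "q \<in> V" for q by (rule ZV[OF that])
    show "wedge \<mu> T \<theta> q \<noteq> 0" if \<mu>: "\<mu> \<in> A" and q: "q \<in> fst \<mu> \<inter> V" for \<mu> q
    proof -
      have "q \<in> fst \<mu> \<inter> fst \<kappa> \<inter> V" using q by (auto simp: V_def)
      then show ?thesis
        using wedge_chain[OF \<mu> \<kappa>(1) oV smT sm\<theta>, of q] wedge\<kappa>[of q] jac_nonzero[OF \<mu> \<kappa>(1), of q] by simp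
    qed
  qed
qed

section \<open>The open collar and the sets cut out by its coordinate\<close>

abbreviation P :: "'a set" where
  "P \<equiv> \<tau> ` ({-1<..<1} \<times> \<Union>\<C>)"

lemma collar_local:
  assumes "p \<in> P"
  obtains V \<theta> where "oS V" "p \<in> V" "V \<subseteq> P" "smooth_in V T" "smooth_in V \<theta>"
    "\<And>q. q \<in> V \<Longrightarrow> Z q = cis (\<theta> q)"
    "\<And>\<kappa> q. \<kappa> \<in> A \<Longrightarrow> q \<in> fst \<kappa> \<inter> V \<Longrightarrow> wedge \<kappa> T \<theta> q \<noteq> 0"
proof -
  obtain C t \<theta>0 where "C \<in> \<C>" "t \<in> {-1<..<1}" "p = coll C (t, \<theta>0)"
    using assms unfolding tubeset_coll by blast
  then show ?thesis using that collar_chart[of C t \<theta>0] by metis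
qed

lemma collar_open: "oS P"
proof (rule oS_local)
  fix p assume "p \<in> P"
  then show "\<exists>V. oS V \<and> p \<in> V \<and> V \<subseteq> P" by (rule collar_local) blast
qed

lemma T_smooth: "smooth_in P T"
proof (rule smooth_in_local)
  fix p assume "p \<in> P"
  then show "\<exists>V. oS V \<and> p \<in> V \<and> smooth_in V T" by (rule collar_local) blast
qed

lemma tube_sub: "tubeset \<subseteq> S" "P \<subseteq> tubeset"
proof -
  show "tubeset \<subseteq> S" by (subst decomposition(1)) blast
  show "P \<subseteq> tubeset" by (intro image_mono Sigma_mono) auto
qed

lemma S_cases:
  assumes "p \<in> S"
  obtains "p \<in> S_minus" "T p = - 1" | "p \<in> S_plus" "T p = 1"
    | t x where "t \<in> {-1..1}" "x \<in> \<Union>\<C>" "p = \<tau> (t, x)" "T p = t"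
proof -
  have "p \<in> S_minus \<union> tubeset \<union> S_plus" using assms decomposition(1) by simp
  then consider "p \<in> tubeset" | "p \<in> S_minus" "p \<notin> tubeset" | "p \<in> S_plus" "p \<notin> tubeset" by blast
  then show thesis
  proof cases
    case 1
    then obtain t x where "t \<in> {-1..1}" "x \<in> \<Union>\<C>" "p = \<tau> (t, x)" by blast
    then show ?thesis using that(3)[of t x] T_tau[of t x] by simp
  next
    case 2
    then have "p \<notin> S_plus" using decomposition(4) by (auto simp: disjnt_iff)
    then show ?thesis using 2 that(1) by (simp add: T_def)
  next
    case 3
    then show ?thesis using that(2) by (simp add: T_def)
  qed
qed

lemma T_range: "p \<in> S \<Longrightarrow> \<bar>T p\<bar> \<le> 1"
  by (erule S_cases) auto

lemma in_P_iff: "p \<in> S \<Longrightarrow> p \<in> P \<longleftrightarrow> \<bar>T p\<bar> < 1"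
proof
  assume "p \<in> P"
  then obtain t x where "t \<in> {-1<..<1}" "x \<in> \<Union>\<C>" "p = \<tau> (t, x)" by blast
  then show "\<bar>T p\<bar> < 1" using T_tau[of t x] by auto
next
  assume "p \<in> S" "\<bar>T p\<bar> < 1"
  then show "p \<in> P"
  proof (cases rule: S_cases)
    case (3 t x)
    then have "(t, x) \<in> {-1<..<1} \<times> \<Union>\<C>" using \<open>\<bar>T p\<bar> < 1\<close> by auto
    then show ?thesis using 3(3) by blast
  qed auto
qed

lemma circles_sub: "\<Union>\<C> \<subseteq> S"
proof
  fix p assume p: "p \<in> \<Union>\<C>"
  then have "(0 :: real, p) \<in> {-1..1} \<times> \<Union>\<C>" by simp
  then have "\<tau> (0, p) \<in> tubeset" by (rule imageI)
  then show "p \<in> S" using tau_0[OF p] tube_sub(1) by auto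
qed

lemma T_eq_0_iff: "p \<in> S \<Longrightarrow> T p = 0 \<longleftrightarrow> p \<in> \<Union>\<C>"
proof
  assume "p \<in> S" "T p = 0"
  then show "p \<in> \<Union>\<C>" by (cases rule: S_cases) (use tau_0 in auto)
next
  assume "p \<in> \<Union>\<C>"
  then show "T p = 0" using T_tau[of 0 p] tau_0[of p] by simp
qed

text \<open>A point of the closure outside \<open>R\<close> and its end of the tube is off the
  frontier, hence interior to the closure. It cannot lie in \<open>R'\<close> or \<open>P\<close>,
  which are open and miss \<open>R\<close>, so it sits at an end of the tube. But then its
  neighbourhood inside the closure contains points of \<open>P\<close>, a contradiction.\<close>

lemma closure_side:
  assumes R: "oS R'" "disjnt R R'" "disjnt R tubeset" "S = R \<union> tubeset \<union> R'"
    and e: "e \<in> {-1, 1 :: real}"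
    and fr: "(top_of_set S) frontier_of ((top_of_set S) closure_of R) = \<tau> ` ({e} \<times> \<Union>\<C>)"
  shows "(top_of_set S) closure_of R \<subseteq> R \<union> \<tau> ` ({e} \<times> \<Union>\<C>)"
proof
  let ?cl = "(top_of_set S) closure_of R"
  have avoid: "q \<notin> ?cl" if "oS V" "q \<in> V" "V \<inter> R = {}" for q V
    using that unfolding in_closure_of by blast
  have avoidP: "q \<notin> ?cl" if "q \<in> P" for q
  proof -
    have "P \<inter> R = {}" using R(3) tube_sub(2) unfolding disjnt_def by blast
    then show ?thesis by (rule avoid[OF collar_open that])
  qed
  fix p assume p: "p \<in> ?cl"
  show "p \<in> R \<union> \<tau> ` ({e} \<times> \<Union>\<C>)"
  proof (rule ccontr)
    assume not: "p \<notin> R \<union> \<tau> ` ({e} \<times> \<Union>\<C>)"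
    have "p \<notin> R'" using p avoid[OF R(1)] R(2) by (auto simp: disjnt_iff)
    moreover have pS: "p \<in> S" using p by (simp add: in_closure_of)
    ultimately have "p \<in> tubeset" using R(4) not by blast
    then obtain C t \<theta>0 where t: "C \<in> \<C>" "t \<in> {-1..1}" "p = coll C (t, \<theta>0)"
      unfolding tubeset_coll by blast
    have "p \<in> (top_of_set S) interior_of ?cl"
      using p not fr unfolding frontier_of_def by auto
    then obtain O' where O': "oS O'" "p \<in> O'" "O' \<subseteq> ?cl" unfolding interior_of_def by blast
    have inP: "coll C (s, \<theta>0) \<in> P" if "\<bar>s\<bar> < 1" for s
    proof -
      have "(s, circ C (cis \<theta>0)) \<in> {-1<..<1} \<times> \<Union>\<C>" using that circ_in[OF t(1)] t(1) by auto
      then have "\<tau> (s, circ C (cis \<theta>0)) \<in> P" by (rule imageI)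
      then show ?thesis by (simp add: coll_def)
    qed
    have t1: "\<bar>t\<bar> = 1" using t avoidP[OF inP[of t]] p by (cases "\<bar>t\<bar> < 1") auto
    have "continuous_on {-1..1} (\<lambda>s. coll C (s, \<theta>0))"
      by (rule continuous_on_compose2[OF coll_continuous[OF t(1)]]) (auto intro!: continuous_intros)
    moreover have "(\<lambda>s. coll C (s, \<theta>0)) \<in> {-1..1} \<rightarrow> S" using coll_in_S[OF t(1)] by auto
    ultimately have "openin (top_of_set {-1..1}) ({-1..1} \<inter> (\<lambda>s. coll C (s, \<theta>0)) -` O')"
      using O'(1) by (rule continuous_openin_preimage)
    moreover have "t \<in> {-1..1} \<inter> (\<lambda>s. coll C (s, \<theta>0)) -` O'" using t O' by simp
    ultimately obtain d where d: "d > 0" "\<And>s. s \<in> {-1..1} \<Longrightarrow> dist s t < d \<Longrightarrow> coll C (s, \<theta>0) \<in> O'"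
      unfolding openin_euclidean_subtopology_iff by blast
    \<comment> \<open>Scaling \<open>t\<close> by \<open>1 - m\<close> moves from the end of the
      tube into the open collar by less than \<open>d\<close>.\<close>
    define m where "m = min (d / 2) 1"
    have m: "0 < m" "m \<le> 1" "m < d" using d by (auto simp: m_def)
    have s: "\<bar>t * (1 - m)\<bar> < 1" using m t1 by (simp add: abs_mult)
    have "dist (t * (1 - m)) t < d"
      using m t1 by (simp add: dist_real_def right_diff_distrib abs_mult)
    then have "coll C (t * (1 - m), \<theta>0) \<in> O'" using s by (intro d) (auto simp: abs_less_iff)
    then show False using avoidP[OF inP[OF s]] O'(3) by blast
  qed
qed

text \<open>This is continuity of \<open>T\<close>. For \<open>-1 \<le> a < 1\<close> the complement
  of \<open>{T > a}\<close> is the closure of \<open>S_minus\<close> together with a compact part of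
  the tube; for \<open>{T < a}\<close> the sides are exchanged. \<open>closure_side\<close>
  guarantees that taking closures adds no point with another value of \<open>T\<close>.\<close>

lemma T_greater: "oS {p \<in> S. a < T p}" and T_less: "oS {p \<in> S. T p < a}"
proof -
  have opn: "oS (S - (X \<union> Y))" if "closedin (top_of_set S) X" "compact Y" for X Y
  proof -
    have "S - (X \<union> Y) = (S - X) \<inter> (S \<inter> - Y)" by blast
    moreover have "oS (S \<inter> - Y)" using that(2) by (intro openin_open_Int open_Compl compact_imp_closed)
    ultimately show ?thesis using that(1) by (simp add: closedin_def oS_Int)
  qed
  let ?m = "(top_of_set S) closure_of S_minus" and ?p = "(top_of_set S) closure_of S_plus"
  have SmSp: "S_minus \<subseteq> S" "S_plus \<subseteq> S" using regions oS_sub by blast+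
  have sub: "S_minus \<subseteq> ?m" "S_plus \<subseteq> ?p" using SmSp by (simp_all add: closure_of_subset)
  have dec: "S = S_plus \<union> tubeset \<union> S_minus" using decomposition(1) by blast
  have m: "?m \<subseteq> S_minus \<union> \<tau> ` ({-1} \<times> \<Union>\<C>)"
    by (rule closure_side[OF regions(2) decomposition(4,2,1) _ boundaries(1)]) simp
  have p: "?p \<subseteq> S_plus \<union> \<tau> ` ({1} \<times> \<Union>\<C>)"
    by (rule closure_side[OF regions(1) _ decomposition(3) dec _ boundaries(2)])
      (use decomposition(4) in \<open>auto simp: disjnt_sym\<close>)
  have Tm: "T q = -1" if q: "q \<in> ?m" for q
  proof (cases "q \<in> S_minus")
    case True
    then have "q \<notin> tubeset" "q \<notin> S_plus" using decomposition(2,4) by (auto simp: disjnt_iff)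
    then show ?thesis by (simp add: T_def)
  next
    case False
    then obtain x where "x \<in> \<Union>\<C>" "q = \<tau> (-1, x)" using m q by blast
    then show ?thesis using T_tau[of "-1" x] by simp
  qed
  have Tp: "T q = 1" if q: "q \<in> ?p" for q
  proof (cases "q \<in> S_plus")
    case True
    then have "q \<notin> tubeset" using decomposition(3) by (auto simp: disjnt_iff)
    then show ?thesis using True by (simp add: T_def)
  next
    case False
    then obtain x where "x \<in> \<Union>\<C>" "q = \<tau> (1, x)" using p q by blast
    then show ?thesis using T_tau[of 1 x] by simp
  qed
  have Tt: "T q \<in> I" if "q \<in> \<tau> ` (I \<times> \<Union>\<C>)" "I \<subseteq> {-1..1}" for q I
  proof -
    from that(1) obtain t x where "t \<in> I" "x \<in> \<Union>\<C>" "q = \<tau> (t, x)" by blast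
    then show ?thesis using T_tau[of t x] that(2) by auto
  qed
  show "oS {p \<in> S. a < T p}"
  proof -
    consider "a < -1" | "1 \<le> a" | "-1 \<le> a" "a < 1" by linarith
    then show ?thesis
    proof cases
      case 1
      then have "{p \<in> S. a < T p} = S" using T_range by (force simp: abs_le_iff)
      then show ?thesis by (simp only: oS_S)
    next
      case 2
      then have "{p \<in> S. a < T p} = {}" using T_range by (force simp: abs_le_iff)
      then show ?thesis by (simp only: openin_empty)
    next
      case 3
      have "{p \<in> S. a < T p} = S - (?m \<union> \<tau> ` ({-1..a} \<times> \<Union>\<C>))"
      proof (rule set_eqI, rule iffI)
        fix q assume q: "q \<in> {p \<in> S. a < T p}"
        then have "q \<notin> ?m" using Tm[of q] 3 by auto
        moreover have "q \<notin> \<tau> ` ({-1..a} \<times> \<Union>\<C>)" using Tt[of q "{-1..a}"] q 3 by auto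
        ultimately show "q \<in> S - (?m \<union> \<tau> ` ({-1..a} \<times> \<Union>\<C>))" using q by blast
      next
        fix q assume q: "q \<in> S - (?m \<union> \<tau> ` ({-1..a} \<times> \<Union>\<C>))"
        then have "q \<in> S" by blast
        then show "q \<in> {p \<in> S. a < T p}"
        proof (cases rule: S_cases)
          case (3 t x)
          have "\<not> t \<le> a"
          proof
            assume "t \<le> a"
            then have "(t, x) \<in> {-1..a} \<times> \<Union>\<C>" using 3 by auto
            then show False using q 3(3) by blast
          qed
          then show ?thesis using 3 \<open>q \<in> S\<close> by simp
        qed (use q sub 3 in auto)
      qed
      then show ?thesis using opn[OF closedin_closure_of tube_compact[of "-1" a]] 3 by simp
    qed
  qed
  show "oS {p \<in> S. T p < a}"
  proof -
    consider "1 < a" | "a \<le> -1" | "-1 < a" "a \<le> 1" by linarith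
    then show ?thesis
    proof cases
      case 1
      then have "{p \<in> S. T p < a} = S" using T_range by (force simp: abs_le_iff)
      then show ?thesis by (simp only: oS_S)
    next
      case 2
      then have "{p \<in> S. T p < a} = {}" using T_range by (force simp: abs_le_iff)
      then show ?thesis by (simp only: openin_empty)
    next
      case 3
      have "{p \<in> S. T p < a} = S - (?p \<union> \<tau> ` ({a..1} \<times> \<Union>\<C>))"
      proof (rule set_eqI, rule iffI)
        fix q assume q: "q \<in> {p \<in> S. T p < a}"
        then have "q \<notin> ?p" using Tp[of q] 3 by auto
        moreover have "q \<notin> \<tau> ` ({a..1} \<times> \<Union>\<C>)" using Tt[of q "{a..1}"] q 3 by auto
        ultimately show "q \<in> S - (?p \<union> \<tau> ` ({a..1} \<times> \<Union>\<C>))" using q by blast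
      next
        fix q assume q: "q \<in> S - (?p \<union> \<tau> ` ({a..1} \<times> \<Union>\<C>))"
        then have "q \<in> S" by blast
        then show "q \<in> {p \<in> S. T p < a}"
        proof (cases rule: S_cases)
          case (3 t x)
          have "\<not> a \<le> t"
          proof
            assume "a \<le> t"
            then have "(t, x) \<in> {a..1} \<times> \<Union>\<C>" using 3 by auto
            then show False using q 3(3) by blast
          qed
          then show ?thesis using 3 \<open>q \<in> S\<close> by simp
        qed (use q sub 3 in auto)
      qed
      then show ?thesis using opn[OF closedin_closure_of tube_compact[of a 1]] 3 by simp
    qed
  qed
qed

end

section \<open>Construction of the function and the metric\<close>

lemma sum_list_zero: "(\<And>x. x \<in> set xs \<Longrightarrow> h x = 0) \<Longrightarrow> (\<Sum>x\<leftarrow>xs. h x) = (0::real)"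
  by (induction xs) auto

context dividing_collar
begin

lemma T_abs_greater: "oS {p \<in> S. a < \<bar>T p\<bar>}" and T_abs_less: "oS {p \<in> S. \<bar>T p\<bar> < a}"
proof -
  have "{p \<in> S. a < \<bar>T p\<bar>} = {p \<in> S. a < T p} \<union> {p \<in> S. T p < - a}" by auto
  then show "oS {p \<in> S. a < \<bar>T p\<bar>}" using T_greater T_less by auto
  have "{p \<in> S. \<bar>T p\<bar> < a} = {p \<in> S. - a < T p} \<inter> {p \<in> S. T p < a}" by auto
  then show "oS {p \<in> S. \<bar>T p\<bar> < a}" using T_greater T_less by auto
qed

text \<open>Near \<open>|T| = 1\<close>, where nothing is known about smoothness of
  \<open>T\<close>, the function vanishes identically.\<close>

lemma collar_extension:
  assumes b: "b < 1" and sm: "smooth_in P f" and zero: "\<And>p. p \<in> S \<Longrightarrow> b \<le> \<bar>T p\<bar> \<Longrightarrow> f p = 0"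
  shows "smooth_in S f"
proof (rule smooth_in_local)
  fix p assume p: "p \<in> S"
  show "\<exists>V. oS V \<and> p \<in> V \<and> smooth_in V f"
  proof (cases "\<bar>T p\<bar> < 1")
    case True
    then show ?thesis using sm collar_open in_P_iff[OF p] by blast
  next
    case False
    have "smooth_in {p \<in> S. b < \<bar>T p\<bar>} f"
      by (rule smooth_in_cong[OF T_abs_greater, THEN iffD2, OF _ smooth_in_const[of _ 0]]) (use zero
      in auto)
    then show ?thesis using False b p T_abs_greater[of b] by (intro exI[of _ "{p \<in> S. b < \<bar>T p\<bar>}"]) auto
  qed
qed

text \<open>The plateau ends well beyond \<open>5/8\<close>, which leaves room for further
  components of the immersion to start before it ends. The support stays inside the open collar,
  where \<open>T\<close> is smooth.\<close>

abbreviation cut :: "'a \<Rightarrow> real" where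
  "cut p \<equiv> bell (7/8) (15/16) (T p)"

text \<open>The cylinder \<open>(t, cos \<theta>, sin \<theta>)\<close> in three-space, whose
  induced metric is flat, cut off so that it extends by zero to the whole surface.\<close>

definition collar_funs :: "('a \<Rightarrow> real) list" where
  "collar_funs = [\<lambda>p. cut p * T p, \<lambda>p. cut p * Re (Z p), \<lambda>p. cut p * Im (Z p)]"

text \<open>Below \<open>7/8\<close> the cutoff is \<open>1\<close> and drops out of the
  differentials.\<close>

lemma collar_local':
  assumes "p \<in> S" "\<bar>T p\<bar> < 7/8"
  obtains V \<theta> where "oS V" "p \<in> V" "V \<subseteq> {p \<in> S. \<bar>T p\<bar> < 7/8}" "smooth_in V T" "smooth_in V \<theta>"
    "\<And>\<kappa> q. \<kappa> \<in> A \<Longrightarrow> q \<in> fst \<kappa> \<inter> V \<Longrightarrow> wedge \<kappa> T \<theta> q \<noteq> 0"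
    "\<And>\<kappa> q i. \<kappa> \<in> A \<Longrightarrow> q \<in> fst \<kappa> \<inter> V \<Longrightarrow> map (\<lambda>f. pd \<kappa> i f q) collar_funs
      = [pd \<kappa> i T q, - sin (\<theta> q) * pd \<kappa> i \<theta> q, cos (\<theta> q) * pd \<kappa> i \<theta> q]"
proof -
  have "p \<in> P" using in_P_iff assms by simp
  then obtain V \<theta> where V: "oS V" "p \<in> V" "V \<subseteq> P" "smooth_in V T" "smooth_in V \<theta>"
    "\<And>q. q \<in> V \<Longrightarrow> Z q = cis (\<theta> q)"
    "\<And>\<kappa> q. \<kappa> \<in> A \<Longrightarrow> q \<in> fst \<kappa> \<inter> V \<Longrightarrow> wedge \<kappa> T \<theta> q \<noteq> 0"
    by (rule collar_local) blast
  define V' where "V' = V \<inter> {p \<in> S. \<bar>T p\<bar> < 7/8}"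
  have oV': "oS V'" unfolding V'_def by (rule oS_Int[OF V(1) T_abs_less])
  show thesis
  proof (rule that[of V' \<theta>])
    show "oS V'" by fact
    show "p \<in> V'" using V assms by (simp add: V'_def)
    show "V' \<subseteq> {p \<in> S. \<bar>T p\<bar> < 7/8}" by (auto simp: V'_def)
    show "smooth_in V' T" "smooth_in V' \<theta>" using V smooth_in_subset by (auto simp: V'_def)
    show "wedge \<kappa> T \<theta> q \<noteq> 0" if "\<kappa> \<in> A" "q \<in> fst \<kappa> \<inter> V'" for \<kappa> q
      using V(7) that by (simp add: V'_def)
    show "map (\<lambda>f. pd \<kappa> i f q) collar_funs
      = [pd \<kappa> i T q, - sin (\<theta> q) * pd \<kappa> i \<theta> q, cos (\<theta> q) * pd \<kappa> i \<theta> q]"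
      if \<kappa>: "\<kappa> \<in> A" and q: "q \<in> fst \<kappa> \<inter> V'" for \<kappa> q i
    proof -
      have cut1: "cut x = 1" if "x \<in> V'" for x using that by (simp add: V'_def bell_eq_1)
      have Zx: "Re (Z x) = cos (\<theta> x)" "Im (Z x) = sin (\<theta> x)" if "x \<in> V'" for x
        using that V(6) by (simp_all add: V'_def)
      have qV: "q \<in> V'" "q \<in> fst \<kappa>" "q \<in> fst \<kappa> \<inter> V" using q by (auto simp: V'_def)
      have "pd \<kappa> i (\<lambda>p. cut p * T p) q = pd \<kappa> i T q"
        by (rule pd_cong[OF \<kappa> oV' qV(1,2)]) (simp add: cut1)
      moreover have "pd \<kappa> i (\<lambda>p. cut p * Re (Z p)) q = pd \<kappa> i (\<lambda>p. cos (\<theta> p)) q"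
        by (rule pd_cong[OF \<kappa> oV' qV(1,2)]) (simp add: cut1 Zx)
      moreover have "pd \<kappa> i (\<lambda>p. cut p * Im (Z p)) q = pd \<kappa> i (\<lambda>p. sin (\<theta> p)) q"
        by (rule pd_cong[OF \<kappa> oV' qV(1,2)]) (simp add: cut1 Zx)
      moreover have "pd \<kappa> i (\<lambda>p. cos (\<theta> p)) q = - sin (\<theta> q) * pd \<kappa> i \<theta> q"
        by (rule pd_compose[OF \<kappa> qV(3) V(5) DERIV_cos])
      moreover have "pd \<kappa> i (\<lambda>p. sin (\<theta> p)) q = cos (\<theta> q) * pd \<kappa> i \<theta> q"
        by (rule pd_compose[OF \<kappa> qV(3) V(5) DERIV_sin])
      ultimately show ?thesis by (simp add: collar_funs_def)
    qed
  qed
qed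

lemma collar_funs_smooth: "f \<in> set collar_funs \<Longrightarrow> smooth_in S f"
proof -
  have cutP: "smooth_in P cut"
    by (rule smooth_in_compose[OF collar_open open_UNIV Cinf_on_bell _ T_smooth]) simp
  have Re: "smooth_in P (\<lambda>p. Re (Z p))" and Im: "smooth_in P (\<lambda>p. Im (Z p))"
  proof -
    have *: "\<exists>V. oS V \<and> p \<in> V \<and> smooth_in V (\<lambda>p. Re (Z p)) \<and> smooth_in V (\<lambda>p. Im (Z p))" if p: "p \<in> P"
      for p
    proof -
      obtain V \<theta> where V: "oS V" "p \<in> V" "smooth_in V \<theta>" "\<And>q. q \<in> V \<Longrightarrow> Z q = cis (\<theta> q)"
        by (rule collar_local[OF p]) blast
      have "smooth_in V (\<lambda>p. Re (Z p))"
        by (rule smooth_in_cong[OF V(1), THEN iffD2, OF _ smooth_in_compose[OF V(1) open_UNIV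
        Cinf_on_sin_cos(2) _ V(3)]])
          (simp_all add: V(4))
      moreover have "smooth_in V (\<lambda>p. Im (Z p))"
        by (rule smooth_in_cong[OF V(1), THEN iffD2, OF _ smooth_in_compose[OF V(1) open_UNIV
        Cinf_on_sin_cos(1) _ V(3)]])
          (simp_all add: V(4))
      ultimately show ?thesis using V by blast
    qed
    show "smooth_in P (\<lambda>p. Re (Z p))" by (rule smooth_in_local) (use * in blast)
    show "smooth_in P (\<lambda>p. Im (Z p))" by (rule smooth_in_local) (use * in blast)
  qed
  have ext: "smooth_in S (\<lambda>p. cut p * g p)" if "smooth_in P g" for g
    by (rule collar_extension[of "15/16"]) (auto intro!: smooth_in_mult collar_open cutP that simp:
    bell_eq_0)
  assume "f \<in> set collar_funs"
  then show ?thesis using ext[OF T_smooth] ext[OF Re] ext[OF Im] by (auto simp: collar_funs_def)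
qed

text \<open>One of \<open>sin \<theta>\<close> and \<open>cos \<theta>\<close> is nonzero, so
  \<open>t\<close> and one of the two circle components have independent differentials.\<close>

lemma collar_funs_immersion:
  assumes \<kappa>: "\<kappa> \<in> A" "p \<in> fst \<kappa>" "\<bar>T p\<bar> < 7/8"
  shows "\<exists>f\<in>set collar_funs. \<exists>g\<in>set collar_funs. wedge \<kappa> f g p \<noteq> 0"
proof -
  have "p \<in> S" using \<kappa> chart_open oS_sub by blast
  then obtain V \<theta> where V: "p \<in> V"
    "\<And>\<kappa> q. \<kappa> \<in> A \<Longrightarrow> q \<in> fst \<kappa> \<inter> V \<Longrightarrow> wedge \<kappa> T \<theta> q \<noteq> 0"
    "\<And>\<kappa> q i. \<kappa> \<in> A \<Longrightarrow> q \<in> fst \<kappa> \<inter> V \<Longrightarrow> map (\<lambda>f. pd \<kappa> i f q) collar_funs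
      = [pd \<kappa> i T q, - sin (\<theta> q) * pd \<kappa> i \<theta> q, cos (\<theta> q) * pd \<kappa> i \<theta> q]"
    using \<kappa>(3) by (rule collar_local') blast
  obtain f1 f2 f3 where fs: "collar_funs = [f1, f2, f3]" by (simp add: collar_funs_def)
  have pV: "p \<in> fst \<kappa> \<inter> V" using V \<kappa> by blast
  have w: "wedge \<kappa> f1 f2 p = - sin (\<theta> p) * wedge \<kappa> T \<theta> p" "wedge \<kappa> f1 f3 p = cos (\<theta> p) * wedge \<kappa> T \<theta> p"
    using V(3)[OF \<kappa>(1) pV] by (simp_all add: fs wedge_def algebra_simps)
  have "sin (\<theta> p) \<noteq> 0 \<or> cos (\<theta> p) \<noteq> 0" using sin_zero_abs_cos_one[of "\<theta> p"] by auto
  then have "wedge \<kappa> f1 f2 p \<noteq> 0 \<or> wedge \<kappa> f1 f3 p \<noteq> 0" using w V(2)[OF \<kappa>(1) pV] by auto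
  then show ?thesis by (auto simp: fs)
qed

text \<open>On the compact set \<open>|T| \<ge> 7/8\<close>, where the cutoff may differ from
  \<open>1\<close>, finitely many pairs of cut-off coordinates supply the missing independent
  differentials. They vanish for \<open>|T| \<le> 5/8\<close>, so the flat metric survives below
  that level.\<close>

lemma metric_exists:
  assumes S: "compact S"
  obtains fs where "immersed_surface S A (collar_funs @ fs)"
    "\<And>f p. f \<in> set fs \<Longrightarrow> p \<in> S \<Longrightarrow> \<bar>T p\<bar> \<le> 5/8 \<Longrightarrow> f p = 0"
proof -
  let ?W = "{p \<in> S. 5/8 < \<bar>T p\<bar>}" and ?K = "{p \<in> S. 7/8 \<le> \<bar>T p\<bar>}"
  define good where "good p V f g \<longleftrightarrow> oS V \<and> p \<in> V \<and> smooth_in S f \<and> smooth_in S g \<and>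
      (\<forall>q\<in>S - ?W. f q = 0 \<and> g q = 0) \<and> (\<forall>\<kappa>\<in>A. \<forall>q\<in>fst \<kappa> \<inter> V. wedge \<kappa> f g q \<noteq> 0)" for p V f g
  have ex: "\<forall>p\<in>?K. \<exists>V f g. good p V f g"
  proof
    fix p assume "p \<in> ?K"
    then have "p \<in> ?W" by auto
    then obtain V f g where "oS V" "p \<in> V" "V \<subseteq> ?W" "smooth_in S f" "smooth_in S g"
      "\<And>q. q \<in> S - ?W \<Longrightarrow> f q = 0 \<and> g q = 0"
      "\<And>\<kappa> q. \<kappa> \<in> A \<Longrightarrow> q \<in> fst \<kappa> \<inter> V \<Longrightarrow> wedge \<kappa> f g q \<noteq> 0"
      by (rule local_coordinate_functions[OF T_abs_greater]) blast
    then have "good p V f g" unfolding good_def by blast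
    then show "\<exists>V f g. good p V f g" by blast
  qed
  from bchoice[OF ex] obtain V where "\<forall>p\<in>?K. \<exists>f g. good p (V p) f g" by (elim exE)
  from bchoice[OF this] obtain f where "\<forall>p\<in>?K. \<exists>g. good p (V p) (f p) g" by (elim exE)
  from bchoice[OF this] obtain g where good: "\<forall>p\<in>?K. good p (V p) (f p) (g p)" by (elim exE)
  note good' = bspec[OF good, unfolded good_def]
  have V: "oS (V p)" "p \<in> V p" and fg: "smooth_in S (f p)" "smooth_in S (g p)" if "p \<in> ?K" for p
    using good'[OF that] by (simp_all only: simp_thms)
  have fg0: "f p q = 0 \<and> g p q = 0" if "p \<in> ?K" "q \<in> S - ?W" for p q
    using good'[OF that(1)] that(2) by (elim conjE) (erule bspec)
  have fgw: "wedge \<kappa> (f p) (g p) q \<noteq> 0" if "p \<in> ?K" "\<kappa> \<in> A" "q \<in> fst \<kappa> \<inter> V p" for p \<kappa> q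
    using good'[OF that(1)] that(2,3) by (elim conjE) (drule (1) bspec, erule (1) bspec)
  have KS: "?K \<subseteq> S" by auto
  have "S - ?K = {p \<in> S. \<bar>T p\<bar> < 7/8}" by auto
  then have "closedin (top_of_set S) ?K" using T_abs_less[of "7/8"] KS by (simp add: closedin_def)
  then have cK: "compact ?K" using S closedin_compact by blast
  have "\<forall>p\<in>?K. \<exists>U. open U \<and> V p = S \<inter> U"
  proof
    fix p assume "p \<in> ?K"
    from V(1)[OF this] show "\<exists>U. open U \<and> V p = S \<inter> U" by (simp only: openin_open)
  qed
  from bchoice[OF this] obtain U where "\<forall>p\<in>?K. open (U p) \<and> V p = S \<inter> U p" by (elim exE)
  then have U: "open (U p)" "V p = S \<inter> U p" if "p \<in> ?K" for p using that by simp_all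
  have cover: "?K \<subseteq> (\<Union>p\<in>?K. U p)"
  proof
    fix p assume p: "p \<in> ?K"
    then have "p \<in> U p" using V(2)[OF p] U(2)[OF p] by (simp only: Int_iff)
    then show "p \<in> (\<Union>p\<in>?K. U p)" using p by (rule UN_I[rotated])
  qed
  obtain Q where Q: "Q \<subseteq> ?K" "finite Q" "?K \<subseteq> (\<Union>p\<in>Q. U p)"
    by (rule compactE_image[OF cK U(1) cover])
  obtain l where l: "set l = Q" using finite_list[OF Q(2)] by blast
  define fs where "fs = map f l @ map g l"
  have fs: "set fs = f ` Q \<union> g ` Q" by (simp add: fs_def l)
  show thesis
  proof (rule that[of fs])
    show "h p = 0" if h: "h \<in> set fs" and p: "p \<in> S" "\<bar>T p\<bar> \<le> 5/8" for h p
    proof -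
      have "p \<in> S - ?W" using p by auto
      moreover obtain q where "q \<in> Q" "h = f q \<or> h = g q" using h unfolding fs by blast
      ultimately show ?thesis using fg0[of q p] Q(1) by auto
    qed
    show "immersed_surface S A (collar_funs @ fs)"
    proof unfold_locales
      show "smooth_in S h" if "h \<in> set (collar_funs @ fs)" for h
      proof -
        from that consider "h \<in> set collar_funs" | q where "q \<in> Q" "h = f q" | q where "q \<in> Q" "h = g q"
          using fs by auto
        then show ?thesis
        proof cases
          case (2 q)
          then show ?thesis using fg(1) Q(1) by (simp add: subset_iff)
        next
          case (3 q)
          then show ?thesis using fg(2) Q(1) by (simp add: subset_iff)
        qed (rule collar_funs_smooth)
      qed
      fix \<kappa> p assume \<kappa>: "\<kappa> \<in> A" "p \<in> fst \<kappa>"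
      have pS: "p \<in> S" using \<kappa> chart_open oS_sub by blast
      show "\<exists>h\<in>set (collar_funs @ fs). \<exists>k\<in>set (collar_funs @ fs). wedge \<kappa> h k p \<noteq> 0"
      proof (cases "\<bar>T p\<bar> < 7/8")
        case True
        then show ?thesis using collar_funs_immersion[OF \<kappa>] by auto
      next
        case False
        then have "p \<in> ?K" using pS by simp
        then obtain q where q: "q \<in> Q" "p \<in> U q" using Q(3) by blast
        then have qK: "q \<in> ?K" using Q(1) by blast
        have "p \<in> fst \<kappa> \<inter> V q" using U(2)[OF qK] q \<kappa> pS by (simp only: Int_iff)
        then have "wedge \<kappa> (f q) (g q) p \<noteq> 0" by (rule fgw[OF qK \<kappa>(1)])
        moreover have "f q \<in> set (collar_funs @ fs)" "g q \<in> set (collar_funs @ fs)"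
          using q(1) by (simp_all add: fs)
        ultimately show ?thesis by blast
      qed
    qed
  qed
qed

text \<open>Below \<open>5/8\<close> only the cylinder components have nonzero differentials, and
  \<open>sin\<^sup>2 + cos\<^sup>2 = 1\<close> reduces their metric to the flat one, so
  \<open>lap_flat\<close> applies.\<close>

lemma collar_lap:
  assumes fs: "immersed_surface S A (collar_funs @ fs)"
    "\<And>f p. f \<in> set fs \<Longrightarrow> p \<in> S \<Longrightarrow> \<bar>T p\<bar> \<le> 5/8 \<Longrightarrow> f p = 0"
    and p: "p \<in> S" "\<bar>T p\<bar> < 5/8"
    and U: "open U" "{-1<..<1} \<subseteq> U" "Cinf_on U g" "Cinf_on U g'"
    and g: "\<And>x. x \<in> U \<Longrightarrow> (g has_real_derivative g' x) (at x)" "(g' has_real_derivative g2) (at (T p))"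
  shows "immersed_surface.lap A (collar_funs @ fs) (\<lambda>q. g (T q)) p = - g2"
proof -
  interpret I: immersed_surface S A "collar_funs @ fs" by (rule fs(1))
  have "\<bar>T p\<bar> < 7/8" using p by simp
  with p(1) obtain V \<theta> where V: "oS V" "p \<in> V" "V \<subseteq> {p \<in> S. \<bar>T p\<bar> < 7/8}" "smooth_in V T" "smooth_in V \<theta>"
    "\<And>\<kappa> q. \<kappa> \<in> A \<Longrightarrow> q \<in> fst \<kappa> \<inter> V \<Longrightarrow> wedge \<kappa> T \<theta> q \<noteq> 0"
    "\<And>\<kappa> q i. \<kappa> \<in> A \<Longrightarrow> q \<in> fst \<kappa> \<inter> V \<Longrightarrow> map (\<lambda>f. pd \<kappa> i f q) collar_funs
      = [pd \<kappa> i T q, - sin (\<theta> q) * pd \<kappa> i \<theta> q, cos (\<theta> q) * pd \<kappa> i \<theta> q]"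
    by (rule collar_local') blast
  let ?N = "{p \<in> S. \<bar>T p\<bar> < 5/8}"
  define V' where "V' = V \<inter> ?N"
  have oV': "oS V'" unfolding V'_def by (rule oS_Int[OF V(1) T_abs_less])
  have pV': "p \<in> V'" using V p by (simp add: V'_def)
  have sm: "smooth_in V' T" "smooth_in V' \<theta>" using V smooth_in_subset by (auto simp: V'_def)
  obtain f1 f2 f3 where cf: "collar_funs = [f1, f2, f3]" by (simp add: collar_funs_def)
  have flat: "(\<Sum>f\<leftarrow>collar_funs @ fs. pd \<kappa> i f q * pd \<kappa> j f q) = pd \<kappa> i T q * pd \<kappa> j T q + pd \<kappa> i \<theta> q
    * pd \<kappa> j \<theta> q"
    if \<kappa>: "\<kappa> \<in> A" and q: "q \<in> fst \<kappa> \<inter> V'" for \<kappa> q i j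
  proof -
    have "pd \<kappa> i f q = 0" if "f \<in> set fs" for f
    proof -
      have "pd \<kappa> i f q = pd \<kappa> i (\<lambda>p. 0) q"
        by (rule pd_cong[OF \<kappa> oV']) (use q fs(2)[OF that] in \<open>auto simp: V'_def\<close>)
      then show ?thesis by (simp add: pd_const)
    qed
    then have 0: "(\<Sum>f\<leftarrow>fs. pd \<kappa> i f q * pd \<kappa> j f q) = 0" by (intro sum_list_zero) simp
    have "q \<in> fst \<kappa> \<inter> V" using q by (auto simp: V'_def)
    have rot: "sin (\<theta> q) * (sin (\<theta> q) * x) + cos (\<theta> q) * (cos (\<theta> q) * x) = x" for x
    proof -
      have "sin (\<theta> q) * (sin (\<theta> q) * x) + cos (\<theta> q) * (cos (\<theta> q) * x) = ((sin (\<theta> q))\<^sup>2 + (cos (\<theta>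
        q))\<^sup>2) * x"
        by (simp only: power2_eq_square distrib_right mult.assoc)
      then show ?thesis by simp
    qed
    have "(\<Sum>f\<leftarrow>collar_funs. pd \<kappa> i f q * pd \<kappa> j f q) = pd \<kappa> i T q * pd \<kappa> j T q + pd \<kappa> i \<theta> q * pd \<kappa> j \<theta> q"
      using V(7)[OF \<kappa> \<open>q \<in> fst \<kappa> \<inter> V\<close>, of i] V(7)[OF \<kappa> \<open>q \<in> fst \<kappa> \<inter> V\<close>, of j]
        rot[of "pd \<kappa> i \<theta> q * pd \<kappa> j \<theta> q"]
      by (simp add: cf algebra_simps)
    then show ?thesis using 0 by simp
  qed
  show ?thesis
  proof (rule I.lap_flat[OF oV' sm pV'])
    fix \<kappa> q assume \<kappa>: "\<kappa> \<in> A" and q: "q \<in> fst \<kappa> \<inter> V'"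
    show "wedge \<kappa> T \<theta> q \<noteq> 0" using V(6) \<kappa> q by (simp add: V'_def)
    show "gE (collar_funs @ fs) \<kappa> q = pd \<kappa> 1 T q * pd \<kappa> 1 T q + pd \<kappa> 1 \<theta> q * pd \<kappa> 1 \<theta> q"
      "gF (collar_funs @ fs) \<kappa> q = pd \<kappa> 1 T q * pd \<kappa> 2 T q + pd \<kappa> 1 \<theta> q * pd \<kappa> 2 \<theta> q"
      "gG (collar_funs @ fs) \<kappa> q = pd \<kappa> 2 T q * pd \<kappa> 2 T q + pd \<kappa> 2 \<theta> q * pd \<kappa> 2 \<theta> q"
      unfolding gE_def gF_def gG_def by (rule flat[OF \<kappa> q])+
  next
    fix q assume "q \<in> V'"
    then have "\<bar>T q\<bar> < 1" by (simp add: V'_def)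
    then show "T q \<in> U" using U(2) by (auto simp: abs_less_iff)
  qed (use U g in auto)
qed

end

section \<open>The function \<open>u\<close> and the positive quotient\<close>

context dividing_collar
begin

lemma smooth_in_sgn_T: "smooth_in {p \<in> S. T p \<noteq> 0} (\<lambda>p. sgn (T p))"
proof (rule smooth_in_local)
  fix p assume p: "p \<in> {p \<in> S. T p \<noteq> 0}"
  have "smooth_in {p \<in> S. 0 < T p} (\<lambda>p. sgn (T p))" "smooth_in {p \<in> S. T p < 0} (\<lambda>p. sgn (T p))"
    by (rule smooth_in_cong[OF T_greater, THEN iffD2, OF _ smooth_in_const[of _ 1]], simp,
        rule smooth_in_cong[OF T_less, THEN iffD2, OF _ smooth_in_const[of _ "-1"]], simp)
  then show "\<exists>V. oS V \<and> p \<in> V \<and> smooth_in V (\<lambda>p. sgn (T p))"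
    using p T_greater[of 0] T_less[of 0]
    by (cases "0 < T p") (auto intro: exI[of _ "{p \<in> S. 0 < T p}"] exI[of _ "{p \<in> S. T p < 0}"])
qed

proposition collar_solution:
  assumes S: "compact S" "connected S" and ne: "\<Union>\<C> \<noteq> {}"
  obtains fs u f where "immersed_surface S A fs" "smooth_in S u" "smooth_in S f"
    "\<And>p. p \<in> S \<Longrightarrow> 0 < f p"
    "\<And>\<kappa> p. \<kappa> \<in> A \<Longrightarrow> p \<in> fst \<kappa> \<Longrightarrow> lap_in fs \<kappa> u p = f p * u p"
    "{p \<in> S. u p = 0} = \<Union>\<C>"
    "\<And>\<kappa> p. \<kappa> \<in> A \<Longrightarrow> p \<in> fst \<kappa> \<Longrightarrow> u p = 0 \<Longrightarrow> pd \<kappa> 1 u p \<noteq> 0 \<or> pd \<kappa> 2 u p \<noteq> 0"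
proof -
  obtain l where l: "immersed_surface S A (collar_funs @ l)"
    "\<And>f p. f \<in> set l \<Longrightarrow> p \<in> S \<Longrightarrow> \<bar>T p\<bar> \<le> 5/8 \<Longrightarrow> f p = 0"
    by (rule metric_exists[OF S(1)]) blast
  interpret I: immersed_surface S A "collar_funs @ l" by (rule l(1))
  obtain h h1 h2 where h: "Cinf_on {-2<..<2} h"
    "\<And>t. \<bar>t\<bar> < 2 \<Longrightarrow> (h has_real_derivative h1 t) (at t)"
    "\<And>t. \<bar>t\<bar> < 2 \<Longrightarrow> (h1 has_real_derivative h2 t) (at t)"
    and h_sin: "\<And>t. \<bar>t\<bar> \<le> 1/4 \<Longrightarrow> h t = sin t" "\<And>t. \<bar>t\<bar> < 1/4 \<Longrightarrow> h2 t = - sin t"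
    and h_const: "\<And>t. 1/2 \<le> t \<Longrightarrow> t < 2 \<Longrightarrow> h t = h (1/2)" "\<And>t. -2 < t \<Longrightarrow> t \<le> -1/2 \<Longrightarrow> h t = h (-1/2)"
    and h_sgn: "\<And>t. 0 < t \<Longrightarrow> t < 2 \<Longrightarrow> 0 < h t" "\<And>t. -2 < t \<Longrightarrow> t < 0 \<Longrightarrow> h t < 0"
    and h2_sgn: "\<And>t. 0 < t \<Longrightarrow> t < 1/2 \<Longrightarrow> h2 t < 0" "\<And>t. - 1/2 < t \<Longrightarrow> t < 0 \<Longrightarrow> 0 < h2 t"
      "\<And>t. 0 < t \<Longrightarrow> t \<le> 1 \<Longrightarrow> h2 t \<le> 0" "\<And>t. - 1 \<le> t \<Longrightarrow> t < 0 \<Longrightarrow> 0 \<le> h2 t"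
    by (rule profile_exists, rule that; (assumption | meson))
  have h1_smooth: "Cinf_on {-2<..<2} h1"
  proof -
    have "Cinf_on {-2<..<2} (\<lambda>t. frechet_derivative h (at t) 1)"
      by (rule Cinf_on_frechet_derivative[OF h(1)])
    moreover have "frechet_derivative h (at t) 1 = h1 t" if "t \<in> {-2<..<2}" for t
    proof -
      have "(h has_derivative (*) (h1 t)) (at t)" using h(2)[of t] that
        by (simp add: has_field_derivative_def abs_less_iff)
      then show ?thesis by (simp add: frechet_derivative_eqI)
    qed
    ultimately show ?thesis by (rule_tac Cinf_on_cong[THEN iffD1]) auto
  qed
  let ?s = "\<lambda>p. sgn (T p)"
  define u0 where "u0 p = h (T p)" for p
  have lap_in: "I.lap u0 p = - h2 (T p)" if "p \<in> S" "\<bar>T p\<bar> < 5/8" for p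
    unfolding u0_def[abs_def]
  proof (rule collar_lap[where U="{-2<..<2}" and g=h and g'=h1, OF l(1) _ that])
    show "f p = 0" if "f \<in> set l" "p \<in> S" "\<bar>T p\<bar> \<le> 5/8" for f p using l(2) that by blast
  qed (use h h1_smooth that in auto)
  \<comment> \<open>Beyond level \<open>1/2\<close> the profile is constant on each side, so
    \<open>u0\<close> is smooth there without smoothness of \<open>T\<close>.\<close>
  have u0_pos: "u0 p = h (1/2)" if "p \<in> {p \<in> S. 1/2 < T p}" for p
    unfolding u0_def by (rule h_const(1)) (use that T_range[of p] in auto)
  have u0_neg: "u0 p = h (-1/2)" if "p \<in> {p \<in> S. T p < -1/2}" for p
    unfolding u0_def by (rule h_const(2)) (use that T_range[of p] in auto)
  have u0_smooth: "smooth_in S u0"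
  proof (rule smooth_in_local)
    fix p assume p: "p \<in> S"
    have "smooth_in P u0"
      unfolding u0_def[abs_def]
    proof (rule smooth_in_compose[OF collar_open open_greaterThanLessThan h(1) _ T_smooth])
      fix q assume "q \<in> P"
      then have "\<bar>T q\<bar> < 1" using in_P_iff tube_sub by blast
      then show "T q \<in> {-2<..<2}" by auto
    qed
    moreover have "smooth_in {p \<in> S. 1/2 < T p} u0"
      by (rule smooth_in_cong[OF T_greater, THEN iffD2, OF _ smooth_in_const]) (rule u0_pos)
    moreover have "smooth_in {p \<in> S. T p < -1/2} u0"
      by (rule smooth_in_cong[OF T_less, THEN iffD2, OF _ smooth_in_const]) (rule u0_neg)
    moreover have "p \<in> P \<or> p \<in> {p \<in> S. 1/2 < T p} \<or> p \<in> {p \<in> S. T p < -1/2}"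
      using p in_P_iff[OF p] by auto
    ultimately show "\<exists>V. oS V \<and> p \<in> V \<and> smooth_in V u0"
      using collar_open T_greater[of "1/2"] T_less[of "-1/2"] by blast
  qed
  have lap_out: "I.lap u0 p = 0" if "p \<in> S" "1/2 < \<bar>T p\<bar>" for p
  proof (cases "0 < T p")
    case True
    have "I.lap u0 p = I.lap (\<lambda>q. h (1/2)) p"
      by (rule I.lap_cong[OF T_greater[of "1/2"] _ u0_pos]) (use that True in auto)
    then show ?thesis by (simp add: I.lap_const)
  next
    case False
    have "I.lap u0 p = I.lap (\<lambda>q. h (-1/2)) p"
      by (rule I.lap_cong[OF T_less[of "-1/2"] _ u0_neg]) (use that False in auto)
    then show ?thesis by (simp add: I.lap_const)
  qed
  have s_lap_pos: "0 < ?s p * I.lap u0 p" if "p \<in> S" "T p \<noteq> 0" "\<bar>T p\<bar> < 1/2" for p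
    using that lap_in[of p] h2_sgn(1,2)[of "T p"] by (cases "0 < T p") (auto simp: abs_less_iff)
  have s_lap_nonneg: "0 \<le> ?s p * I.lap u0 p" if "p \<in> S" "T p \<noteq> 0" for p
  proof (cases "\<bar>T p\<bar> < 5/8")
    case True
    then show ?thesis using that lap_in[of p] h2_sgn(3,4)[of "T p"]
      by (cases "0 < T p") (auto simp: abs_less_iff)
  qed (use that lap_out[of p] in auto)
  have s_u0: "0 < ?s p * u0 p" if "p \<in> S" "T p \<noteq> 0" for p
    using that T_range[of p] h_sgn[of "T p"] by (cases "0 < T p") (auto simp: u0_def)
  \<comment> \<open>Sweeping in \<open>|T| > 1/8\<close> leaves \<open>u = sin T\<close> untouched
    near \<Gamma>. The defect is collected in \<open>1/8 < |T| < 3/8\<close>, a zone whose closure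
    lies in \<open>0 < |T| < 1/2\<close>, where \<open>- h''\<close> does not vanish.\<close>
  let ?W = "{p \<in> S. 1/8 < \<bar>T p\<bar>}" and ?N = "{p \<in> S. 1/8 < \<bar>T p\<bar>} \<inter> {p \<in> S. \<bar>T p\<bar> < 3/8}"
  have outW: "S - (?W - ?N) = {p \<in> S. \<bar>T p\<bar> < 3/8}" by auto
  obtain p0 where "p0 \<in> \<Union>\<C>" using ne by blast
  then have p0: "p0 \<in> S" "T p0 = 0" using circles_sub T_eq_0_iff by blast+
  have "oS (S - (?W - ?N))" unfolding outW by (rule T_abs_less)
  moreover have "S - (?W - ?N) \<noteq> {}" unfolding outW using p0 by auto
  ultimately obtain w where w: "smooth_in S w" "\<And>x. x \<in> S - ?W \<Longrightarrow> w x = 0"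
    "\<And>x. x \<in> ?W - ?N \<Longrightarrow> 0 < I.lap w x"
    using I.sweep[OF S T_abs_greater oS_Int[OF T_abs_greater T_abs_less] Int_lower1] by blast
  have w0: "w x = 0" if "x \<in> {p \<in> S. \<bar>T p\<bar> < 1/8}" for x
    using that by (intro w(2)) auto
  have lap_w0: "I.lap w x = 0" if "x \<in> {p \<in> S. \<bar>T p\<bar> < 1/8}" for x
    using I.lap_cong[OF T_abs_less that w0] by (simp add: I.lap_const)
  \<comment> \<open>Multiplication by the sign of \<open>T\<close> is smooth because
    \<open>w\<close> vanishes near \<open>T = 0\<close>; it turns \<open>L w > 0\<close> into the
    sign required on each side.\<close>
  define v where "v p = ?s p * w p" for p
  have T_ne: "oS {p \<in> S. T p \<noteq> 0}"
  proof -
    have "{p \<in> S. T p \<noteq> 0} = {p \<in> S. 0 < \<bar>T p\<bar>}" by auto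
    then show ?thesis using T_abs_greater[of 0] by (simp only:)
  qed
  have v_smooth: "smooth_in S v"
  proof (rule smooth_in_local)
    fix p assume p: "p \<in> S"
    have "smooth_in {p \<in> S. \<bar>T p\<bar> < 1/8} v"
      by (rule smooth_in_cong[OF T_abs_less, THEN iffD2, OF _ smooth_in_const[of _ 0]]) (simp add:
      v_def w0)
    moreover have "smooth_in {p \<in> S. T p \<noteq> 0} v"
      unfolding v_def[abs_def]
      by (rule smooth_in_mult[OF T_ne smooth_in_sgn_T smooth_in_subset[OF w(1)]]) auto
    moreover have "p \<in> {p \<in> S. \<bar>T p\<bar> < 1/8} \<or> p \<in> {p \<in> S. T p \<noteq> 0}" using p by auto
    ultimately show "\<exists>V. oS V \<and> p \<in> V \<and> smooth_in V v" using T_ne T_abs_less[of "1/8"] by blast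
  qed
  have lap_v: "I.lap v p = ?s p * I.lap w p" if "p \<in> S" "T p \<noteq> 0" for p
  proof (cases "0 < T p")
    case True
    have "I.lap v p = I.lap w p"
      by (rule I.lap_cong[OF T_greater[of 0]]) (use that True in \<open>auto simp: v_def\<close>)
    then show ?thesis using True by simp
  next
    case False
    have "I.lap v p = I.lap (\<lambda>q. - 1 * w q) p"
      by (rule I.lap_cong[OF T_less[of 0]]) (use that False in \<open>auto simp: v_def\<close>)
    also have "\<dots> = - 1 * I.lap w p" by (rule I.lap_mult_const[OF oS_S w(1) that(1)])
    finally show ?thesis using that False by simp
  qed
  have closed: "compact {p \<in> S. a \<le> \<bar>T p\<bar>}" "compact {p \<in> S. a \<le> \<bar>T p\<bar> \<and> \<bar>T p\<bar> \<le> b}" for a b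
  proof -
    have 1: "S - {p \<in> S. a \<le> \<bar>T p\<bar>} = {p \<in> S. \<bar>T p\<bar> < a}"
      "S - {p \<in> S. a \<le> \<bar>T p\<bar> \<and> \<bar>T p\<bar> \<le> b} = {p \<in> S. \<bar>T p\<bar> < a} \<union> {p \<in> S. b < \<bar>T p\<bar>}" by auto
    have "closedin (top_of_set S) {p \<in> S. a \<le> \<bar>T p\<bar>}"
      unfolding closedin_def topspace_euclidean_subtopology 1(1) by (simp add: T_abs_less)
    moreover have "closedin (top_of_set S) {p \<in> S. a \<le> \<bar>T p\<bar> \<and> \<bar>T p\<bar> \<le> b}"
      unfolding closedin_def topspace_euclidean_subtopology 1(2) using T_abs_less T_abs_greater by auto
    ultimately show "compact {p \<in> S. a \<le> \<bar>T p\<bar>}" "compact {p \<in> S. a \<le> \<bar>T p\<bar> \<and> \<bar>T p\<bar> \<le> b}"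
      using S(1) closedin_compact by blast+
  qed
  let ?K1 = "{p \<in> S. 1/8 \<le> \<bar>T p\<bar> \<and> \<bar>T p\<bar> \<le> 3/8}" and ?K2 = "{p \<in> S. 1/8 \<le> \<bar>T p\<bar>}"
  have cont: "continuous_on S (I.lap u0)" "continuous_on S (I.lap w)" "continuous_on S u0"
    "continuous_on S w"
    using smooth_in_continuous[OF oS_S] I.lap_smooth[OF oS_S] u0_smooth w(1) by auto
  have c1: "continuous_on ?K1 (\<lambda>p. \<bar>I.lap u0 p\<bar>)"
    by (intro continuous_intros continuous_on_subset[OF cont(1)]) auto
  have p1: "0 < \<bar>I.lap u0 x\<bar>" if "x \<in> ?K1" for x
  proof -
    have "x \<in> S" "T x \<noteq> 0" "\<bar>T x\<bar> < 1/2" using that by auto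
    from s_lap_pos[OF this] show ?thesis by auto
  qed
  obtain m1 where m1: "0 < m1" "\<And>p. p \<in> ?K1 \<Longrightarrow> m1 \<le> \<bar>I.lap u0 p\<bar>"
    using compact_positive_bound[OF closed(2) c1 p1] by blast
  have c2: "continuous_on ?K2 (\<lambda>p. \<bar>u0 p\<bar>)"
    by (intro continuous_intros continuous_on_subset[OF cont(3)]) auto
  have p2: "0 < \<bar>u0 x\<bar>" if "x \<in> ?K2" for x
  proof -
    have "x \<in> S" "T x \<noteq> 0" using that by auto
    from s_u0[OF this] show ?thesis by auto
  qed
  obtain m2 where m2: "0 < m2" "\<And>p. p \<in> ?K2 \<Longrightarrow> m2 \<le> \<bar>u0 p\<bar>"
    using compact_positive_bound[OF closed(1) c2 p2] by blast
  obtain B1 where B1: "0 \<le> B1" "\<And>p. p \<in> S \<Longrightarrow> \<bar>I.lap w p\<bar> \<le> B1"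
    using compact_abs_bound[OF S(1) cont(2)] by blast
  obtain B2 where B2: "0 \<le> B2" "\<And>p. p \<in> S \<Longrightarrow> \<bar>w p\<bar> \<le> B2"
    using compact_abs_bound[OF S(1) cont(4)] by blast
  \<comment> \<open>The correction must stay below \<open>m1\<close>, a lower bound for
    \<open>|L u0|\<close> where \<open>L w\<close> may be negative, and below \<open>m2\<close>, a
    lower bound for \<open>|u0|\<close> where \<open>w\<close> may be nonzero. The summand 1 makes
    both estimates strict.\<close>
  define e where "e = min m1 m2 / (B1 + B2 + 1)"
  have e0: "e > 0" using m1 m2 B1 B2 by (auto simp: e_def intro!: divide_pos_pos)
  have eB: "e * (B1 + B2 + 1) = min m1 m2" using B1 B2 by (simp add: e_def)
  have eb: "e * B1 < m1" "e * B2 < m2"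
  proof -
    have "e * B1 < e * (B1 + B2 + 1)" "e * B2 < e * (B1 + B2 + 1)" using e0 B1 B2 by simp_all
    then show "e * B1 < m1" "e * B2 < m2" unfolding eB by linarith+
  qed
  define u where "u p = u0 p + e * v p" for p
  have ev_smooth: "smooth_in S (\<lambda>p. e * v p)" by (intro smooth_in_mult oS_S smooth_in_const v_smooth)
  have u_smooth: "smooth_in S u" unfolding u_def[abs_def]
    by (rule smooth_in_add[OF oS_S u0_smooth ev_smooth])
  have lap_u: "I.lap u p = I.lap u0 p + e * I.lap v p" if "p \<in> S" for p
    unfolding u_def[abs_def] I.lap_add[OF oS_S u0_smooth ev_smooth that] I.lap_mult_const[OF oS_S
    v_smooth that] ..
  have abs_s: "?s p * x = \<bar>x\<bar>" if "0 \<le> ?s p * x" "T p \<noteq> 0" for p x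
    using that by (auto simp: sgn_if split: if_splits)
  have ss: "?s p * ?s p = 1" if "T p \<noteq> 0" for p using that by (simp add: sgn_if)
  have su: "0 < ?s p * u p" if p: "p \<in> S" "T p \<noteq> 0" for p
  proof (cases "\<bar>T p\<bar> < 1/8")
    case True
    then show ?thesis using s_u0[OF p] w0[of p] p by (simp add: u_def v_def)
  next
    case False
    have "?s p * u p = ?s p * u0 p + e * w p"
      using ss[OF p(2)]
      by (simp add: u_def v_def distrib_left mult.left_commute[of e] mult.assoc[symmetric])
    moreover have "?s p * u0 p = \<bar>u0 p\<bar>" using s_u0[OF p] abs_s p by simp
    moreover have "m2 \<le> \<bar>u0 p\<bar>" using False p by (intro m2) auto
    moreover have "- (e * B2) \<le> e * w p"
      using B2(2)[OF p(1)] e0 mult_left_mono[of "- B2" "w p" e] by (simp add: abs_le_iff)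
    ultimately show ?thesis using eb(2) by linarith
  qed
  have slap: "0 < ?s p * I.lap u p" if p: "p \<in> S" "T p \<noteq> 0" for p
  proof -
    have eq: "?s p * I.lap u p = ?s p * I.lap u0 p + e * I.lap w p"
      using ss[OF p(2)]
      by (simp add: lap_u[OF p(1)] lap_v[OF p] distrib_left mult.left_commute[of e]
      mult.assoc[symmetric])
    \<comment> \<open>Near \<Gamma> the correction vanishes; in the zone of the defect
      \<open>L u0\<close> dominates it; beyond that \<open>L w\<close> is positive and
      \<open>L u0\<close> does not have the wrong sign.\<close>
    consider "\<bar>T p\<bar> < 1/8" | "1/8 \<le> \<bar>T p\<bar>" "\<bar>T p\<bar> < 3/8" | "3/8 \<le> \<bar>T p\<bar>" by linarith
    then show ?thesis
    proof cases
      case 1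
      then show ?thesis unfolding eq using lap_w0[of p] s_lap_pos[OF p] p by simp
    next
      case 2
      have "?s p * I.lap u0 p = \<bar>I.lap u0 p\<bar>" by (rule abs_s[OF s_lap_nonneg[OF p] p(2)])
      moreover have "m1 \<le> \<bar>I.lap u0 p\<bar>" using 2 p by (intro m1) auto
      moreover have "- (e * B1) \<le> e * I.lap w p"
        using B1(2)[OF p(1)] e0 mult_left_mono[of "- B1" "I.lap w p" e] by (simp add: abs_le_iff)
      ultimately show ?thesis unfolding eq using eb(1) by linarith
    next
      case 3
      have "0 < I.lap w p" using 3 p by (intro w(3)) auto
      then have "0 < e * I.lap w p" using e0 by simp
      then show ?thesis unfolding eq using s_lap_nonneg[OF p] by linarith
    qed
  qed
  have u_near: "u p = sin (T p)" if "p \<in> {p \<in> S. \<bar>T p\<bar> < 1/8}" for p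
    using that h_sin(1)[of "T p"] w0[of p] by (simp add: u_def u0_def v_def)
  have lap_near: "I.lap u p = sin (T p)" if p: "p \<in> {p \<in> S. \<bar>T p\<bar> < 1/8}" for p
  proof -
    have "I.lap u p = I.lap u0 p"
      by (rule I.lap_cong[OF T_abs_less p]) (simp add: u_def v_def w0)
    then show ?thesis using p lap_in[of p] h_sin(2)[of "T p"] by simp
  qed
  \<comment> \<open>Near \<Gamma> both \<open>L u\<close> and \<open>u\<close> equal
    \<open>sin T\<close>, so the quotient is \<open>1\<close> there, and the value prescribed on
    \<Gamma> continues it smoothly.\<close>
  define f where "f p = (if T p = 0 then 1 else I.lap u p / u p)" for p
  have u_ne: "u p \<noteq> 0" if "p \<in> S" "T p \<noteq> 0" for p using su[OF that] by auto
  have f_near: "f p = 1" if "p \<in> {p \<in> S. \<bar>T p\<bar> < 1/8}" for p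
    using u_near[OF that] lap_near[OF that] u_ne[of p] that by (auto simp: f_def)
  have zero: "u p = 0 \<longleftrightarrow> T p = 0" if "p \<in> S" for p
    using u_ne[OF that] u_near[of p] that by auto
  show thesis
  proof (rule that[OF l(1) u_smooth])
    show "smooth_in S f"
    proof (rule smooth_in_local)
      fix p assume p: "p \<in> S"
      have "smooth_in {p \<in> S. \<bar>T p\<bar> < 1/8} f"
        by (rule smooth_in_cong[OF T_abs_less, THEN iffD2, OF _ smooth_in_const]) (rule f_near)
      moreover have "smooth_in {p \<in> S. T p \<noteq> 0} (\<lambda>p. I.lap u p / u p)"
        by (rule smooth_in_divide[OF T_ne smooth_in_subset[OF I.lap_smooth[OF oS_S u_smooth]]
        smooth_in_subset[OF u_smooth]])
          (use u_ne in auto)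
      then have "smooth_in {p \<in> S. T p \<noteq> 0} f"
        by (rule smooth_in_cong[OF T_ne, THEN iffD1, rotated]) (simp add: f_def)
      moreover have "p \<in> {p \<in> S. \<bar>T p\<bar> < 1/8} \<or> p \<in> {p \<in> S. T p \<noteq> 0}" using p by auto
      ultimately show "\<exists>V. oS V \<and> p \<in> V \<and> smooth_in V f" using T_ne T_abs_less[of "1/8"] by blast
    qed
    show "0 < f p" if p: "p \<in> S" for p
    proof (cases "T p = 0")
      case False
      have "0 < (?s p * I.lap u p) / (?s p * u p)" using slap[OF p False] su[OF p False]
        by (rule divide_pos_pos)
      then show ?thesis using False by (simp add: f_def sgn_zero_iff)
    qed (simp add: f_def)
    show "lap_in (collar_funs @ l) \<kappa> u p = f p * u p" if \<kappa>: "\<kappa> \<in> A" "p \<in> fst \<kappa>" for \<kappa> p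
    proof -
      have p: "p \<in> S" using \<kappa> chart_open oS_sub by blast
      have "lap_in (collar_funs @ l) \<kappa> u p = I.lap u p"
        by (rule I.lap_eq[OF \<kappa>(1) oS_S u_smooth \<kappa>(2) p, symmetric])
      also have "\<dots> = f p * u p"
        using u_ne[OF p] zero[OF p] lap_near[of p] p by (auto simp: f_def)
      finally show ?thesis .
    qed
    show "{p \<in> S. u p = 0} = \<Union>\<C>"
      using zero T_eq_0_iff circles_sub by blast
    show "pd \<kappa> 1 u p \<noteq> 0 \<or> pd \<kappa> 2 u p \<noteq> 0" if \<kappa>: "\<kappa> \<in> A" "p \<in> fst \<kappa>" and u0: "u p = 0" for \<kappa> p
    proof -
      have p: "p \<in> S" using \<kappa> chart_open oS_sub by blast
      have Tp: "T p = 0" using zero[OF p] u0 by simp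
      then have "p \<in> P" using in_P_iff[OF p] by simp
      then obtain V \<theta> where V: "oS V" "p \<in> V" "smooth_in V T" "wedge \<kappa> T \<theta> p \<noteq> 0"
        by (rule collar_local) (use \<kappa> in blast)
      have near: "p \<in> {p \<in> S. \<bar>T p\<bar> < 1/8}" using p Tp by simp
      \<comment> \<open>Near \<Gamma> \<open>u = sin T\<close>, and \<open>dT\<close> is nonzero
        because it is independent of the differential of the angle.\<close>
      have "pd \<kappa> i u p = pd \<kappa> i (\<lambda>p. sin (T p)) p" for i
        by (rule pd_cong[OF \<kappa>(1) T_abs_less near \<kappa>(2) u_near])
      moreover have "pd \<kappa> i (\<lambda>p. sin (T p)) p = cos (T p) * pd \<kappa> i T p" for i
        using pd_compose[OF \<kappa>(1) _ V(3) DERIV_sin] V \<kappa> by blast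
      ultimately show ?thesis using V(4) by (auto simp: wedge_def Tp)
    qed
  qed
qed

end

section \<open>From chart representations to tensors\<close>

context surface_atlas
begin

lemma tangent_component:
  assumes "v \<in> tangent_space A p" "\<kappa> \<in> A" "\<mu> \<in> A" "p \<in> fst \<kappa> \<inter> fst \<mu>"
  shows "v \<mu> $ k = v \<kappa> $ 1 * pd \<kappa> 1 (crd \<mu> k) p + v \<kappa> $ 2 * pd \<kappa> 2 (crd \<mu> k) p"
proof -
  have "v \<mu> = frechet_derivative (transition \<kappa> \<mu>) (at (snd \<kappa> p)) (v \<kappa>)"
    using assms unfolding tangent_space_def by blast
  then show ?thesis by (simp add: transition_has_derivative(2)[OF assms(2-4)])
qed

lemma tangentI:
  assumes "\<And>\<kappa> \<mu> k. \<kappa> \<in> A \<Longrightarrow> \<mu> \<in> A \<Longrightarrow> p \<in> fst \<kappa> \<inter> fst \<mu> \<Longrightarrow>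
      v \<mu> $ k = v \<kappa> $ 1 * pd \<kappa> 1 (crd \<mu> k) p + v \<kappa> $ 2 * pd \<kappa> 2 (crd \<mu> k) p"
    and "\<And>\<kappa>. \<not> (\<kappa> \<in> A \<and> p \<in> fst \<kappa>) \<Longrightarrow> v \<kappa> = 0"
  shows "v \<in> tangent_space A p"
  unfolding tangent_space_def
proof (intro CollectI conjI ballI allI impI)
  fix \<kappa> \<mu> assume *: "\<kappa> \<in> A" "\<mu> \<in> A" "p \<in> fst \<kappa> \<inter> fst \<mu>"
  show "v \<mu> = frechet_derivative (transition \<kappa> \<mu>) (at (snd \<kappa> p)) (v \<kappa>)"
    unfolding vec_eq_iff transition_has_derivative(2)[OF *] using assms(1)[OF *] by blast
qed (rule assms(2))

lemma coord_vec_component: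
  assumes "\<kappa> \<in> A" "\<mu> \<in> A" "p \<in> fst \<kappa> \<inter> fst \<mu>"
  shows "coord_vec A \<kappa> p e \<mu> $ k = e $ 1 * pd \<kappa> 1 (crd \<mu> k) p + e $ 2 * pd \<kappa> 2 (crd \<mu> k) p"
  using assms transition_has_derivative(2)[OF assms] by (simp add: coord_vec_def)

lemma coord_vec_self: "\<kappa> \<in> A \<Longrightarrow> p \<in> fst \<kappa> \<Longrightarrow> coord_vec A \<kappa> p e \<kappa> = e"
  by (simp add: vec_eq_iff forall_2 coord_vec_component pd_crd)

lemma coord_vec_tangent:
  assumes "\<kappa> \<in> A" "p \<in> fst \<kappa>"
  shows "coord_vec A \<kappa> p e \<in> tangent_space A p"
proof (rule tangentI)
  fix \<mu> \<nu> k assume *: "\<mu> \<in> A" "\<nu> \<in> A" "p \<in> fst \<mu> \<inter> fst \<nu>"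
  have p: "p \<in> fst \<kappa> \<inter> fst \<mu>" "p \<in> fst \<kappa> \<inter> fst \<nu>" "p \<in> fst \<kappa> \<inter> fst \<mu> \<inter> fst \<nu>" using * assms by auto
  have "pd \<kappa> i (crd \<nu> k) p = pd \<mu> 1 (crd \<nu> k) p * pd \<kappa> i (crd \<mu> 1) p + pd \<mu> 2 (crd \<nu> k) p * pd \<kappa> i
    (crd \<mu> 2) p" for i
    by (rule pd_chain[OF assms(1) *(1) chart_open[OF *(2)] crd_smooth[OF *(2)] p(3)])
  then show "coord_vec A \<kappa> p e \<nu> $ k = coord_vec A \<kappa> p e \<mu> $ 1 * pd \<mu> 1 (crd \<nu> k) p + coord_vec A \<kappa>
    p e \<mu> $ 2 * pd \<mu> 2 (crd \<nu> k) p"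
    unfolding coord_vec_component[OF assms(1) *(1) p(1)] coord_vec_component[OF assms(1) *(2) p(2)]
    by (simp only: algebra_simps)
qed (auto simp: coord_vec_def)

lemma smooth_on_chart:
  assumes "\<kappa> \<in> A" "smooth_in (fst \<kappa>) g" "\<And>q. q \<in> fst \<kappa> \<Longrightarrow> h q = g q"
  shows "smooth_on (chart_image \<kappa>) (h \<circ> chart_inv \<kappa>)"
proof -
  have "Cinf_on (chart_image \<kappa>) (g \<circ> chart_inv \<kappa>)"
    using assms unfolding smooth_in_def by fastforce
  then have "Cinf_on (chart_image \<kappa>) (h \<circ> chart_inv \<kappa>)"
    by (rule Cinf_on_cong[OF open_chart_image[OF assms(1)], THEN iffD2, rotated])
      (simp add: assms(3) chart_inv_in[OF assms(1)])
  then show ?thesis using smooth_on_iff_Cinf_on[OF open_chart_image[OF assms(1)]] by blast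
qed

text \<open>The atlas \<open>A\<close> itself need not be oriented. The sign compares a chart of
  \<open>A\<close> with an oriented chart at the point. Jacobians within \<open>B\<close> are
  positive, so the comparison does not depend on the oriented chart and is locally constant.\<close>

lemma orientation_sign:
  assumes "orientable S A"
  obtains \<sigma> where "\<And>\<kappa> p. \<kappa> \<in> A \<Longrightarrow> p \<in> fst \<kappa> \<Longrightarrow> \<sigma> \<kappa> p * \<sigma> \<kappa> p = (1::real)"
    "\<And>\<kappa> p. \<kappa> \<in> A \<Longrightarrow> p \<in> fst \<kappa> \<Longrightarrow> \<exists>N. oS N \<and> p \<in> N \<and> (\<forall>q\<in>N. \<sigma> \<kappa> q = \<sigma> \<kappa> p)"
    "\<And>\<kappa> \<mu> p. \<kappa> \<in> A \<Longrightarrow> \<mu> \<in> A \<Longrightarrow> p \<in> fst \<kappa> \<inter> fst \<mu> \<Longrightarrow> \<sigma> \<kappa> p = sgn (jac \<kappa> \<mu> p) * \<sigma> \<mu> p"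
proof -
  obtain B where B: "oriented_atlas S B" "smooth_atlas S (A \<union> B)"
    using assms unfolding orientable_def by blast
  interpret AB: surface_atlas S "A \<union> B" by unfold_locales (rule B(2))
  interpret B: surface_atlas S B by unfold_locales (use B(1) in \<open>simp add: oriented_atlas_def\<close>)
  have chainAB: "jac \<kappa> \<nu> p = jac \<kappa> \<mu> p * jac \<mu> \<nu> p"
    if "\<kappa> \<in> A \<union> B" "\<mu> \<in> A \<union> B" "\<nu> \<in> A \<union> B" "p \<in> fst \<kappa> \<inter> fst \<mu> \<inter> fst \<nu>" for \<kappa> \<mu> \<nu> p
    by (rule AB.wedge_chain[OF that(1,2) AB.chart_open[OF that(3)] AB.crd_smooth[OF that(3)]
    AB.crd_smooth[OF that(3)] that(4)])
  have jac0: "jac \<kappa> \<mu> p \<noteq> 0" if "\<kappa> \<in> A \<union> B" "\<mu> \<in> A \<union> B" "p \<in> fst \<kappa> \<inter> fst \<mu>" for \<kappa> \<mu> p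
    by (rule AB.jac_nonzero[OF that])
  have posB: "0 < jac \<mu> \<nu> p" if "\<mu> \<in> B" "\<nu> \<in> B" "p \<in> fst \<mu> \<inter> fst \<nu>" for \<mu> \<nu> p
  proof -
    have "0 < det (matrix (frechet_derivative (transition \<mu> \<nu>) (at (snd \<mu> p))))"
      using B(1) that unfolding oriented_atlas_def by blast
    then show ?thesis
      by (simp add: det_2 matrix_def B.transition_has_derivative(2)[OF that] axis_def wedge_def
      mult.commute)
  qed
  define \<sigma> where "\<sigma> \<kappa> p = sgn (jac \<kappa> (chart_at B p) p)" for \<kappa> p
  have at: "chart_at B p \<in> B" "p \<in> fst (chart_at B p)" if "p \<in> S" for p
    using someI_ex[of "\<lambda>\<kappa>. \<kappa> \<in> B \<and> p \<in> fst \<kappa>"] B.chart_cover[OF that] unfolding chart_at_def by blast+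
  have \<sigma>_eq: "\<sigma> \<kappa> p = sgn (jac \<kappa> \<mu> p)" if "\<kappa> \<in> A" "\<mu> \<in> B" "p \<in> fst \<kappa> \<inter> fst \<mu>" for \<kappa> \<mu> p
  proof -
    have pS: "p \<in> S" using that chart_open oS_sub by blast
    have "jac \<kappa> (chart_at B p) p = jac \<kappa> \<mu> p * jac \<mu> (chart_at B p) p"
      by (rule chainAB) (use that at[OF pS] in auto)
    moreover have "0 < jac \<mu> (chart_at B p) p" by (rule posB) (use that at[OF pS] in auto)
    ultimately show ?thesis by (simp add: \<sigma>_def sgn_mult)
  qed
  show thesis
  proof (rule that[of \<sigma>])
    fix \<kappa> p assume \<kappa>: "\<kappa> \<in> A" "p \<in> fst \<kappa>"
    have pS: "p \<in> S" using \<kappa> chart_open oS_sub by blast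
    let ?\<mu> = "chart_at B p"
    have p: "p \<in> fst \<kappa> \<inter> fst ?\<mu>" using \<kappa> at[OF pS] by auto
    have k: "\<kappa> \<in> A \<union> B" "?\<mu> \<in> A \<union> B" using \<kappa> at[OF pS] by auto
    show "\<sigma> \<kappa> p * \<sigma> \<kappa> p = 1" using jac0[OF k p] by (simp add: \<sigma>_def sgn_if)
    obtain N where N: "oS N" "p \<in> N" "N \<subseteq> fst \<kappa> \<inter> fst ?\<mu>"
      "\<And>q. q \<in> N \<Longrightarrow> sgn (jac \<kappa> ?\<mu> q) = sgn (jac \<kappa> ?\<mu> p)"
      using AB.wedge_sgn_const[OF k(1) AB.chart_open[OF k(2)] AB.crd_smooth[OF k(2)]
      AB.crd_smooth[OF k(2)] p jac0[OF k p]] by blast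
    have "\<sigma> \<kappa> q = \<sigma> \<kappa> p" if "q \<in> N" for q
      using \<sigma>_eq[OF \<kappa>(1) at(1)[OF pS], of q] N(3,4) that by (auto simp: \<sigma>_def)
    then show "\<exists>N. oS N \<and> p \<in> N \<and> (\<forall>q\<in>N. \<sigma> \<kappa> q = \<sigma> \<kappa> p)" using N by blast
  next
    fix \<kappa> \<mu> p assume k: "\<kappa> \<in> A" "\<mu> \<in> A" and p: "p \<in> fst \<kappa> \<inter> fst \<mu>"
    have pS: "p \<in> S" using k p chart_open oS_sub by blast
    have "jac \<kappa> (chart_at B p) p = jac \<kappa> \<mu> p * jac \<mu> (chart_at B p) p"
      by (rule chainAB) (use k p at[OF pS] in auto)
    then show "\<sigma> \<kappa> p = sgn (jac \<kappa> \<mu> p) * \<sigma> \<mu> p" by (simp add: \<sigma>_def sgn_mult)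
  qed
qed

end

section \<open>Complex structure, area form and metric of an oriented surface\<close>

locale oriented_immersed_surface = immersed_surface S A fs
  for S :: "'a::t2_space set" and A :: "'a chart set" and fs +
  fixes \<sigma> :: "'a chart \<Rightarrow> 'a \<Rightarrow> real"
  assumes sign_sq: "\<kappa> \<in> A \<Longrightarrow> p \<in> fst \<kappa> \<Longrightarrow> \<sigma> \<kappa> p * \<sigma> \<kappa> p = 1"
    and sign_local: "\<kappa> \<in> A \<Longrightarrow> p \<in> fst \<kappa> \<Longrightarrow> \<exists>N. openin (top_of_set S) N \<and> p \<in> N \<and> (\<forall>q\<in>N. \<sigma> \<kappa> q = \<sigma> \<kappa> p)"
    and sign_chain: "\<kappa> \<in> A \<Longrightarrow> \<mu> \<in> A \<Longrightarrow> p \<in> fst \<kappa> \<inter> fst \<mu> \<Longrightarrow> \<sigma> \<kappa> p = sgn (jac \<kappa> \<mu> p) * \<sigma> \<mu> p"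
begin

text \<open>The matrix of the rotation by a right angle with respect to the metric, its direction
  corrected by \<open>\<sigma>\<close> so that all charts agree.\<close>

definition rot :: "'a chart \<Rightarrow> 'a \<Rightarrow> real^2 \<Rightarrow> real^2" where
  "rot \<kappa> p x = (\<sigma> \<kappa> p / rt fs \<kappa> p * (- gF fs \<kappa> p * x $ 1 - gG fs \<kappa> p * x $ 2)) *\<^sub>R axis 1 1
     + (\<sigma> \<kappa> p / rt fs \<kappa> p * (gE fs \<kappa> p * x $ 1 + gF fs \<kappa> p * x $ 2)) *\<^sub>R axis 2 1"

definition cstr :: "'a endo" where
  "cstr p v = (\<lambda>\<mu>. if \<mu> \<in> A \<and> p \<in> fst \<mu> then rot \<mu> p (v \<mu>) else 0)"

text \<open>The Riemannian area form scaled by \<open>f\<close>.\<close>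

definition aform :: "('a \<Rightarrow> real) \<Rightarrow> 'a bilin" where
  "aform f p v w = (let \<kappa> = chart_at A p in
     f p * (\<sigma> \<kappa> p * rt fs \<kappa> p * (v \<kappa> $ 1 * w \<kappa> $ 2 - v \<kappa> $ 2 * w \<kappa> $ 1)))"

lemma rot_nth:
  "rot \<kappa> p x $ 1 = \<sigma> \<kappa> p / rt fs \<kappa> p * (- gF fs \<kappa> p * x $ 1 - gG fs \<kappa> p * x $ 2)"
  "rot \<kappa> p x $ 2 = \<sigma> \<kappa> p / rt fs \<kappa> p * (gE fs \<kappa> p * x $ 1 + gF fs \<kappa> p * x $ 2)"
  by (simp_all add: rot_def axis_def)

lemma sign_smooth: "\<kappa> \<in> A \<Longrightarrow> smooth_in (fst \<kappa>) (\<sigma> \<kappa>)"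
proof (rule smooth_in_local)
  fix p assume "\<kappa> \<in> A" "p \<in> fst \<kappa>"
  then obtain N where N: "oS N" "p \<in> N" "\<forall>q\<in>N. \<sigma> \<kappa> q = \<sigma> \<kappa> p" using sign_local by blast
  have "smooth_in N (\<sigma> \<kappa>)"
    by (rule smooth_in_cong[OF N(1), THEN iffD2, OF _ smooth_in_const]) (use N in blast)
  then show "\<exists>V. oS V \<and> p \<in> V \<and> smooth_in V (\<sigma> \<kappa>)" using N by blast
qed

text \<open>The scalar in front of \<open>- x\<close> is the Gram determinant divided by
  \<open>rt\<^sup>2\<close>, hence \<open>1\<close>.\<close>

lemma rot_rot:
  assumes "\<kappa> \<in> A" "p \<in> fst \<kappa>" shows "rot \<kappa> p (rot \<kappa> p x) = - x"
proof -
  define c where "c = \<sigma> \<kappa> p / rt fs \<kappa> p"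
  have c: "c * c * (gE fs \<kappa> p * gG fs \<kappa> p - gF fs \<kappa> p * gF fs \<kappa> p) = 1"
    using rt_pos[OF assms] sign_sq[OF assms] unfolding rt_sq[OF assms, symmetric] by (simp add: c_def)
  have "rot \<kappa> p (rot \<kappa> p x) $ k = - (c * c * (gE fs \<kappa> p * gG fs \<kappa> p - gF fs \<kappa> p * gF fs \<kappa> p)) * x $ k"
    for k
    using exhaust_2[of k] by (elim disjE) (simp_all add: rot_nth c_def[symmetric] algebra_simps)
  then show ?thesis unfolding c by (simp add: vec_eq_iff)
qed

text \<open>The sign of the Jacobian in \<open>\<sigma>\<close> and its absolute value in the
  density combine to the Jacobian itself, so \<open>\<sigma> * rt\<close> transforms like the
  coefficient of a two-form.\<close>

lemma sign_rt_chain: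
  assumes "\<kappa> \<in> A" "\<mu> \<in> A" "p \<in> fst \<kappa> \<inter> fst \<mu>"
  shows "\<sigma> \<kappa> p * rt fs \<kappa> p = jac \<kappa> \<mu> p * (\<sigma> \<mu> p * rt fs \<mu> p)"
    and "\<sigma> \<kappa> p / rt fs \<kappa> p * jac \<kappa> \<mu> p = \<sigma> \<mu> p / rt fs \<mu> p"
proof -
  have "sgn (jac \<kappa> \<mu> p) * \<bar>jac \<kappa> \<mu> p\<bar> = jac \<kappa> \<mu> p" by (simp add: sgn_if)
  then show "\<sigma> \<kappa> p * rt fs \<kappa> p = jac \<kappa> \<mu> p * (\<sigma> \<mu> p * rt fs \<mu> p)"
    unfolding sign_chain[OF assms] rt_chain[OF assms] by (metis mult.assoc mult.left_commute)
  show "\<sigma> \<kappa> p / rt fs \<kappa> p * jac \<kappa> \<mu> p = \<sigma> \<mu> p / rt fs \<mu> p"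
    unfolding sign_chain[OF assms] rt_chain[OF assms] using jac_nonzero[OF assms] by (simp add: sgn_if)
qed

text \<open>Invariance of the rotation: \<open>\<sigma> / rt\<close> transforms with the inverse
  Jacobian, which compensates the factor arising from the metric coefficients.\<close>

lemma cstr_tangent:
  assumes v: "v \<in> tangent_space A p" shows "cstr p v \<in> tangent_space A p"
proof (rule tangentI)
  fix \<kappa> \<mu> k assume *: "\<kappa> \<in> A" "\<mu> \<in> A" "p \<in> fst \<kappa> \<inter> fst \<mu>"
  let ?a = "\<lambda>k. pd \<kappa> 1 (crd \<mu> k) p" and ?b = "\<lambda>k. pd \<kappa> 2 (crd \<mu> k) p"
  define c where "c = \<sigma> \<kappa> p / rt fs \<kappa> p"
  have c: "\<sigma> \<mu> p / rt fs \<mu> p = c * (?a 1 * ?b 2 - ?b 1 * ?a 2)"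
    using sign_rt_chain(2)[OF *] by (simp add: jac_eq c_def)
  have "rot \<mu> p (v \<mu>) $ k = rot \<kappa> p (v \<kappa>) $ 1 * ?a k + rot \<kappa> p (v \<kappa>) $ 2 * ?b k"
    using exhaust_2[of k]
    by (elim disjE) (simp_all add: rot_nth c c_def[symmetric] tangent_component[OF v *]
    metric_chain[OF *] algebra_simps)
  then show "cstr p v \<mu> $ k = cstr p v \<kappa> $ 1 * ?a k + cstr p v \<kappa> $ 2 * ?b k"
    using * by (simp add: cstr_def)
qed (auto simp: cstr_def)

lemma aform_eq:
  assumes "\<kappa> \<in> A" "p \<in> fst \<kappa>" "v \<in> tangent_space A p" "w \<in> tangent_space A p"
  shows "aform f p v w = f p * (\<sigma> \<kappa> p * rt fs \<kappa> p * (v \<kappa> $ 1 * w \<kappa> $ 2 - v \<kappa> $ 2 * w \<kappa> $ 1))"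
proof -
  let ?\<mu> = "chart_at A p"
  have pS: "p \<in> S" using assms chart_open oS_sub by blast
  have *: "\<kappa> \<in> A" "?\<mu> \<in> A" "p \<in> fst \<kappa> \<inter> fst ?\<mu>" using assms chart_at[OF pS] by auto
  have "v ?\<mu> $ 1 * w ?\<mu> $ 2 - v ?\<mu> $ 2 * w ?\<mu> $ 1 = jac \<kappa> ?\<mu> p * (v \<kappa> $ 1 * w \<kappa> $ 2 - v \<kappa> $ 2 * w \<kappa> $ 1)"
    unfolding tangent_component[OF assms(3) *] tangent_component[OF assms(4) *] jac_eq
    by (simp only: algebra_simps)
  then show ?thesis
    unfolding aform_def Let_def sign_rt_chain(1)[OF *] by simp
qed

lemma differential_eq:
  assumes "\<kappa> \<in> A" "p \<in> fst \<kappa>" "v \<in> tangent_space A p" "smooth_in S u"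
  shows "differential A u p v = v \<kappa> $ 1 * pd \<kappa> 1 u p + v \<kappa> $ 2 * pd \<kappa> 2 u p"
proof -
  let ?\<mu> = "chart_at A p"
  have pS: "p \<in> S" using assms chart_open oS_sub by blast
  have *: "\<kappa> \<in> A" "?\<mu> \<in> A" "p \<in> fst \<kappa> \<inter> fst ?\<mu>" "p \<in> fst ?\<mu> \<inter> S" "p \<in> fst \<kappa> \<inter> fst ?\<mu> \<inter> S"
    using assms chart_at[OF pS] pS by auto
  have "differential A u p v = v ?\<mu> $ 1 * pd ?\<mu> 1 u p + v ?\<mu> $ 2 * pd ?\<mu> 2 u p"
    unfolding differential_def Let_def frechet_derivative_eqI[OF smooth_in_has_derivative[OF *(2)
    assms(4) *(4)]] ..
  then show ?thesis
    unfolding tangent_component[OF assms(3) *(1-3)] pd_chain[OF *(1,2) oS_S assms(4) *(5)]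
    by (simp only: algebra_simps)
qed

lemma du_rot:
  assumes "\<kappa> \<in> A" "p \<in> fst \<kappa>" "v \<in> tangent_space A p" "smooth_in S u"
  shows "comp_endo (differential A u) cstr p v
    = \<sigma> \<kappa> p * (v \<kappa> $ 1 * star1 fs \<kappa> u p + v \<kappa> $ 2 * star2 fs \<kappa> u p)"
proof -
  have "cstr p v \<kappa> = rot \<kappa> p (v \<kappa>)" using assms by (simp add: cstr_def)
  then show ?thesis
    unfolding comp_endo_def differential_eq[OF assms(1,2) cstr_tangent[OF assms(3)] assms(4)]
    by (simp add: rot_nth star1_def star2_def divide_inverse algebra_simps)
qed

text \<open>The orientation sign is locally constant and is not differentiated. What remains is the
  exterior derivative of the one-form \<open>(star1, star2)\<close>, that is, \<open>lap_in\<close>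
  times the density.\<close>

lemma ext_deriv_du_rot:
  assumes pS: "p \<in> S" and v: "v \<in> tangent_space A p" and w: "w \<in> tangent_space A p" and u:
    "smooth_in S u"
  defines "\<kappa> \<equiv> chart_at A p"
  shows "ext_deriv A (comp_endo (differential A u) cstr) p v w
    = \<sigma> \<kappa> p * rt fs \<kappa> p * (v \<kappa> $ 1 * w \<kappa> $ 2 - v \<kappa> $ 2 * w \<kappa> $ 1) * lap_in fs \<kappa> u p"
proof -
  have \<kappa>: "\<kappa> \<in> A" "p \<in> fst \<kappa>" using chart_at[OF pS] by (auto simp: \<kappa>_def)
  have kS: "fst \<kappa> \<inter> S = fst \<kappa>" using oS_sub[OF chart_open[OF \<kappa>(1)]] by blast
  have o: "oS (fst \<kappa>)" by (rule chart_open[OF \<kappa>(1)])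
  have pp: "p \<in> fst \<kappa> \<inter> fst \<kappa>" using \<kappa> by simp
  define q where "q e = (\<lambda>x. \<sigma> \<kappa> x * (e $ 1 * star1 fs \<kappa> u x + e $ 2 * star2 fs \<kappa> u x))"
    for e :: "real^2"
  have st: "smooth_in (fst \<kappa>) (star1 fs \<kappa> u)" "smooth_in (fst \<kappa>) (star2 fs \<kappa> u)"
    using star_smooth[OF \<kappa>(1) oS_S u] by (simp_all add: kS)
  have in1: "smooth_in (fst \<kappa>) (\<lambda>x. e $ 1 * star1 fs \<kappa> u x)"
    "smooth_in (fst \<kappa>) (\<lambda>x. e $ 2 * star2 fs \<kappa> u x)" for e :: "real^2"
    by (intro smooth_in_mult o smooth_in_const st)+
  have q: "smooth_in (fst \<kappa>) (q e)" for e
    unfolding q_def by (intro smooth_in_mult smooth_in_add o sign_smooth \<kappa> in1)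
  have pd\<sigma>: "pd \<kappa> i (\<sigma> \<kappa>) p = 0" for i
  proof -
    obtain N where N: "oS N" "p \<in> N" "\<forall>q\<in>N. \<sigma> \<kappa> q = \<sigma> \<kappa> p" using sign_local[OF \<kappa>] by blast
    have "pd \<kappa> i (\<sigma> \<kappa>) p = pd \<kappa> i (\<lambda>q. \<sigma> \<kappa> p) p"
      by (rule pd_cong[OF \<kappa>(1) N(1,2) \<kappa>(2)]) (rule bspec[OF N(3)])
    then show ?thesis by (simp add: pd_const)
  qed
  have pd1: "pd \<kappa> i (\<lambda>x. c * star1 fs \<kappa> u x) p = c * pd \<kappa> i (star1 fs \<kappa> u) p" for i c
    using pd_mult[OF \<kappa>(1) pp smooth_in_const st(1), of i c] by (simp add: pd_const)
  have pd2: "pd \<kappa> i (\<lambda>x. c * star2 fs \<kappa> u x) p = c * pd \<kappa> i (star2 fs \<kappa> u) p" for i c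
    using pd_mult[OF \<kappa>(1) pp smooth_in_const st(2), of i c] by (simp add: pd_const)
  have pdq: "pd \<kappa> i (q e) p = \<sigma> \<kappa> p * (e $ 1 * pd \<kappa> i (star1 fs \<kappa> u) p + e $ 2 * pd \<kappa> i (star2 fs \<kappa>
    u) p)" for i e
  proof -
    define r where "r x = e $ 1 * star1 fs \<kappa> u x + e $ 2 * star2 fs \<kappa> u x" for x
    have r: "smooth_in (fst \<kappa>) r" unfolding r_def[abs_def] by (rule smooth_in_add[OF o in1])
    have "pd \<kappa> i (q e) p = pd \<kappa> i (\<sigma> \<kappa>) p * r p + \<sigma> \<kappa> p * pd \<kappa> i r p"
      using pd_mult[OF \<kappa>(1) pp sign_smooth[OF \<kappa>(1)] r] by (simp only: q_def r_def)
    moreover have "pd \<kappa> i r p = e $ 1 * pd \<kappa> i (star1 fs \<kappa> u) p + e $ 2 * pd \<kappa> i (star2 fs \<kappa> u) p"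
      using pd_add[OF \<kappa>(1) pp in1(1)[of e] in1(2)[of e], of i] unfolding pd1 pd2 r_def[abs_def] .
    ultimately show ?thesis by (simp add: pd\<sigma>)
  qed
  have pairing: "frechet_derivative (\<lambda>x. comp_endo (differential A u) cstr (chart_inv \<kappa> x)
    (coord_vec A \<kappa> (chart_inv \<kappa> x) e)) (at (snd \<kappa> p)) d
     = d $ 1 * pd \<kappa> 1 (q e) p + d $ 2 * pd \<kappa> 2 (q e) p" for e d
  proof -
    have "frechet_derivative (\<lambda>x. comp_endo (differential A u) cstr (chart_inv \<kappa> x) (coord_vec A \<kappa>
      (chart_inv \<kappa> x) e)) (at (snd \<kappa> p))
      = frechet_derivative (q e \<circ> chart_inv \<kappa>) (at (snd \<kappa> p))"
    proof (rule frechet_derivative_cong_open[OF open_chart_image[OF \<kappa>(1)]])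
      show "snd \<kappa> p \<in> chart_image \<kappa>" using \<kappa> by blast
      fix x assume "x \<in> chart_image \<kappa>"
      then have x: "chart_inv \<kappa> x \<in> fst \<kappa>" by (rule chart_inv_in[OF \<kappa>(1)])
      show "comp_endo (differential A u) cstr (chart_inv \<kappa> x) (coord_vec A \<kappa> (chart_inv \<kappa> x) e) = (q
        e \<circ> chart_inv \<kappa>) x"
        unfolding du_rot[OF \<kappa>(1) x coord_vec_tangent[OF \<kappa>(1) x] u] coord_vec_self[OF \<kappa>(1) x]
        by (simp add: q_def)
    qed
    then show ?thesis using frechet_derivative_eqI[OF smooth_in_has_derivative[OF \<kappa>(1) q pp]] by simp
  qed
  have "ext_deriv A (comp_endo (differential A u) cstr) p v w
    = \<sigma> \<kappa> p * (v \<kappa> $ 1 * w \<kappa> $ 2 - v \<kappa> $ 2 * w \<kappa> $ 1) * (pd \<kappa> 1 (star2 fs \<kappa> u) p - pd \<kappa> 2 (star1 fs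
      \<kappa> u) p)"
    unfolding ext_deriv_def Let_def \<kappa>_def[symmetric] pairing pdq by (simp only: algebra_simps)
  then show ?thesis
    using rt_pos[OF \<kappa>] by (simp add: lap_in_def)
qed

definition gform :: "'a chart \<Rightarrow> 'a \<Rightarrow> real^2 \<Rightarrow> real^2 \<Rightarrow> real" where
  "gform \<kappa> p x y = gE fs \<kappa> p * x $ 1 * y $ 1 + gF fs \<kappa> p * (x $ 1 * y $ 2 + x $ 2 * y $ 1) + gG fs \<kappa>
    p * x $ 2 * y $ 2"

text \<open>Sign and density in the area form cancel against those in the rotation and leave the
  pulled-back metric.\<close>

lemma metric_eq:
  assumes "\<kappa> \<in> A" "p \<in> fst \<kappa>" "v \<in> tangent_space A p" "w \<in> tangent_space A p"
  shows "metric_of (aform f) cstr p v w = f p * gform \<kappa> p (v \<kappa>) (w \<kappa>)"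
proof -
  let ?s = "\<sigma> \<kappa> p" and ?r = "rt fs \<kappa> p"
  define c where "c = ?s / ?r"
  have cw: "cstr p w \<kappa> = rot \<kappa> p (w \<kappa>)" using assms by (simp add: cstr_def)
  have sr: "?s * ?r * c = 1" using sign_sq[OF assms(1,2)] rt_pos[OF assms(1,2)] by (simp add: c_def)
  have "metric_of (aform f) cstr p v w = f p * (?s * ?r * (v \<kappa> $ 1 * rot \<kappa> p (w \<kappa>) $ 2 - v \<kappa> $ 2 *
    rot \<kappa> p (w \<kappa>) $ 1))"
    unfolding metric_of_def aform_eq[OF assms(1-3) cstr_tangent[OF assms(4)]] cw ..
  also have "?s * ?r * (v \<kappa> $ 1 * rot \<kappa> p (w \<kappa>) $ 2 - v \<kappa> $ 2 * rot \<kappa> p (w \<kappa>) $ 1)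
     = ?s * ?r * c * gform \<kappa> p (v \<kappa>) (w \<kappa>)"
    by (simp add: rot_nth gform_def c_def[symmetric] algebra_simps)
  finally show ?thesis by (simp add: sr)
qed

lemma gform_pos: "\<kappa> \<in> A \<Longrightarrow> p \<in> fst \<kappa> \<Longrightarrow> x \<noteq> 0 \<Longrightarrow> 0 < gform \<kappa> p x x"
  using metric_pos[of \<kappa> p "x $ 1" "x $ 2"] by (simp add: gform_def vec_eq_iff forall_2 algebra_simps)

lemma tcomb_tangent:
  assumes "v \<in> tangent_space A p" "w \<in> tangent_space A p" shows "tcomb a v b w \<in> tangent_space A p"
proof (rule tangentI)
  fix \<kappa> \<mu> k assume *: "\<kappa> \<in> A" "\<mu> \<in> A" "p \<in> fst \<kappa> \<inter> fst \<mu>"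
  show "tcomb a v b w \<mu> $ k = tcomb a v b w \<kappa> $ 1 * pd \<kappa> 1 (crd \<mu> k) p + tcomb a v b w \<kappa> $ 2 * pd \<kappa>
    2 (crd \<mu> k) p"
    using tangent_component[OF assms(1) *, of k] tangent_component[OF assms(2) *, of k]
    by (simp add: tcomb_def algebra_simps)
next
  fix \<kappa> assume "\<not> (\<kappa> \<in> A \<and> p \<in> fst \<kappa>)"
  then have "v \<kappa> = 0" "w \<kappa> = 0" using assms unfolding tangent_space_def by blast+
  then show "tcomb a v b w \<kappa> = 0" by (simp add: tcomb_def)
qed

lemma coord_field_tangent: "\<kappa> \<in> A \<Longrightarrow> p \<in> fst \<kappa> \<Longrightarrow> coord_field A \<kappa> i p \<in> tangent_space A p"
  and coord_field_self: "\<kappa> \<in> A \<Longrightarrow> p \<in> fst \<kappa> \<Longrightarrow> coord_field A \<kappa> i p \<kappa> = axis i 1"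
  unfolding coord_field_def by (rule coord_vec_tangent, assumption+) (rule coord_vec_self)

lemma bilinear_field_aform:
  assumes f: "smooth_in S f"
  shows "smooth_bilinear_field A S (aform f)"
  unfolding smooth_bilinear_field_def
proof (intro conjI ballI allI)
  fix p v w z a b assume "p \<in> S" and t: "v \<in> tangent_space A p" "w \<in> tangent_space A p"
    "z \<in> tangent_space A p"
  show "aform f p (tcomb a v b w) z = a * aform f p v z + b * aform f p w z"
    "aform f p z (tcomb a v b w) = a * aform f p z v + b * aform f p z w"
    by (simp_all add: aform_def Let_def tcomb_def algebra_simps)
next
  fix \<kappa> and i k :: 2 assume \<kappa>: "\<kappa> \<in> A"
  have o: "oS (fst \<kappa>)" by (rule chart_open[OF \<kappa>])
  let ?e = "\<lambda>i :: 2. axis i 1 :: real^2"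
  let ?c = "?e i $ 1 * ?e k $ 2 - ?e i $ 2 * ?e k $ 1"
  show "smooth_on (chart_image \<kappa>) ((\<lambda>p. aform f p (coord_field A \<kappa> i p) (coord_field A \<kappa> k p)) \<circ>
    chart_inv \<kappa>)"
  proof (rule smooth_on_chart[OF \<kappa>])
    show "smooth_in (fst \<kappa>) (\<lambda>p. f p * (\<sigma> \<kappa> p * rt fs \<kappa> p * ?c))"
      by (intro smooth_in_mult o sign_smooth rt_smooth smooth_in_const \<kappa> smooth_in_subset[OF f
      oS_sub[OF o]])
    show "aform f p (coord_field A \<kappa> i p) (coord_field A \<kappa> k p) = f p * (\<sigma> \<kappa> p * rt fs \<kappa> p * ?c)"
      if "p \<in> fst \<kappa>" for p
      unfolding aform_eq[OF \<kappa> that coord_field_tangent[OF \<kappa> that] coord_field_tangent[OF \<kappa> that]]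
      coord_field_self[OF \<kappa> that] ..
  qed
qed

lemma area_form_aform:
  assumes f: "smooth_in S f" and pos: "\<And>p. p \<in> S \<Longrightarrow> 0 < f p"
  shows "area_form S A (aform f)"
  unfolding area_form_def
proof (intro conjI ballI)
  show "smooth_bilinear_field A S (aform f)" by (rule bilinear_field_aform[OF f])
  show "aform f p v v = 0" for p v by (simp add: aform_def Let_def)
  fix p assume p: "p \<in> S"
  let ?k = "chart_at A p"
  note k = chart_at[OF p]
  have "\<sigma> ?k p \<noteq> 0" using sign_sq[OF k] by auto
  then have "aform f p (coord_field A ?k 1 p) (coord_field A ?k 2 p) \<noteq> 0"
    unfolding aform_eq[OF k coord_field_tangent[OF k] coord_field_tangent[OF k]] coord_field_self[OF k]
    using rt_pos[OF k] pos[OF p] by (simp add: axis_def)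
  then show "\<exists>v\<in>tangent_space A p. \<exists>w\<in>tangent_space A p. aform f p v w \<noteq> 0"
    using coord_field_tangent[OF k] by blast
qed

lemma complex_structure_cstr: "complex_structure S A cstr"
  unfolding complex_structure_def
proof (intro conjI ballI allI)
  fix p v assume p: "p \<in> S" and v: "v \<in> tangent_space A p"
  show "cstr p v \<in> tangent_space A p" by (rule cstr_tangent[OF v])
  show "cstr p (cstr p v) = (\<lambda>\<kappa>. - v \<kappa>)"
  proof
    fix \<kappa>
    show "cstr p (cstr p v) \<kappa> = - v \<kappa>"
    proof (cases "\<kappa> \<in> A \<and> p \<in> fst \<kappa>")
      case False
      then have "v \<kappa> = 0" using v unfolding tangent_space_def by blast
      then show ?thesis using False by (auto simp: cstr_def)
    qed (simp add: cstr_def rot_rot)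
  qed
next
  fix p v w a b
  show "cstr p (tcomb a v b w) = tcomb a (cstr p v) b (cstr p w)"
    by (rule ext) (simp add: cstr_def tcomb_def vec_eq_iff forall_2 rot_nth algebra_simps)
next
  fix \<kappa> and i :: 2 assume \<kappa>: "\<kappa> \<in> A"
  have o: "oS (fst \<kappa>)" and oi: "open (chart_image \<kappa>)"
    by (rule chart_open[OF \<kappa>], rule open_chart_image[OF \<kappa>])
  have val: "cstr p (coord_field A \<kappa> i p) \<kappa> = rot \<kappa> p (axis i 1)" if "p \<in> fst \<kappa>" for p
    using that \<kappa> by (simp add: cstr_def coord_field_self)
  have sm: "smooth_in (fst \<kappa>) (\<lambda>p. \<sigma> \<kappa> p / rt fs \<kappa> p * (- gF fs \<kappa> p * axis i 1 $ 1 - gG fs \<kappa> p *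
    axis i 1 $ 2))"
    "smooth_in (fst \<kappa>) (\<lambda>p. \<sigma> \<kappa> p / rt fs \<kappa> p * (gE fs \<kappa> p * axis i 1 $ 1 + gF fs \<kappa> p * axis i 1 $ 2))"
    by (intro smooth_in_mult smooth_in_divide smooth_in_diff smooth_in_add smooth_in_minus o
    sign_smooth rt_smooth
        metric_smooth smooth_in_const \<kappa>; use rt_pos[OF \<kappa>] in force)+
  have sub: "Cinf_on (chart_image \<kappa>) (g \<circ> chart_inv \<kappa>)" if "smooth_in (fst \<kappa>) g" for g
    using that \<kappa> unfolding smooth_in_def by fastforce
  have "Cinf_on (chart_image \<kappa>) (\<lambda>x. rot \<kappa> (chart_inv \<kappa> x) (axis i 1))"
    unfolding rot_def
    by (intro Cinf_on_add Cinf_on_scaleR oi Cinf_on_const sub[OF sm(1), unfolded o_def] sub[OF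
    sm(2), unfolded o_def])
  then have "Cinf_on (chart_image \<kappa>) ((\<lambda>p. cstr p (coord_field A \<kappa> i p) \<kappa>) \<circ> chart_inv \<kappa>)"
    by (rule Cinf_on_cong[OF oi, THEN iffD2, rotated]) (simp add: val chart_inv_in[OF \<kappa>])
  then show "smooth_on (chart_image \<kappa>) ((\<lambda>p. cstr p (coord_field A \<kappa> i p) \<kappa>) \<circ> chart_inv \<kappa>)"
    using smooth_on_iff_Cinf_on[OF oi] by blast
qed

lemma compatible_aform_cstr:
  assumes f: "smooth_in S f" and pos: "\<And>p. p \<in> S \<Longrightarrow> 0 < f p"
  shows "compatible S A (aform f) cstr"
  unfolding compatible_def riemannian_metric_def smooth_bilinear_field_def
proof (intro conjI ballI allI impI)
  fix p v w z a b assume p: "p \<in> S" and t: "v \<in> tangent_space A p" "w \<in> tangent_space A p"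
    "z \<in> tangent_space A p"
  note k = chart_at[OF p]
  note m = metric_eq[OF k]
  show "metric_of (aform f) cstr p (tcomb a v b w) z = a * metric_of (aform f) cstr p v z + b *
    metric_of (aform f) cstr p w z"
    "metric_of (aform f) cstr p z (tcomb a v b w) = a * metric_of (aform f) cstr p z v + b *
      metric_of (aform f) cstr p z w"
    unfolding m[OF tcomb_tangent[OF t(1,2)] t(3)] m[OF t(3) tcomb_tangent[OF t(1,2)]] m[OF t(1,3)]
    m[OF t(2,3)] m[OF t(3,1)] m[OF t(3,2)]
    by (simp_all add: tcomb_def gform_def algebra_simps)
next
  fix \<kappa> and i k :: 2 assume \<kappa>: "\<kappa> \<in> A"
  have o: "oS (fst \<kappa>)" by (rule chart_open[OF \<kappa>])
  show "smooth_on (chart_image \<kappa>) ((\<lambda>p. metric_of (aform f) cstr p (coord_field A \<kappa> i p)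
    (coord_field A \<kappa> k p)) \<circ> chart_inv \<kappa>)"
  proof (rule smooth_on_chart[OF \<kappa>])
    show "smooth_in (fst \<kappa>) (\<lambda>p. f p * gform \<kappa> p (axis i 1) (axis k 1))"
      unfolding gform_def
      by (intro smooth_in_mult smooth_in_add o metric_smooth smooth_in_const \<kappa> smooth_in_subset[OF f
      oS_sub[OF o]])
    show "metric_of (aform f) cstr p (coord_field A \<kappa> i p) (coord_field A \<kappa> k p) = f p * gform \<kappa> p
      (axis i 1) (axis k 1)"
      if "p \<in> fst \<kappa>" for p
      unfolding metric_eq[OF \<kappa> that coord_field_tangent[OF \<kappa> that] coord_field_tangent[OF \<kappa> that]]
      coord_field_self[OF \<kappa> that] ..
  qed
next
  fix p v w assume p: "p \<in> S" and t: "v \<in> tangent_space A p" "w \<in> tangent_space A p"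
  note k = chart_at[OF p]
  show "metric_of (aform f) cstr p v w = metric_of (aform f) cstr p w v"
    unfolding metric_eq[OF k t] metric_eq[OF k t(2,1)] by (simp add: gform_def algebra_simps)
next
  fix p v assume p: "p \<in> S" and v: "v \<in> tangent_space A p" "v \<noteq> (\<lambda>_. 0)"
  let ?k = "chart_at A p"
  note k = chart_at[OF p]
  have "v ?k \<noteq> 0"
  proof
    assume 0: "v ?k = 0"
    have "v \<mu> = 0" for \<mu>
    proof (cases "\<mu> \<in> A \<and> p \<in> fst \<mu>")
      case True
      then have "\<mu> \<in> A" "p \<in> fst ?k \<inter> fst \<mu>" using k by auto
      from tangent_component[OF v(1) k(1) this] show ?thesis by (simp add: vec_eq_iff 0)
    next
      case False
      then show ?thesis using v(1) unfolding tangent_space_def by blast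
    qed
    then show False using v(2) by auto
  qed
  then show "0 < metric_of (aform f) cstr p v v"
    unfolding metric_eq[OF k v(1) v(1)] using gform_pos[OF k] pos[OF p] by simp
qed

text \<open>The norm is a supremum of reals, so boundedness on the unit ball has to be established
  before a single vector can serve as a lower bound.\<close>

lemma covector_norm_differential_pos:
  assumes f: "\<And>p. p \<in> S \<Longrightarrow> 0 < f p" and u: "smooth_in S u" and p: "p \<in> S"
    and du: "\<And>\<kappa>. \<kappa> \<in> A \<Longrightarrow> p \<in> fst \<kappa> \<Longrightarrow> pd \<kappa> 1 u p \<noteq> 0 \<or> pd \<kappa> 2 u p \<noteq> 0"
  shows "0 < covector_norm A (metric_of (aform f) cstr) (differential A u) p"
proof -
  let ?k = "chart_at A p" and ?g = "metric_of (aform f) cstr"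
  note k = chart_at[OF p]
  let ?X = "{v \<in> tangent_space A p. ?g p v v \<le> 1}"
  define E F G D where "E = gE fs ?k p" and "F = gF fs ?k p" and "G = gG fs ?k p" and "D = E * G - F * F"
  have pos: "E > 0" "G > 0" "D > 0" "f p > 0"
    using gE_pos[OF k] gG_pos[OF k] disc_pos[OF k] f[OF p] by (auto simp: E_def F_def G_def D_def)
  have bdd: "\<bar>differential A u p v\<bar> \<le> (1 + G / (f p * D)) * \<bar>pd ?k 1 u p\<bar> + (1 + E / (f p * D)) *
    \<bar>pd ?k 2 u p\<bar>"
    if v: "v \<in> ?X" for v
  proof -
    let ?x = "v ?k $ 1" and ?y = "v ?k $ 2"
    have t: "v \<in> tangent_space A p" "f p * gform ?k p (v ?k) (v ?k) \<le> 1"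
      using v metric_eq[OF k, of v v f] by auto
    define Q where "Q = gform ?k p (v ?k) (v ?k)"
    have Q: "Q = E * ?x * ?x + 2 * F * ?x * ?y + G * ?y * ?y"
      by (simp add: Q_def gform_def E_def F_def G_def algebra_simps)
    have Q1: "Q \<le> 1 / f p" using t(2) pos by (simp add: Q_def field_simps)
    \<comment> \<open>Completing the square in each variable bounds the components of vectors in the
      unit ball.\<close>
    have "E * Q = (E * ?x + F * ?y)\<^sup>2 + D * ?y\<^sup>2" "G * Q = (G * ?y + F * ?x)\<^sup>2 + D * ?x\<^sup>2"
      unfolding Q D_def by (simp_all add: power2_eq_square algebra_simps)
    then have "D * ?y\<^sup>2 \<le> E * Q" "D * ?x\<^sup>2 \<le> G * Q" by auto
    moreover have "E * Q \<le> E * (1 / f p)" "G * Q \<le> G * (1 / f p)" using Q1 pos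
      by (intro mult_left_mono; simp)+
    ultimately have "D * ?y\<^sup>2 \<le> E / f p" "D * ?x\<^sup>2 \<le> G / f p" by simp_all
    then have sq: "?y\<^sup>2 \<le> E / (f p * D)" "?x\<^sup>2 \<le> G / (f p * D)" using pos by (simp_all add: field_simps)
    \<comment> \<open>Turns a bound on \<open>x\<^sup>2\<close> into a bound on \<open>|x|\<close>
      without square roots.\<close>
    have abs1: "\<bar>x\<bar> \<le> 1 + x\<^sup>2" for x :: real
    proof (cases "\<bar>x\<bar> \<le> 1")
      case False
      then have "\<bar>x\<bar> * 1 \<le> \<bar>x\<bar> * \<bar>x\<bar>" by (intro mult_left_mono) auto
      then show ?thesis by (simp add: power2_eq_square)
    qed (simp add: add_increasing2)
    have "\<bar>differential A u p v\<bar> \<le> \<bar>?x\<bar> * \<bar>pd ?k 1 u p\<bar> + \<bar>?y\<bar> * \<bar>pd ?k 2 u p\<bar>"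
      unfolding differential_eq[OF k t(1) u] abs_mult[symmetric] by (rule abs_triangle_ineq)
    also have "\<dots> \<le> (1 + G / (f p * D)) * \<bar>pd ?k 1 u p\<bar> + (1 + E / (f p * D)) * \<bar>pd ?k 2 u p\<bar>"
      using abs1[of ?x] abs1[of ?y] sq by (intro add_mono mult_right_mono) auto
    finally show ?thesis .
  qed
  then have bd: "bdd_above ((\<lambda>v. \<bar>differential A u p v\<bar>) ` ?X)" by (intro bdd_aboveI2) 
  obtain i where i: "pd ?k i u p \<noteq> 0" using du[OF k] by blast
  define c where "c = f p * gform ?k p (axis i 1) (axis i 1)"
  have c: "c > 0" unfolding c_def using pos gform_pos[OF k, of "axis i 1"] by (simp add: axis_eq_0_iff)
  \<comment> \<open>A multiple of a coordinate vector along which \<open>u\<close> varies; it lies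
    in the unit ball because \<open>c \<le> (1 + c)\<^sup>2\<close>.\<close>
  define v where "v = coord_vec A ?k p (axis i (1 / (1 + c)))"
  have v: "v \<in> tangent_space A p" "v ?k = axis i (1 / (1 + c))"
    unfolding v_def by (rule coord_vec_tangent[OF k], rule coord_vec_self[OF k])
  have "gform ?k p (axis i (1 / (1 + c))) (axis i (1 / (1 + c))) = gform ?k p (axis i 1) (axis i 1)
    / ((1 + c) * (1 + c))"
    using exhaust_2[of i] by (auto simp: gform_def axis_def)
  then have "?g p v v = c / ((1 + c) * (1 + c))"
    unfolding metric_eq[OF k v(1) v(1)] v(2) c_def by simp
  moreover have "c \<le> (1 + c) * (1 + c)" using c mult_pos_pos[OF c c] by (simp add: algebra_simps)
  then have "c / ((1 + c) * (1 + c)) \<le> 1" using c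
    by (intro divide_le_eq_1_pos[THEN iffD2] mult_pos_pos) auto
  ultimately have vX: "v \<in> ?X" using v by simp
  have "differential A u p v = 1 / (1 + c) * pd ?k i u p"
    unfolding differential_eq[OF k v(1) u] v(2) using exhaust_2[of i] by (auto simp: axis_def)
  then have "0 < \<bar>differential A u p v\<bar>" using i c by simp
  also have "\<dots> \<le> covector_norm A ?g (differential A u) p"
    unfolding covector_norm_def by (rule cSUP_upper[OF vX bd])
  finally show ?thesis .
qed

end

theorem proposition6:
  fixes S S_minus S_plus :: "'a::t2_space set"
    and A :: "'a chart set"
    and \<C> :: "'a set set"
    and \<tau> :: "real \<times> 'a \<Rightarrow> 'a"
  assumes surface: "closed_surface S A" "connected S" "orientable S A"
    and circles: "finite \<C>" "\<C> \<noteq> {}" "pairwise disjnt \<C>" "\<forall>C\<in>\<C>. embedded_circle S A C"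
    and tube: "tubular_neighbourhood S A \<C> \<tau>"
    and regions: "openin (top_of_set S) S_minus" "S_minus \<noteq> {}"
      "openin (top_of_set S) S_plus" "S_plus \<noteq> {}"
    and decomposition: "S = S_minus \<union> \<tau> ` ({-1..1} \<times> \<Union>\<C>) \<union> S_plus"
      "disjnt S_minus (\<tau> ` ({-1..1} \<times> \<Union>\<C>))"
      "disjnt S_plus (\<tau> ` ({-1..1} \<times> \<Union>\<C>))"
      "disjnt S_minus S_plus"
    and boundaries:
      "(top_of_set S) frontier_of ((top_of_set S) closure_of S_minus) = \<tau> ` ({-1} \<times> \<Union>\<C>)"
      "(top_of_set S) frontier_of ((top_of_set S) closure_of S_plus) = \<tau> ` ({1} \<times> \<Union>\<C>)"
  shows "\<exists>u \<Omega> j. smooth_function A u \<and> area_form S A \<Omega> \<and>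
      complex_structure S A j \<and> compatible S A \<Omega> j \<and>
      (\<forall>p\<in>S. \<forall>v\<in>tangent_space A p. \<forall>w\<in>tangent_space A p.
         ext_deriv A (comp_endo (differential A u) j) p v w = u p * \<Omega> p v w) \<and>
      {p \<in> S. u p = 0} = \<Union>\<C> \<and>
      (\<forall>p\<in>S. (u p)\<^sup>2 + (covector_norm A (metric_of \<Omega> j) (differential A u) p)\<^sup>2 > 0)"
proof -
  have atlas: "smooth_atlas S A" and S: "compact S" using surface(1) by (auto simp: closed_surface_def)
  interpret dividing_collar S A \<C> \<tau> S_minus S_plus
    by unfold_locales (fact atlas circles tube regions decomposition boundaries)+
  have ne: "\<Union>\<C> \<noteq> {}"
  proof -
    obtain C where "C \<in> \<C>" using circles(2) by blast
    then show ?thesis using circ_in[of C 0] by blast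
  qed
  obtain fs u f where fs: "immersed_surface S A fs" and u: "smooth_in S u" and f: "smooth_in S f"
    and fpos: "\<And>p. p \<in> S \<Longrightarrow> 0 < f p"
    and lap: "\<And>\<kappa> p. \<kappa> \<in> A \<Longrightarrow> p \<in> fst \<kappa> \<Longrightarrow> lap_in fs \<kappa> u p = f p * u p"
    and zero: "{p \<in> S. u p = 0} = \<Union>\<C>"
    and du: "\<And>\<kappa> p. \<kappa> \<in> A \<Longrightarrow> p \<in> fst \<kappa> \<Longrightarrow> u p = 0 \<Longrightarrow> pd \<kappa> 1 u p \<noteq> 0 \<or> pd \<kappa> 2 u p \<noteq> 0"
    by (rule collar_solution[OF S surface(2) ne], rule that; (assumption | blast))
  obtain \<sigma> where \<sigma>: "\<And>\<kappa> p. \<kappa> \<in> A \<Longrightarrow> p \<in> fst \<kappa> \<Longrightarrow> \<sigma> \<kappa> p * \<sigma> \<kappa> p = (1::real)"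
    "\<And>\<kappa> p. \<kappa> \<in> A \<Longrightarrow> p \<in> fst \<kappa> \<Longrightarrow> \<exists>N. oS N \<and> p \<in> N \<and> (\<forall>q\<in>N. \<sigma> \<kappa> q = \<sigma> \<kappa> p)"
    "\<And>\<kappa> \<mu> p. \<kappa> \<in> A \<Longrightarrow> \<mu> \<in> A \<Longrightarrow> p \<in> fst \<kappa> \<inter> fst \<mu> \<Longrightarrow> \<sigma> \<kappa> p = sgn (jac \<kappa> \<mu> p) * \<sigma> \<mu> p"
    by (rule orientation_sign[OF surface(3)], rule that; (assumption | blast))
  interpret I: immersed_surface S A fs by (rule fs)
  interpret O: oriented_immersed_surface S A fs \<sigma> by unfold_locales (use \<sigma> in blast)+
  show ?thesis
  proof (intro exI conjI ballI)
    show "smooth_function A u"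
      unfolding smooth_function_def
    proof
      fix \<kappa> assume \<kappa>: "\<kappa> \<in> A"
      show "smooth_on (chart_image \<kappa>) (u \<circ> chart_inv \<kappa>)"
        by (rule smooth_on_chart[OF \<kappa> smooth_in_subset[OF u oS_sub[OF chart_open[OF \<kappa>]]]]) simp
    qed
    show "area_form S A (O.aform f)" by (rule O.area_form_aform[OF f fpos])
    show "complex_structure S A O.cstr" by (rule O.complex_structure_cstr)
    show "compatible S A (O.aform f) O.cstr" by (rule O.compatible_aform_cstr[OF f fpos])
    show "{p \<in> S. u p = 0} = \<Union>\<C>" by (rule zero)
  next
    fix p v w assume p: "p \<in> S" and t: "v \<in> tangent_space A p" "w \<in> tangent_space A p"
    \<comment> \<open>The factor \<open>f\<close> enters on the left through
      \<open>L u = f u\<close> and on the right through the area form.\<close>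
    show "ext_deriv A (comp_endo (differential A u) O.cstr) p v w = u p * O.aform f p v w"
      unfolding O.ext_deriv_du_rot[OF p t u] lap[OF I.chart_at[OF p]] O.aform_def Let_def by simp
  next
    fix p assume p: "p \<in> S"
    show "0 < (u p)\<^sup>2 + (covector_norm A (metric_of (O.aform f) O.cstr) (differential A u) p)\<^sup>2"
    \<comment> \<open>Only at the zeros of \<open>u\<close> does the norm of the differential have
      to be positive.\<close>
    proof (cases "u p = 0")
      case True
      have "0 < covector_norm A (metric_of (O.aform f) O.cstr) (differential A u) p"
        by (rule O.covector_norm_differential_pos[OF fpos u p]) (use du True in blast)+
      then show ?thesis by (simp add: True)
    next
      case False
      then show ?thesis by (simp add: add_pos_nonneg)
    qed
  qed
qed

end
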